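(* Let $X=X_1\times X_2\times\cdots\times X_r$ be a product of locally compact Hadamard spaces and let $\Gamma<\mathrm{Is}(X_1)\times\cdots\times\mathrm{Is}(X_r)$ be a group which acts properly discontinuously on $X$ and contains two independent regular axial isometries. Then the set $P_\Gamma\subset E$ of slopes of all limit points of $\Gamma$ is equal to $\ell_\Gamma\cap E$. Moreover, the limit cone $\ell_\Gamma$ is convex.
   Context: A Hadamard space is a complete CAT(0) metric space. Let $(X_i,d_i)$, $i=1,\ldots,r$, be locally compact Hadamard spaces, and let $X=X_1\times\cdots\times X_r$ carry the product distance $d=\sqrt{d_1^2+\cdots+d_r^2}$. $\partial X$ denotes the geometric boundary with the cone topology. An isometry $h$ of a Hadamard space $Y$ is axial if there are $l(h)>0$ (translation length) and a geodesic line $\sigma:\mathbb{R}\to Y$ (an axis) with $h(\sigma(t))=\sigma(t+l(h))$ for all $t$; set $h^+=\sigma(\infty)$, $h^-=\sigma(-\infty)$. It is rank one if it has an axis which does not bound a flat half-plane (a closed convex subset of $Y$ isometric to $[0,\infty)\times\mathbb{R}$ whose boundary line is the axis). Two rank one isometries $g,h$ are independent if $\{g^+,g^-\}\cap\{h^+,h^-\}=\emptyset$. An element $h=(h_1,\ldots,h_r)\in\mathrm{Is}(X_1)\times\cdots\times\mathrm{Is}(X_r)$ is regular axial if each $h_i$ is a rank one isometry of $X_i$; its translation vector is $L(h)=(l_1(h),\ldots,l_r(h))\in\mathbb{R}_{>0}^r$, where $l_i(h)$ is the translation length of $h_i$. Two regular axial isometries $g,h$ are independent if $g_i,h_i$ are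 independent for all $i$. $E=\{\theta\in\mathbb{R}_{\ge0}^r:\Vert\theta\Vert=1\}$. Every geodesic ray in $X$ has the form $\sigma(t)=(\sigma_1(\theta_1 t),\ldots,\sigma_r(\theta_r t))$ with $\sigma_i$ geodesic rays in $X_i$ and $\theta\in E$; $\theta$ is its slope and depends only on the class of $\sigma$ in $\partial X$. $L_\Gamma=\overline{\Gamma\cdot x}\cap\partial X$ ($x\in X$ arbitrary) is the geometric limit set; $P_\Gamma\subset E$ is the set of slopes of points of $L_\Gamma$. The limit cone $\ell_\Gamma$ is the closure in $\mathbb{R}_{\ge0}^r$ of the union of the half-lines spanned by the vectors $L(\gamma)$, $\gamma\in\Gamma$ regular axial. *)

theory Defs
  imports "HOL-Analysis.Analysis" "HOL-Algebra.Bij" "HOL-Algebra.Product_Groups"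
begin

no_notation eq_closure_of (\<open>closure'_of\<index>\<close>)

section \<open>Finite products of metric spaces\<close>

definition L2_metric :: "('n::finite \<Rightarrow> 'a metric) \<Rightarrow> ('n \<Rightarrow> 'a) metric" where
  "L2_metric X = metric ({x. \<forall>i. x i \<in> mspace (X i)},
     \<lambda>x y. L2_set (\<lambda>i. mdist (X i) (x i) (y i)) UNIV)"

lemma Metric_space_L2:
  fixes X :: "'n::finite \<Rightarrow> 'a metric"
  shows "Metric_space {x. \<forall>i. x i \<in> mspace (X i)}
    (\<lambda>x y. L2_set (\<lambda>i. mdist (X i) (x i) (y i)) UNIV)"
proof
  fix x y :: "'n \<Rightarrow> 'a"
  show "0 \<le> L2_set (\<lambda>i. mdist (X i) (x i) (y i)) UNIV"
    by (rule L2_set_nonneg)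
  show "L2_set (\<lambda>i. mdist (X i) (x i) (y i)) UNIV = L2_set (\<lambda>i. mdist (X i) (y i) (x i)) UNIV"
    by (simp add: mdist_commute)
next
  fix x y assume "x \<in> {x. \<forall>i. x i \<in> mspace (X i)}" "y \<in> {x. \<forall>i. x i \<in> mspace (X i)}"
  then show "(L2_set (\<lambda>i. mdist (X i) (x i) (y i)) UNIV = 0) = (x = y)"
    by (auto simp: L2_set_eq_0_iff fun_eq_iff)
next
  fix x y z
  assume "x \<in> {x. \<forall>i. x i \<in> mspace (X i)}" "y \<in> {x. \<forall>i. x i \<in> mspace (X i)}"
    "z \<in> {x. \<forall>i. x i \<in> mspace (X i)}"
  then have "L2_set (\<lambda>i. mdist (X i) (x i) (z i)) UNIV
      \<le> L2_set (\<lambda>i. mdist (X i) (x i) (y i) + mdist (X i) (y i) (z i)) UNIV"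
    by (intro L2_set_mono) (auto simp: mdist_triangle)
  also have "\<dots> \<le> L2_set (\<lambda>i. mdist (X i) (x i) (y i)) UNIV
      + L2_set (\<lambda>i. mdist (X i) (y i) (z i)) UNIV"
    by (rule L2_set_triangle_ineq)
  finally show "L2_set (\<lambda>i. mdist (X i) (x i) (z i)) UNIV
      \<le> L2_set (\<lambda>i. mdist (X i) (x i) (y i)) UNIV + L2_set (\<lambda>i. mdist (X i) (y i) (z i)) UNIV" .
qed

lemma mspace_L2_metric [simp]: "mspace (L2_metric X) = {x. \<forall>i. x i \<in> mspace (X i)}"
  unfolding L2_metric_def by (rule Metric_space.mspace_metric[OF Metric_space_L2])

lemma mdist_L2_metric: "mdist (L2_metric X) x y = L2_set (\<lambda>i. mdist (X i) (x i) (y i)) UNIV"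
  unfolding L2_metric_def by (simp add: Metric_space.mdist_metric[OF Metric_space_L2])


section \<open>Geodesics and Hadamard spaces\<close>

text \<open>Geodesics have unit speed. Segments and rays are total functions on the reals of which only
  the values on \<open>[0, d(x,y)]\<close>, respectively on \<open>[0, \<infinity>)\<close>, matter.\<close>

definition geodesic_segment :: "'a metric \<Rightarrow> 'a \<Rightarrow> 'a \<Rightarrow> (real \<Rightarrow> 'a) \<Rightarrow> bool" where
  "geodesic_segment M x y c \<longleftrightarrow>
     c ` {0..mdist M x y} \<subseteq> mspace M \<and> c 0 = x \<and> c (mdist M x y) = y \<and>
     (\<forall>s\<in>{0..mdist M x y}. \<forall>t\<in>{0..mdist M x y}. mdist M (c s) (c t) = \<bar>s - t\<bar>)"

definition geodesic_ray :: "'a metric \<Rightarrow> (real \<Rightarrow> 'a) \<Rightarrow> bool" where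
  "geodesic_ray M c \<longleftrightarrow>
     c ` {0..} \<subseteq> mspace M \<and> (\<forall>s\<ge>0. \<forall>t\<ge>0. mdist M (c s) (c t) = \<bar>s - t\<bar>)"

definition geodesic_line :: "'a metric \<Rightarrow> (real \<Rightarrow> 'a) \<Rightarrow> bool" where
  "geodesic_line M c \<longleftrightarrow> range c \<subseteq> mspace M \<and> (\<forall>s t. mdist M (c s) (c t) = \<bar>s - t\<bar>)"

definition geodesic_space :: "'a metric \<Rightarrow> bool" where
  "geodesic_space M \<longleftrightarrow> (\<forall>x\<in>mspace M. \<forall>y\<in>mspace M. \<exists>c. geodesic_segment M x y c)"

text \<open>In the comparison inequality the points \<open>c s\<close> and \<open>c' t\<close> lie on the sides \<open>[p,q]\<close> and \<open>[p,r]\<close>.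
  Since the vertices are arbitrary, this covers all pairs of distinct sides; for points on the same
  side the inequality is an equality.\<close>

definition CAT0 :: "'a metric \<Rightarrow> bool" where
  "CAT0 M \<longleftrightarrow> geodesic_space M \<and>
     (\<forall>p\<in>mspace M. \<forall>q\<in>mspace M. \<forall>r\<in>mspace M. \<forall>c c'.
        geodesic_segment M p q c \<longrightarrow> geodesic_segment M p r c' \<longrightarrow>
        (\<forall>(p'::real^2) q' r'.
           dist p' q' = mdist M p q \<longrightarrow> dist p' r' = mdist M p r \<longrightarrow> dist q' r' = mdist M q r \<longrightarrow>
           (\<forall>s\<in>{0..mdist M p q}. \<forall>t\<in>{0..mdist M p r}.
            \<forall>x'\<in>closed_segment p' q'. \<forall>y'\<in>closed_segment p' r'.
              dist p' x' = s \<longrightarrow> dist p' y' = t \<longrightarrow> mdist M (c s) (c' t) \<le> dist x' y')))"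

definition Hadamard_space :: "'a metric \<Rightarrow> bool" where
  "Hadamard_space M \<longleftrightarrow> mcomplete_of M \<and> CAT0 M"


section \<open>The geometric boundary and the cone topology\<close>

definition asymptotic_rel :: "'a metric \<Rightarrow> ((real \<Rightarrow> 'a) \<times> (real \<Rightarrow> 'a)) set" where
  "asymptotic_rel M = {(c, c'). geodesic_ray M c \<and> geodesic_ray M c' \<and>
     (\<exists>K. \<forall>t\<ge>0. mdist M (c t) (c' t) \<le> K)}"

definition geometric_boundary :: "'a metric \<Rightarrow> (real \<Rightarrow> 'a) set set" where
  "geometric_boundary M = {c. geodesic_ray M c} // asymptotic_rel M"

definition ray_endpoint :: "'a metric \<Rightarrow> (real \<Rightarrow> 'a) \<Rightarrow> (real \<Rightarrow> 'a) set" where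
  "ray_endpoint M c = asymptotic_rel M `` {c}"

lemma equiv_asymptotic_rel: "equiv {c. geodesic_ray M c} (asymptotic_rel M)"
proof (rule equivI)
  show "asymptotic_rel M \<subseteq> {c. geodesic_ray M c} \<times> {c. geodesic_ray M c}"
    by (auto simp: asymptotic_rel_def)
  show "refl_on {c. geodesic_ray M c} (asymptotic_rel M)"
    by (auto simp: refl_on_def asymptotic_rel_def geodesic_ray_def)
  show "sym (asymptotic_rel M)"
    by (simp add: sym_def asymptotic_rel_def) (metis mdist_commute)
  show "trans (asymptotic_rel M)"
  proof (rule transI)
    fix a b c
    assume ab: "(a, b) \<in> asymptotic_rel M" and bc: "(b, c) \<in> asymptotic_rel M"
    then obtain K K' where K: "\<And>t. t \<ge> 0 \<Longrightarrow> mdist M (a t) (b t) \<le> K"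
        and K': "\<And>t. t \<ge> 0 \<Longrightarrow> mdist M (b t) (c t) \<le> K'"
      by (auto simp: asymptotic_rel_def)
    have "mdist M (a t) (c t) \<le> K + K'" if "t \<ge> 0" for t
    proof -
      have "a t \<in> mspace M" "b t \<in> mspace M" "c t \<in> mspace M"
        using ab bc that by (auto simp: asymptotic_rel_def geodesic_ray_def)
      then show ?thesis
        using mdist_triangle[of "a t" M "b t" "c t"] K[OF that] K'[OF that] by linarith
    qed
    with ab bc show "(a, c) \<in> asymptotic_rel M"
      by (auto simp: asymptotic_rel_def)
  qed
qed

text \<open>The bordification is the disjoint union of \<open>mspace M\<close> (via \<open>Inl\<close>) and the geometric boundary
  (via \<open>Inr\<close>). The set \<open>cone_nbhd M c R \<epsilon>\<close> is Bridson and Haefliger's \<open>U(c,R,\<epsilon>)\<close> (Chapter II.8): it consists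
  of all points outside the closed ball of radius \<open>R\<close> around \<open>c 0\<close> whose projection to that ball has
  distance less than \<open>\<epsilon>\<close> from \<open>c R\<close>. Open balls and the sets \<open>U(c,R,\<epsilon>)\<close> with \<open>c 0\<close> a fixed base point form
  a basis of the cone topology; since the latter does not depend on the base point, all rays may be
  used as a subbasis.\<close>

definition cone_nbhd :: "'a metric \<Rightarrow> (real \<Rightarrow> 'a) \<Rightarrow> real \<Rightarrow> real \<Rightarrow> ('a + (real \<Rightarrow> 'a) set) set" where
  "cone_nbhd M c R \<epsilon> =
     {Inl x |x. x \<in> mspace M \<and> mdist M (c 0) x > R \<and>
        (\<exists>g. geodesic_segment M (c 0) x g \<and> mdist M (g R) (c R) < \<epsilon>)} \<union>
     {Inr \<xi> |\<xi>. \<xi> \<in> geometric_boundary M \<and> (\<exists>g\<in>\<xi>. g 0 = c 0 \<and> mdist M (g R) (c R) < \<epsilon>)}"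

definition cone_topology :: "'a metric \<Rightarrow> ('a + (real \<Rightarrow> 'a) set) topology" where
  "cone_topology M = topology_generated_by
     ({Inl ` {y \<in> mspace M. mdist M x y < \<epsilon>} |x \<epsilon>. x \<in> mspace M} \<union>
      {cone_nbhd M c R \<epsilon> |c R \<epsilon>. geodesic_ray M c \<and> R > 0 \<and> \<epsilon> > 0})"


section \<open>Isometries\<close>

definition isometry_group :: "'a metric \<Rightarrow> ('a \<Rightarrow> 'a) monoid" where
  "isometry_group M = (BijGroup (mspace M))\<lparr>carrier :=
     {f \<in> Bij (mspace M). \<forall>x\<in>mspace M. \<forall>y\<in>mspace M. mdist M (f x) (f y) = mdist M x y}\<rparr>"

lemma group_isometry_group: "group (isometry_group M)"
proof -
  let ?S = "mspace M"
  let ?H = "{f \<in> Bij ?S. \<forall>x\<in>?S. \<forall>y\<in>?S. mdist M (f x) (f y) = mdist M x y}"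
  interpret B: group "BijGroup ?S" by (rule group_BijGroup)
  have "subgroup ?H (BijGroup ?S)"
  proof (rule B.subgroupI)
    show "?H \<subseteq> carrier (BijGroup ?S)" by (auto simp: BijGroup_def)
    show "?H \<noteq> {}" using id_Bij[of ?S] by fastforce
  next
    fix f assume f: "f \<in> ?H"
    then have bij: "bij_betw f ?S ?S" by (simp add: Bij_def)
    have "mdist M (inv_into ?S f x) (inv_into ?S f y) = mdist M x y" if "x \<in> ?S" "y \<in> ?S" for x y
    proof -
      have "inv_into ?S f x \<in> ?S" "inv_into ?S f y \<in> ?S"
        "f (inv_into ?S f x) = x" "f (inv_into ?S f y) = y"
        using that bij_betw_inv_into_right[OF bij] bij_betwE[OF bij_betw_inv_into[OF bij]] by auto
      moreover have "mdist M (f u) (f v) = mdist M u v" if "u \<in> ?S" "v \<in> ?S" for u v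
        using f that by simp
      ultimately show ?thesis by metis
    qed
    then show "inv\<^bsub>BijGroup ?S\<^esub> f \<in> ?H"
      using f by (simp add: inv_BijGroup restrict_inv_into_Bij)
  next
    fix f g assume "f \<in> ?H" "g \<in> ?H"
    then show "f \<otimes>\<^bsub>BijGroup ?S\<^esub> g \<in> ?H"
      using Bij_imp_funcset[of g ?S]
      by (auto simp: BijGroup_def compose_Bij compose_eq Pi_iff)
  qed
  then have "group ((BijGroup ?S)\<lparr>carrier := ?H\<rparr>)"
    by (rule subgroup.subgroup_is_group) (rule B.group_axioms)
  then show ?thesis by (simp only: isometry_group_def)
qed

definition is_axis :: "'a metric \<Rightarrow> ('a \<Rightarrow> 'a) \<Rightarrow> (real \<Rightarrow> 'a) \<Rightarrow> real \<Rightarrow> bool" where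
  "is_axis M h \<sigma> l \<longleftrightarrow> geodesic_line M \<sigma> \<and> l > 0 \<and> (\<forall>t. h (\<sigma> t) = \<sigma> (t + l))"

definition axial :: "'a metric \<Rightarrow> ('a \<Rightarrow> 'a) \<Rightarrow> bool" where
  "axial M h \<longleftrightarrow> h \<in> carrier (isometry_group M) \<and> (\<exists>\<sigma> l. is_axis M h \<sigma> l)"

definition translation_length :: "'a metric \<Rightarrow> ('a \<Rightarrow> 'a) \<Rightarrow> real" where
  "translation_length M h = (THE l. \<exists>\<sigma>. is_axis M h \<sigma> l)"

definition attracting_point :: "'a metric \<Rightarrow> ('a \<Rightarrow> 'a) \<Rightarrow> (real \<Rightarrow> 'a) set" where
  "attracting_point M h = (THE \<xi>. \<exists>\<sigma> l. is_axis M h \<sigma> l \<and> \<xi> = ray_endpoint M \<sigma>)"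

definition repelling_point :: "'a metric \<Rightarrow> ('a \<Rightarrow> 'a) \<Rightarrow> (real \<Rightarrow> 'a) set" where
  "repelling_point M h = (THE \<xi>. \<exists>\<sigma> l. is_axis M h \<sigma> l \<and> \<xi> = ray_endpoint M (\<lambda>t. \<sigma> (- t)))"

text \<open>The descriptions above are well defined: axes of the same isometry have the same translation
  length and stay at bounded distance from each other.\<close>

lemma axes_dist_shift:
  assumes h: "h \<in> carrier (isometry_group M)" and s: "is_axis M h \<sigma> l" and t: "is_axis M h \<tau> m"
  shows "mdist M (\<sigma> (a + of_nat n * l)) (\<tau> (b + of_nat n * m)) = mdist M (\<sigma> a) (\<tau> b)"
proof (induction n)
  case (Suc n)
  have "\<sigma> (a + of_nat (Suc n) * l) = h (\<sigma> (a + of_nat n * l))"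
    and "\<tau> (b + of_nat (Suc n) * m) = h (\<tau> (b + of_nat n * m))"
    using s t by (simp_all add: is_axis_def algebra_simps)
  moreover have "mdist M (h x) (h y) = mdist M x y" if "x \<in> mspace M" "y \<in> mspace M" for x y
    using h that by (simp add: isometry_group_def)
  moreover have "range \<sigma> \<subseteq> mspace M" "range \<tau> \<subseteq> mspace M"
    using s t by (auto simp: is_axis_def geodesic_line_def)
  ultimately show ?case using Suc.IH by (simp add: subset_iff)
qed simp

lemma axes_same_length:
  assumes h: "h \<in> carrier (isometry_group M)" and s: "is_axis M h \<sigma> l" and t: "is_axis M h \<tau> m"
  shows "l = m"
proof (rule ccontr)
  assume "l \<noteq> m"
  define D where "D = mdist M (\<sigma> 0) (\<tau> 0)"
  have sp: "\<And>x. \<sigma> x \<in> mspace M" "\<And>x. \<tau> x \<in> mspace M"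
    and sd: "\<And>x y. mdist M (\<sigma> x) (\<sigma> y) = \<bar>x - y\<bar>" "\<And>x y. mdist M (\<tau> x) (\<tau> y) = \<bar>x - y\<bar>"
    and pos: "l > 0" "m > 0"
    using s t by (auto simp: is_axis_def geodesic_line_def)
  have "of_nat n * \<bar>l - m\<bar> \<le> 2 * D" for n
  proof -
    have e: "mdist M (\<sigma> (of_nat n * l)) (\<tau> (of_nat n * m)) = D"
      using axes_dist_shift[OF h s t, of 0 n 0] by (simp add: D_def)
    have 1: "mdist M (\<sigma> 0) (\<sigma> (of_nat n * l)) = of_nat n * l"
      and 2: "mdist M (\<tau> 0) (\<tau> (of_nat n * m)) = of_nat n * m"
      using pos by (simp_all add: sd)
    let ?s = "\<sigma> (of_nat n * l)" and ?t = "\<tau> (of_nat n * m)"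
    have "mdist M (\<sigma> 0) ?s \<le> mdist M (\<sigma> 0) (\<tau> 0) + mdist M (\<tau> 0) ?s"
      "mdist M (\<tau> 0) ?s \<le> mdist M (\<tau> 0) ?t + mdist M ?t ?s"
      "mdist M (\<tau> 0) ?t \<le> mdist M (\<tau> 0) (\<sigma> 0) + mdist M (\<sigma> 0) ?t"
      "mdist M (\<sigma> 0) ?t \<le> mdist M (\<sigma> 0) ?s + mdist M ?s ?t"
      by (intro mdist_triangle sp)+
    then have "of_nat n * l \<le> D + of_nat n * m + D" "of_nat n * m \<le> D + of_nat n * l + D"
      using e 1 2 mdist_commute[of M "\<tau> 0" "\<sigma> 0"] mdist_commute[of M ?t ?s]
      unfolding D_def by linarith+
    then have "\<bar>of_nat n * (l - m)\<bar> \<le> 2 * D"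
      by (simp add: algebra_simps abs_le_iff)
    then show ?thesis by (simp add: abs_mult)
  qed
  moreover obtain n where "of_nat n * \<bar>l - m\<bar> > 2 * D"
    using reals_Archimedean3[of "\<bar>l - m\<bar>"] \<open>l \<noteq> m\<close> by (metis zero_less_abs_iff right_minus_eq)
  ultimately show False by (meson not_less)
qed

lemma translation_length_eq:
  assumes "h \<in> carrier (isometry_group M)" "is_axis M h \<sigma> l"
  shows "translation_length M h = l"
  unfolding translation_length_def
proof (rule the_equality)
  show "\<exists>\<sigma>. is_axis M h \<sigma> l" using assms(2) by blast
  show "m = l" if "\<exists>\<tau>. is_axis M h \<tau> m" for m
    using that axes_same_length[OF assms(1) _ assms(2)] by auto
qed

lemma axes_bounded:
  assumes h: "h \<in> carrier (isometry_group M)" and s: "is_axis M h \<sigma> l" and t: "is_axis M h \<tau> m"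
  shows "mdist M (\<sigma> x) (\<tau> x) \<le> mdist M (\<sigma> 0) (\<tau> 0) + 2 * l"
proof -
  have m: "m = l" using axes_same_length[OF h s t] by simp
  have sp: "\<And>x. \<sigma> x \<in> mspace M" "\<And>x. \<tau> x \<in> mspace M"
    and sd: "\<And>x y. mdist M (\<sigma> x) (\<sigma> y) = \<bar>x - y\<bar>" "\<And>x y. mdist M (\<tau> x) (\<tau> y) = \<bar>x - y\<bar>"
    and pos: "l > 0"
    using s t by (auto simp: is_axis_def geodesic_line_def)
  define k where "k = \<lfloor>x / l\<rfloor>"
  define n where "n = nat \<bar>k\<bar>"
  define r where "r = x - of_int k * l"
  have "of_int k \<le> x / l" "x / l < of_int k + 1" by (auto simp: k_def)
  then have r: "0 \<le> r" "r \<le> l" using pos by (auto simp: r_def field_simps)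
  have eq: "mdist M (\<sigma> x) (\<tau> x) = mdist M (\<sigma> r) (\<tau> r)"
  proof (cases "k \<ge> 0")
    case True
    then have "r + of_nat n * l = x" by (simp add: r_def n_def)
    then show ?thesis using axes_dist_shift[OF h s t, of r n r] m by simp
  next
    case False
    then have "x + of_nat n * l = r" by (simp add: r_def n_def)
    then show ?thesis using axes_dist_shift[OF h s t, of x n x] m by simp
  qed
  have "mdist M (\<sigma> r) (\<tau> r) \<le> mdist M (\<sigma> r) (\<sigma> 0) + (mdist M (\<sigma> 0) (\<tau> 0) + mdist M (\<tau> 0) (\<tau> r))"
    by (rule order_trans[OF mdist_triangle[OF sp(1) sp(1) sp(2)] add_left_mono])
      (rule mdist_triangle[OF sp(1) sp(2) sp(2)])
  then show ?thesis using eq r by (simp add: sd)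
qed

lemma attracting_point_eq:
  assumes h: "h \<in> carrier (isometry_group M)" and s: "is_axis M h \<sigma> l"
  shows "attracting_point M h = ray_endpoint M \<sigma>"
proof -
  have "ray_endpoint M \<tau> = ray_endpoint M \<sigma>" if t: "is_axis M h \<tau> m" for \<tau> m
  proof -
    have "(\<tau>, \<sigma>) \<in> asymptotic_rel M"
      using s t axes_bounded[OF h t s]
      by (auto simp: asymptotic_rel_def is_axis_def geodesic_line_def geodesic_ray_def)
    then show ?thesis
      unfolding ray_endpoint_def by (rule equiv_class_eq[OF equiv_asymptotic_rel])
  qed
  with s show ?thesis
    unfolding attracting_point_def by (intro the_equality) blast+
qed

lemma repelling_point_eq:
  assumes h: "h \<in> carrier (isometry_group M)" and s: "is_axis M h \<sigma> l"
  shows "repelling_point M h = ray_endpoint M (\<lambda>t. \<sigma> (- t))"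
proof -
  have "ray_endpoint M (\<lambda>t. \<tau> (- t)) = ray_endpoint M (\<lambda>t. \<sigma> (- t))" if t: "is_axis M h \<tau> m" for \<tau> m
  proof -
    have "((\<lambda>t. \<tau> (- t)), (\<lambda>t. \<sigma> (- t))) \<in> asymptotic_rel M"
      using s t axes_bounded[OF h t s]
      by (auto simp: asymptotic_rel_def is_axis_def geodesic_line_def geodesic_ray_def)
    then show ?thesis
      unfolding ray_endpoint_def by (rule equiv_class_eq[OF equiv_asymptotic_rel])
  qed
  with s show ?thesis
    unfolding repelling_point_def by (intro the_equality) blast+
qed

definition geodesically_convex :: "'a metric \<Rightarrow> 'a set \<Rightarrow> bool" where
  "geodesically_convex M F \<longleftrightarrow>
     (\<forall>x\<in>F. \<forall>y\<in>F. \<forall>c. geodesic_segment M x y c \<longrightarrow> c ` {0..mdist M x y} \<subseteq> F)"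

definition bounds_flat_half_plane :: "'a metric \<Rightarrow> (real \<Rightarrow> 'a) \<Rightarrow> bool" where
  "bounds_flat_half_plane M \<sigma> \<longleftrightarrow>
     (\<exists>F. closedin (mtopology_of M) F \<and> geodesically_convex M F \<and>
       (\<exists>f::real \<times> real \<Rightarrow> 'a. f ` ({0..} \<times> UNIV) = F \<and>
          (\<forall>p\<in>{0..} \<times> UNIV. \<forall>q\<in>{0..} \<times> UNIV. mdist M (f p) (f q) = dist p q) \<and>
          f ` ({0} \<times> UNIV) = range \<sigma>))"

definition rank_one :: "'a metric \<Rightarrow> ('a \<Rightarrow> 'a) \<Rightarrow> bool" where
  "rank_one M h \<longleftrightarrow> axial M h \<and> (\<exists>\<sigma> l. is_axis M h \<sigma> l \<and> \<not> bounds_flat_half_plane M \<sigma>)"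

definition independent_rank_one :: "'a metric \<Rightarrow> ('a \<Rightarrow> 'a) \<Rightarrow> ('a \<Rightarrow> 'a) \<Rightarrow> bool" where
  "independent_rank_one M g h \<longleftrightarrow> rank_one M g \<and> rank_one M h \<and>
     {attracting_point M g, repelling_point M g} \<inter> {attracting_point M h, repelling_point M h} = {}"


section \<open>Groups acting on a product\<close>

definition product_isometry_group ::
    "('n::finite \<Rightarrow> 'a metric) \<Rightarrow> ('n \<Rightarrow> 'a \<Rightarrow> 'a) monoid" where
  "product_isometry_group X = product_group UNIV (\<lambda>i. isometry_group (X i))"

definition product_action :: "('n \<Rightarrow> 'a \<Rightarrow> 'a) \<Rightarrow> ('n \<Rightarrow> 'a) \<Rightarrow> ('n \<Rightarrow> 'a)" where
  "product_action h x = (\<lambda>i. h i (x i))"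

definition properly_discontinuous ::
    "('n::finite \<Rightarrow> 'a metric) \<Rightarrow> ('n \<Rightarrow> 'a \<Rightarrow> 'a) set \<Rightarrow> bool" where
  "properly_discontinuous X \<Gamma> \<longleftrightarrow>
     (\<forall>K. compactin (mtopology_of (L2_metric X)) K \<longrightarrow>
        finite {\<gamma> \<in> \<Gamma>. product_action \<gamma> ` K \<inter> K \<noteq> {}})"

definition regular_axial :: "('n::finite \<Rightarrow> 'a metric) \<Rightarrow> ('n \<Rightarrow> 'a \<Rightarrow> 'a) \<Rightarrow> bool" where
  "regular_axial X h \<longleftrightarrow> (\<forall>i. rank_one (X i) (h i))"

definition independent_regular_axial ::
    "('n::finite \<Rightarrow> 'a metric) \<Rightarrow> ('n \<Rightarrow> 'a \<Rightarrow> 'a) \<Rightarrow> ('n \<Rightarrow> 'a \<Rightarrow> 'a) \<Rightarrow> bool" where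
  "independent_regular_axial X g h \<longleftrightarrow> regular_axial X g \<and> regular_axial X h \<and>
     (\<forall>i. independent_rank_one (X i) (g i) (h i))"

definition translation_vector :: "('n::finite \<Rightarrow> 'a metric) \<Rightarrow> ('n \<Rightarrow> 'a \<Rightarrow> 'a) \<Rightarrow> real^'n" where
  "translation_vector X h = (\<chi> i. translation_length (X i) (h i))"

definition slope_sphere :: "(real^'n::finite) set" where
  "slope_sphere = {\<theta>. (\<forall>i. 0 \<le> \<theta> $ i) \<and> norm \<theta> = 1}"

definition has_slope :: "('n::finite \<Rightarrow> 'a metric) \<Rightarrow> (real \<Rightarrow> 'n \<Rightarrow> 'a) \<Rightarrow> real^'n \<Rightarrow> bool" where
  "has_slope X \<sigma> \<theta> \<longleftrightarrow> \<theta> \<in> slope_sphere \<and> geodesic_ray (L2_metric X) \<sigma> \<and>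
     (\<exists>\<rho>. (\<forall>i. geodesic_ray (X i) (\<rho> i)) \<and> (\<forall>t\<ge>0. \<forall>i. \<sigma> t i = \<rho> i (\<theta> $ i * t)))"

text \<open>The geometric limit set, computed from the orbit of the base point \<open>x\<close>.\<close>

definition limit_set :: "('n::finite \<Rightarrow> 'a metric) \<Rightarrow> ('n \<Rightarrow> 'a \<Rightarrow> 'a) set \<Rightarrow> ('n \<Rightarrow> 'a) \<Rightarrow>
    (real \<Rightarrow> 'n \<Rightarrow> 'a) set set" where
  "limit_set X \<Gamma> x = {\<xi> \<in> geometric_boundary (L2_metric X).
     Inr \<xi> \<in> cone_topology (L2_metric X) closure_of (Inl ` ((\<lambda>\<gamma>. product_action \<gamma> x) ` \<Gamma>))}"

definition limit_slopes :: "('n::finite \<Rightarrow> 'a metric) \<Rightarrow> ('n \<Rightarrow> 'a \<Rightarrow> 'a) set \<Rightarrow> ('n \<Rightarrow> 'a) \<Rightarrow>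
    (real^'n) set" where
  "limit_slopes X \<Gamma> x = {\<theta>. \<exists>\<xi>\<in>limit_set X \<Gamma> x. \<exists>\<sigma>\<in>\<xi>. has_slope X \<sigma> \<theta>}"

definition limit_cone :: "('n::finite \<Rightarrow> 'a metric) \<Rightarrow> ('n \<Rightarrow> 'a \<Rightarrow> 'a) set \<Rightarrow> (real^'n) set" where
  "limit_cone X \<Gamma> =
     closure (\<Union>\<gamma>\<in>{\<gamma> \<in> \<Gamma>. regular_axial X \<gamma>}. {s *\<^sub>R translation_vector X \<gamma> |s. s \<ge> 0})"

end

theory Submission
  imports Defs
begin

text \<open>
  Everything rests on an additivity principle for the displacement vectors
  \<open>(d\<^sub>1(x\<^sub>1, \<gamma>\<^sub>1 x\<^sub>1), \<dots>, d\<^sub>r(x\<^sub>r, \<gamma>\<^sub>r x\<^sub>r))\<close> of elements \<open>\<gamma>\<close> of the group. An axis without flat half plane is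
  contracting: a geodesic whose end points project far apart on the axis comes close to it. From two
  independent regular axial elements one obtains \<open>2 r + 1\<close> translated axes such that, in every factor, a
  point projects far out on at most one of them. By the pigeonhole principle, for all \<open>\<gamma>\<close> and \<open>\<gamma>'\<close> one of
  finitely many elements \<open>\<phi>\<close> makes the displacement vector of \<open>\<gamma> \<phi> \<gamma>'\<close> equal to the sum of those of \<open>\<gamma>\<close>
  and \<open>\<gamma>'\<close> up to a bounded error. Likewise, if all displacements of \<open>\<gamma>\<close> are large, one of the \<open>\<gamma> \<phi>\<close> is
  regular axial with translation vector at bounded distance from the displacement vector of \<open>\<gamma>\<close>.
  Hence the limit directions of displacement vectors are exactly the directions of the limit cone, which
  is closed under addition; that the former are the slopes of limit points is a compactness argument.

  Of the \<open>CAT(0)\<close> condition only the inequality of Bruhat and Tits is used, which passes to products.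
  Compactness enters through limits along a fixed free ultrafilter, so that no subsequences occur.
\<close>

section \<open>Limits along an ultrafilter\<close>

text \<open>Contraction is proved by contraposition. If geodesics whose end points project far out
  on both sides could avoid large balls around a point of the axis, their limits would be lines
  parallel to the axis at arbitrarily large distance; the flat strips in between converge to a flat
  half plane. That the limits are parallel to the axis rests on a first use of the hypothesis: far
  past the foot of a point, the distance to it grows along the axis at almost unit rate.

  The obstacle in a product is that one and the same \<phi> has to be good in all factors, although
  the components of \<gamma> are arbitrary isometries. In particular nothing is known about axes of
  \<gamma>. That \<gamma>\<phi> has one is seen from a chain of translates of a contracting line,
  which keeps a minimizing sequence for the displacement bounded. A flat half plane along the new
  axis would contain geodesics at constant large height, while the chain forces them close to the
  axis.\<close>

lemma exists_free_ultrafilter: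
  "\<exists>U. U \<le> (sequentially::nat filter) \<and> U \<noteq> bot \<and>
     (\<forall>P. eventually P U \<or> eventually (\<lambda>n. \<not> P n) U)"
proof -
  let ?A = "{F::nat filter. F \<le> sequentially \<and> F \<noteq> bot}"
  \<comment> \<open>Zorn's lemma is applied to the reversed order, so it yields a minimal proper
    filter.\<close>
  have "\<exists>U\<in>?A. \<forall>F\<in>?A. F \<le> U \<longrightarrow> F = U"
  proof (rule predicate_Zorn)
    show "partial_order_on ?A (relation_of (\<lambda>a b. b \<le> a) ?A)"
      by (rule partial_order_on_relation_ofI) auto
    fix C assume C: "C \<in> Chains (relation_of (\<lambda>a b. b \<le> a) ?A)"
    then have CA: "C \<subseteq> ?A" and tot: "\<And>a b. a \<in> C \<Longrightarrow> b \<in> C \<Longrightarrow> a \<le> b \<or> b \<le> a"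
      by (auto simp: Chains_def relation_of_def)
    show "\<exists>u\<in>?A. \<forall>a\<in>C. u \<le> a"
    proof (cases "C = {}")
      case True then show ?thesis by (intro bexI[of _ sequentially]) auto
    next
      case False
      \<comment> \<open>In a chain, a property that holds eventually for the infimum already does so
        for one member.\<close>
      have "Inf C \<noteq> bot"
      proof
        assume "Inf C = bot"
        then have "eventually (\<lambda>_. False) (Inf C)" by simp
        then obtain b where "b \<in> C" "eventually (\<lambda>_. False) b"
          using eventually_Inf_base[OF False, of "\<lambda>_. False"] tot by (metis order_refl inf.absorb1 inf.absorb2)
        then show False using CA by (auto simp: eventually_False)
      qed
      obtain c where c: "c \<in> C" using False by auto
      have "Inf C \<le> sequentially"
        using Inf_lower[OF c] c CA by (auto intro: order_trans)
      with \<open>Inf C \<noteq> bot\<close> show ?thesis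
        by (intro bexI[of _ "Inf C"]) (auto intro: Inf_lower)
    qed
  qed
  then obtain U where U: "U \<le> sequentially" "U \<noteq> bot"
    and max: "\<And>F. F \<le> sequentially \<Longrightarrow> F \<noteq> bot \<Longrightarrow> F \<le> U \<Longrightarrow> F = U" by auto
  have "eventually P U \<or> eventually (\<lambda>n. \<not> P n) U" for P
  proof (rule disjCI)
    assume n: "\<not> eventually (\<lambda>n. \<not> P n) U"
    \<comment> \<open>If the complement of \<open>P\<close> is not in \<open>U\<close>, restricting
      \<open>U\<close> to \<open>P\<close> leaves a proper filter, which is \<open>U\<close> itself
      by minimality.\<close>
    have ne: "inf U (principal {n. P n}) \<noteq> bot"
    proof
      assume "inf U (principal {n. P n}) = bot"
      then have "eventually (\<lambda>_. False) (inf U (principal {n. P n}))" by simp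
      then show False using n by (simp add: eventually_inf_principal)
    qed
    have "inf U (principal {n. P n}) = U"
      by (rule max[OF _ ne]) (use U in \<open>auto intro: le_infI1\<close>)
    moreover have "eventually P (inf U (principal {n. P n}))"
      by (simp add: eventually_inf_principal)
    ultimately show "eventually P U" by simp
  qed
  with U show ?thesis by blast
qed

definition ufil :: "nat filter" where
  "ufil = (SOME U. U \<le> sequentially \<and> U \<noteq> bot \<and>
     (\<forall>P. eventually P U \<or> eventually (\<lambda>n. \<not> P n) U))"

lemma ufil: "ufil \<le> sequentially" "ufil \<noteq> bot"
    "eventually P ufil \<or> eventually (\<lambda>n. \<not> P n) ufil"
  using someI_ex[OF exists_free_ultrafilter] unfolding ufil_def by blast+

lemma eventually_ufil_not: "\<not> eventually P ufil \<longleftrightarrow> eventually (\<lambda>n. \<not> P n) ufil"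
proof
  assume "eventually (\<lambda>n. \<not> P n) ufil"
  show "\<not> eventually P ufil"
  proof
    assume "eventually P ufil"
    with \<open>eventually (\<lambda>n. \<not> P n) ufil\<close> have "eventually (\<lambda>_. False) ufil"
      by eventually_elim auto
    then show False using ufil(2) by (simp add: eventually_False)
  qed
qed (use ufil(3) in blast)

lemma eventually_ufil: "eventually P sequentially \<Longrightarrow> eventually P ufil"
  using ufil(1) by (rule filter_leD)

lemma tendsto_ufil: "f \<longlonglongrightarrow> l \<Longrightarrow> (f \<longlongrightarrow> l) ufil"
  using ufil(1) by (rule tendsto_mono)

lemma filterlim_ufil: "filterlim f F sequentially \<Longrightarrow> filterlim f F ufil"
  using ufil(1) by (metis filterlim_mono order_refl)

text \<open>Otherwise every point of \<open>K\<close> has a neighbourhood that is missed along the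
  ultrafilter; finitely many of these cover \<open>K\<close>, so \<open>K\<close> itself would be
  missed.\<close>

lemma compactin_ufil_limit:
  assumes K: "compactin T K" and x: "eventually (\<lambda>n. x n \<in> K) ufil"
  shows "\<exists>z\<in>K. \<forall>V. openin T V \<longrightarrow> z \<in> V \<longrightarrow> eventually (\<lambda>n. x n \<in> V) ufil"
proof (rule ccontr)
  assume "\<not> ?thesis"
  then have "\<forall>z\<in>K. \<exists>V. openin T V \<and> z \<in> V \<and> eventually (\<lambda>n. x n \<notin> V) ufil"
    by (simp add: eventually_ufil_not[symmetric])
  then obtain V where V: "\<And>z. z \<in> K \<Longrightarrow> openin T (V z) \<and> z \<in> V z \<and> eventually (\<lambda>n. x n \<notin> V z) ufil"
    by metis
  have "\<exists>F. finite F \<and> F \<subseteq> V ` K \<and> K \<subseteq> \<Union>F"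
    by (rule K[unfolded compactin_def, THEN conjunct2, rule_format]) (use V in blast)
  then obtain F where F: "finite F" "F \<subseteq> V ` K" "K \<subseteq> \<Union>F" by blast
  have "eventually (\<lambda>n. \<forall>W\<in>F. x n \<notin> W) ufil"
    using F(1,2) V by (subst eventually_ball_finite_distrib) auto
  with x have "eventually (\<lambda>_. False) ufil"
    by eventually_elim (use F(3) in blast)
  then show False using ufil(2) by (simp add: eventually_False)
qed

lemma real_ufil_limit:
  fixes f :: "nat \<Rightarrow> real"
  assumes "eventually (\<lambda>n. \<bar>f n\<bar> \<le> B) ufil"
  shows "\<exists>l. (f \<longlongrightarrow> l) ufil"
proof -
  have c: "compactin euclidean {-B..B}" by simp
  have "eventually (\<lambda>n. f n \<in> {-B..B}) ufil" using assms by eventually_elim auto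
  from compactin_ufil_limit[OF c this] show ?thesis
    by (auto simp: tendsto_def)
qed

text \<open>Packages the limit \<open>e\<close> to \<open>0\<close> in first variation and convexity
  arguments, whose error is linear in \<open>e\<close>.\<close>

lemma real_le_if_le_add_scaled:
  fixes a b c :: real
  assumes "\<And>e. 0 < e \<Longrightarrow> e \<le> 1 \<Longrightarrow> a \<le> b + e * c"
  shows "a \<le> b"
proof (rule ccontr)
  assume ab: "\<not> a \<le> b"
  define k where "k = \<bar>c\<bar> + 1"
  have k: "k > 0" "c \<le> k" by (auto simp: k_def)
  define e where "e = min 1 ((a - b) / (2 * k))"
  have e: "0 < e" "e \<le> 1" using ab k by (auto simp: e_def)
  have "e * c \<le> e * k" using e k by (intro mult_left_mono) auto
  also have "\<dots> \<le> ((a - b) / (2 * k)) * k"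
    using k by (intro mult_right_mono) (auto simp: e_def)
  also have "\<dots> = (a - b) / 2" using k by simp
  finally have "e * c \<le> (a - b) / 2" .
  then have "a \<le> b + (a - b) / 2" using assms[OF e] by linarith
  then show False using ab by (simp add: field_simps)
qed

section \<open>Spaces satisfying the inequality of Bruhat and Tits\<close>

text \<open>\<open>CN\<close> is stated for arbitrary ratios and not just midpoints, so geodesics
  come out of it directly. \<open>bounded_limit\<close> is properness; as the ultrafilter is fixed
  once and for all, limits in a product can be taken factor by factor.\<close>

locale CN_space =
  fixes M :: "'a metric"
  assumes CN: "\<And>x y l. x \<in> mspace M \<Longrightarrow> y \<in> mspace M \<Longrightarrow> 0 \<le> l \<Longrightarrow> l \<le> 1 \<Longrightarrow>
      \<exists>z\<in>mspace M. \<forall>w\<in>mspace M. (mdist M z w)\<^sup>2 \<le>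
        (1 - l) * (mdist M x w)\<^sup>2 + l * (mdist M y w)\<^sup>2 - l * (1 - l) * (mdist M x y)\<^sup>2"
    and bounded_limit: "\<And>(x::nat \<Rightarrow> 'a) p r. range x \<subseteq> mspace M \<Longrightarrow> p \<in> mspace M \<Longrightarrow>
      (\<And>n. mdist M p (x n) \<le> r) \<Longrightarrow> \<exists>z\<in>mspace M. ((\<lambda>n. mdist M (x n) z) \<longlongrightarrow> 0) ufil"
begin

abbreviation S where "S \<equiv> mspace M"
abbreviation d where "d \<equiv> mdist M"

lemmas dsym = mdist_commute[of M]
lemmas tri = mdist_triangle[of _ M]
lemma d0[simp]: "x \<in> S \<Longrightarrow> d x x = 0" by simp

lemma tri': "x \<in> S \<Longrightarrow> y \<in> S \<Longrightarrow> z \<in> S \<Longrightarrow> \<bar>d x z - d y z\<bar> \<le> d x y"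
  using tri[of x y z] tri[of y x z] dsym[of x y] by fastforce

text \<open>For \<open>0 \<le> l \<le> 1\<close>, \<open>pt x y l\<close> is the point dividing the geodesic from \<open>x\<close> to \<open>y\<close> in the ratio \<open>l : 1 - l\<close>;
  the inequality determines it uniquely.\<close>

definition pt where
  "pt x y l = (SOME z. z \<in> S \<and> (\<forall>w\<in>S. (d z w)\<^sup>2 \<le>
        (1 - l) * (d x w)\<^sup>2 + l * (d y w)\<^sup>2 - l * (1 - l) * (d x y)\<^sup>2))"

lemma pt_CN':
  assumes "x \<in> S" "y \<in> S" "0 \<le> l" "l \<le> 1"
  shows "pt x y l \<in> S \<and> (\<forall>w\<in>S. (d (pt x y l) w)\<^sup>2 \<le>
        (1 - l) * (d x w)\<^sup>2 + l * (d y w)\<^sup>2 - l * (1 - l) * (d x y)\<^sup>2)"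
  unfolding pt_def by (rule someI_ex) (use CN[OF assms] in blast)

lemma pt_in [simp,intro]: "x \<in> S \<Longrightarrow> y \<in> S \<Longrightarrow> 0 \<le> l \<Longrightarrow> l \<le> 1 \<Longrightarrow> pt x y l \<in> S"
  using pt_CN' by blast

lemma pt_CN: "x \<in> S \<Longrightarrow> y \<in> S \<Longrightarrow> 0 \<le> l \<Longrightarrow> l \<le> 1 \<Longrightarrow> w \<in> S \<Longrightarrow>
   (d (pt x y l) w)\<^sup>2 \<le> (1 - l) * (d x w)\<^sup>2 + l * (d y w)\<^sup>2 - l * (1 - l) * (d x y)\<^sup>2"
  using pt_CN' by blast

text \<open>\<open>CN\<close> at \<open>w = x\<close> and at \<open>w = y\<close> gives the two
  upper bounds, and the triangle inequality leaves no room.\<close>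

lemma d_pt_simps:
  assumes "x \<in> S" "y \<in> S" "0 \<le> l" "l \<le> 1"
  shows "d x (pt x y l) = l * d x y"
    and "d (pt x y l) y = (1 - l) * d x y"
proof -
  have "(d (pt x y l) x)\<^sup>2 \<le> (l * d x y)\<^sup>2"
    using pt_CN[OF assms, of x] assms by (simp add: dsym power2_eq_square algebra_simps)
  then have 1: "d (pt x y l) x \<le> l * d x y" using assms(3) by (meson power2_le_imp_le mult_nonneg_nonneg mdist_nonneg)
  have "(d (pt x y l) y)\<^sup>2 \<le> ((1 - l) * d x y)\<^sup>2"
    using pt_CN[OF assms, of y] assms by (simp add: dsym power2_eq_square algebra_simps)
  then have 2: "d (pt x y l) y \<le> (1 - l) * d x y" using assms(4)
    by (meson power2_le_imp_le mult_nonneg_nonneg mdist_nonneg diff_ge_0_iff_ge)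
  have "d x y \<le> d x (pt x y l) + d (pt x y l) y" using assms by (intro tri) auto
  then show "d x (pt x y l) = l * d x y" "d (pt x y l) y = (1 - l) * d x y"
    using 1 2 dsym[of x "pt x y l"] by (simp_all add: algebra_simps)
qed

text \<open>The two distances make the right-hand side of \<open>CN\<close> at \<open>z\<close>
  vanish.\<close>

lemma pt_unique:
  assumes "x \<in> S" "y \<in> S" "0 \<le> l" "l \<le> 1" "z \<in> S" "d x z = l * d x y" "d z y = (1 - l) * d x y"
  shows "z = pt x y l"
proof -
  have "(d (pt x y l) z)\<^sup>2 \<le> (1 - l) * (l * d x y)\<^sup>2 + l * ((1 - l) * d x y)\<^sup>2 - l * (1 - l) * (d x y)\<^sup>2"
    using pt_CN[OF assms(1-5)] assms(6,7) by (simp add: dsym)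
  also have "\<dots> = 0" by (simp add: power2_eq_square algebra_simps)
  finally have "d (pt x y l) z = 0" by simp
  then show ?thesis using assms by simp
qed

lemma pt_0 [simp]: "x \<in> S \<Longrightarrow> y \<in> S \<Longrightarrow> pt x y 0 = x"
  by (rule pt_unique[symmetric]) auto

lemma pt_1 [simp]: "x \<in> S \<Longrightarrow> y \<in> S \<Longrightarrow> pt x y 1 = y"
  by (rule pt_unique[symmetric]) auto

lemma pt_sym:
  assumes "x \<in> S" "y \<in> S" "0 \<le> l" "l \<le> 1"
  shows "pt y x l = pt x y (1 - l)"
  by (rule pt_unique) (use assms d_pt_simps[of y x l] in \<open>auto simp: dsym\<close>)

lemma pt_pt:
  assumes "x \<in> S" "y \<in> S" "0 \<le> l" "l \<le> 1" "0 \<le> m" "m \<le> 1"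
  shows "pt x (pt x y l) m = pt x y (l * m)"
proof (rule pt_unique)
  let ?z = "pt x (pt x y l) m"
  have z: "?z \<in> S" using assms by auto
  show "0 \<le> l * m" "l * m \<le> 1" using assms by (auto simp: mult_le_one)
  show 1: "d x ?z = l * m * d x y" using assms by (simp add: d_pt_simps)
  have "d ?z y \<le> d ?z (pt x y l) + d (pt x y l) y" using assms z by (intro tri) auto
  also have "\<dots> = (1 - l * m) * d x y" using assms by (simp add: d_pt_simps algebra_simps)
  finally have "d ?z y \<le> (1 - l * m) * d x y" .
  moreover have "d x y \<le> d x ?z + d ?z y" using assms z by (intro tri) auto
  ultimately show "d ?z y = (1 - l * m) * d x y" using 1 by (simp add: algebra_simps)
qed (use assms in auto)

lemma d_pt_pt:
  assumes "x \<in> S" "y \<in> S" "0 \<le> l" "l \<le> 1" "0 \<le> m" "m \<le> 1"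
  shows "d (pt x y l) (pt x y m) = \<bar>l - m\<bar> * d x y"
proof -
  have *: "d (pt x y l) (pt x y m) = (m - l) * d x y" if "l \<le> m" "0 \<le> l" "m \<le> 1" for l m
  proof (cases "m = 0")
    case False
    have "pt x y l = pt x (pt x y m) (l / m)"
      using that False assms by (subst pt_pt) (auto simp: divide_simps)
    moreover have "d (pt x (pt x y m) (l / m)) (pt x y m) = (1 - l / m) * (m * d x y)"
      using that False assms by (subst d_pt_simps) (auto simp: divide_simps d_pt_simps)
    moreover have "(1 - l / m) * (m * d x y) = (m - l) * d x y" using False by (simp add: field_simps)
    ultimately show ?thesis by simp
  qed (use that assms in auto)
  show ?thesis
  proof (cases "l \<le> m")
    case True then show ?thesis using *[of l m] assms by simp
  next
    case False then show ?thesis using *[of m l] assms by (simp add: dsym)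
  qed
qed

text \<open>\<open>CN\<close> is applied at \<open>pt x y l\<close> and again at
  \<open>pt x z l\<close>; the terms with \<open>d x y\<close> and \<open>d x z\<close>
  cancel.\<close>

lemma pt_common_start_dist:
  assumes "x \<in> S" "y \<in> S" "z \<in> S" "0 \<le> l" "l \<le> 1"
  shows "d (pt x y l) (pt x z l) \<le> l * d y z"
proof -
  let ?q = "pt x z l"
  have q: "?q \<in> S" using assms by auto
  have 1: "(d (pt x y l) ?q)\<^sup>2 \<le> (1 - l) * (d x ?q)\<^sup>2 + l * (d y ?q)\<^sup>2 - l * (1 - l) * (d x y)\<^sup>2"
    using assms by (intro pt_CN) auto
  have 2: "(d y ?q)\<^sup>2 \<le> (1 - l) * (d x y)\<^sup>2 + l * (d y z)\<^sup>2 - l * (1 - l) * (d x z)\<^sup>2"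
    using pt_CN[of x z l y] assms by (simp add: dsym)
  have 3: "d x ?q = l * d x z" using assms by (simp add: d_pt_simps)
  have "l * (d y ?q)\<^sup>2 \<le> l * ((1 - l) * (d x y)\<^sup>2 + l * (d y z)\<^sup>2 - l * (1 - l) * (d x z)\<^sup>2)"
    using 2 assms by (intro mult_left_mono) auto
  with 1 3 have "(d (pt x y l) ?q)\<^sup>2 \<le> (l * d y z)\<^sup>2"
    by (simp add: power2_eq_square algebra_simps)
  then show ?thesis using assms by (meson power2_le_imp_le mult_nonneg_nonneg mdist_nonneg)
qed

text \<open>The diagonal from \<open>x\<close> to \<open>y'\<close> cuts the quadrilateral into two
  triangles, each covered by \<open>pt_common_start_dist\<close>.\<close>

lemma pt_dist_convex:
  assumes "x \<in> S" "y \<in> S" "x' \<in> S" "y' \<in> S" "0 \<le> l" "l \<le> 1"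
  shows "d (pt x y l) (pt x' y' l) \<le> (1 - l) * d x x' + l * d y y'"
proof -
  have "d (pt x y l) (pt x y' l) \<le> l * d y y'" using assms by (intro pt_common_start_dist) auto
  moreover have "d (pt x y' l) (pt x' y' l) \<le> (1 - l) * d x x'"
    using pt_common_start_dist[of y' x x' "1 - l"] pt_sym[of y' x l] pt_sym[of y' x' l] assms by simp
  moreover have "d (pt x y l) (pt x' y' l) \<le> d (pt x y l) (pt x y' l) + d (pt x y' l) (pt x' y' l)"
    using assms by (intro tri) auto
  ultimately show ?thesis by linarith
qed

text \<open>The midpoint of the diagonal from \<open>p\<close> to \<open>r\<close> is compared with
  \<open>q\<close> and \<open>s\<close>, followed by \<open>(a + b)^2 \<le> 2 (a^2 + b^2)\<close>.
  It takes the place of comparison angles for projections and parallel lines.\<close>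

lemma quadrilateral_ineq:
  assumes "p \<in> S" "q \<in> S" "r \<in> S" "s \<in> S"
  shows "(d p r)\<^sup>2 + (d q s)\<^sup>2 \<le> (d p q)\<^sup>2 + (d q r)\<^sup>2 + (d r s)\<^sup>2 + (d s p)\<^sup>2"
proof -
  let ?m = "pt p r (1/2)"
  have m: "?m \<in> S" using assms by auto
  have 1: "(d ?m q)\<^sup>2 \<le> (d p q)\<^sup>2 / 2 + (d r q)\<^sup>2 / 2 - (d p r)\<^sup>2 / 4"
    using pt_CN[of p r "1/2" q] assms by simp
  have 2: "(d ?m s)\<^sup>2 \<le> (d p s)\<^sup>2 / 2 + (d r s)\<^sup>2 / 2 - (d p r)\<^sup>2 / 4"
    using pt_CN[of p r "1/2" s] assms by simp
  have "d q s \<le> d ?m q + d ?m s" using tri[of q ?m s] assms m by (simp add: dsym)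
  then have "(d q s)\<^sup>2 \<le> (d ?m q + d ?m s)\<^sup>2" by (intro power_mono) auto
  also have "\<dots> \<le> 2 * ((d ?m q)\<^sup>2 + (d ?m s)\<^sup>2)"
    using sum_squares_bound[of "d ?m q" "d ?m s"] by (simp add: power2_eq_square algebra_simps)
  finally show ?thesis using 1 2 by (simp add: dsym algebra_simps)
qed

lemma seg_pt:
  assumes "x \<in> S" "y \<in> S" "geodesic_segment M x y c" "0 \<le> s" "s \<le> d x y"
  shows "c s = pt x y (s / d x y)"
proof (cases "d x y = 0")
  case True
  then have "s = 0" using assms by auto
  then show ?thesis using assms True by (simp add: geodesic_segment_def)
next
  case False
  then have p: "d x y > 0" using mdist_nonneg[of M x y] by linarith
  have cs: "c s \<in> S" and c0: "c 0 = x" "c (d x y) = y"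
    and dd: "\<And>s t. s \<in> {0..d x y} \<Longrightarrow> t \<in> {0..d x y} \<Longrightarrow> d (c s) (c t) = \<bar>s - t\<bar>"
    using assms unfolding geodesic_segment_def by (auto simp: image_subset_iff)
  have "d x (c s) = s" using dd[of 0 s] assms c0 by simp
  moreover have "d (c s) y = d x y - s" using dd[of s "d x y"] assms c0 p by simp
  ultimately show ?thesis using assms cs p
    by (intro pt_unique) (auto simp: field_simps)
qed

lemma pt_seg:
  assumes "x \<in> S" "y \<in> S"
  shows "geodesic_segment M x y (\<lambda>s. pt x y (s / d x y))"
proof (cases "d x y = 0")
  case True
  then have "x = y" using assms by simp
  then show ?thesis using assms by (auto simp: geodesic_segment_def)
next
  case False
  then have "d x y > 0" using mdist_nonneg[of M x y] by linarith
  then show ?thesis using assms unfolding geodesic_segment_def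
    by (auto simp: d_pt_pt abs_if field_simps)
qed

text \<open>Membership in \<open>S\<close> is only required along the ultrafilter, since the
  sequences met below are given by \<open>pt\<close> with ratios that lie between \<open>0\<close>
  and \<open>1\<close> only eventually.\<close>

definition uconv :: "(nat \<Rightarrow> 'a) \<Rightarrow> 'a \<Rightarrow> bool" where
  "uconv x z \<longleftrightarrow> z \<in> S \<and> eventually (\<lambda>n. x n \<in> S) ufil \<and> ((\<lambda>n. d (x n) z) \<longlongrightarrow> 0) ufil"

lemma uconv_in: "uconv x z \<Longrightarrow> z \<in> S"
  by (simp add: uconv_def)

lemma uconv_bounded:
  assumes "p \<in> S" "eventually (\<lambda>n. x n \<in> S \<and> d p (x n) \<le> r) ufil"
  shows "\<exists>z. uconv x z"
proof -
  \<comment> \<open>\<open>bounded_limit\<close> wants a bound for every index, so exceptional terms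
    are replaced by \<open>p\<close>.\<close>
  define y where "y n = (if x n \<in> S \<and> d p (x n) \<le> r then x n else p)" for n
  have "\<exists>z\<in>S. ((\<lambda>n. d (y n) z) \<longlongrightarrow> 0) ufil"
    by (rule bounded_limit[of y p "max r 0"]) (use assms in \<open>auto simp: y_def\<close>)
  then obtain z where z: "z \<in> S" "((\<lambda>n. d (y n) z) \<longlongrightarrow> 0) ufil" by auto
  have "((\<lambda>n. d (x n) z) \<longlongrightarrow> 0) ufil"
    using z(2) by (rule tendsto_cong[THEN iffD1, rotated]) (use assms(2) in eventually_elim, auto simp: y_def)
  moreover have "eventually (\<lambda>n. x n \<in> S) ufil" using assms(2) by eventually_elim auto
  ultimately show ?thesis using z by (auto simp: uconv_def)
qed

lemma uconv_const: "x \<in> S \<Longrightarrow> uconv (\<lambda>n. x) x"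
  by (simp add: uconv_def)

lemma uconv_dist:
  assumes "uconv x z" "uconv y w"
  shows "((\<lambda>n. d (x n) (y n)) \<longlongrightarrow> d z w) ufil"
proof (rule LIM_zero_cancel)
  have 0: "((\<lambda>n. d (x n) z + d (y n) w) \<longlongrightarrow> 0 + 0) ufil"
    using assms by (intro tendsto_add) (auto simp: uconv_def)
  have zw: "z \<in> S" "w \<in> S" and xs: "eventually (\<lambda>n. x n \<in> S) ufil" and ys: "eventually (\<lambda>n. y n \<in> S) ufil"
    using assms by (auto simp: uconv_def)
  have "eventually (\<lambda>n. norm (d (x n) (y n) - d z w) \<le> d (x n) z + d (y n) w) ufil"
    using xs ys
  proof eventually_elim
    case (elim n)
    have "d z w \<le> d z (x n) + (d (x n) (y n) + d (y n) w)"
      using tri[of z "x n" w] tri[of "x n" "y n" w] elim zw by auto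
    moreover have "d (x n) (y n) \<le> d (x n) z + (d z w + d w (y n))"
      using tri[of "x n" z "y n"] tri[of z w "y n"] elim zw by auto
    ultimately show ?case by (simp add: dsym)
  qed
  then show "((\<lambda>n. d (x n) (y n) - d z w) \<longlongrightarrow> 0) ufil"
    by (rule Lim_null_comparison) (use 0 in simp)
qed

lemma uconv_eq:
  assumes "uconv x z" "uconv y w" "((\<lambda>n. d (x n) (y n)) \<longlongrightarrow> l) ufil"
  shows "d z w = l"
  using tendsto_unique[OF ufil(2) uconv_dist[OF assms(1,2)] assms(3)] .

lemma uconv_le:
  assumes "uconv x z" "uconv y w" "(f \<longlongrightarrow> l) ufil" "eventually (\<lambda>n. d (x n) (y n) \<le> f n) ufil"
  shows "d z w \<le> l"
  using tendsto_le[OF ufil(2) assms(3) uconv_dist[OF assms(1,2)] assms(4)] .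

lemma uconv_sq_le:
  assumes "uconv x z" "uconv y w" "(f \<longlongrightarrow> l) ufil" "eventually (\<lambda>n. (d (x n) (y n))\<^sup>2 \<le> f n) ufil"
  shows "(d z w)\<^sup>2 \<le> l"
  using tendsto_le[OF ufil(2) assms(3) tendsto_power[OF uconv_dist[OF assms(1,2)]] assms(4)] .

lemma uconv_unique: "uconv x z \<Longrightarrow> uconv x w \<Longrightarrow> z = w"
proof -
  assume a: "uconv x z" "uconv x w"
  have "d z w \<le> 0"
    by (rule uconv_le[OF a tendsto_const]) (use a in \<open>auto simp: uconv_def elim: eventually_mono\<close>)
  then show "z = w" using a mdist_nonneg[of M z w] by (auto simp: uconv_def)
qed

text \<open>\<open>CN\<close> used on each of the two segments. The right-hand side is the exact
  value in Euclidean space, so it is the right upper bound for flat strips.\<close>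

lemma CN_pt_pt:
  assumes "p \<in> S" "q \<in> S" "p' \<in> S" "q' \<in> S" "0 \<le> a" "a \<le> 1" "0 \<le> b" "b \<le> 1"
  shows "(d (pt p q a) (pt p' q' b))\<^sup>2 \<le> (1-a)*(1-b)*(d p p')\<^sup>2 + (1-a)*b*(d p q')\<^sup>2 + a*(1-b)*(d q p')\<^sup>2
     + a*b*(d q q')\<^sup>2 - b*(1-b)*(d p' q')\<^sup>2 - a*(1-a)*(d p q)\<^sup>2"
proof -
  let ?z = "pt p q a"
  have z: "?z \<in> S" using assms by auto
  have 1: "(d ?z (pt p' q' b))\<^sup>2 \<le> (1-b)*(d ?z p')\<^sup>2 + b*(d ?z q')\<^sup>2 - b*(1-b)*(d p' q')\<^sup>2"
    using pt_CN[of p' q' b ?z] assms z by (simp add: dsym)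
  have "(1-b)*(d ?z p')\<^sup>2 \<le> (1-b)*((1-a)*(d p p')\<^sup>2 + a*(d q p')\<^sup>2 - a*(1-a)*(d p q)\<^sup>2)"
    using pt_CN[of p q a p'] assms by (intro mult_left_mono) auto
  moreover have "b*(d ?z q')\<^sup>2 \<le> b*((1-a)*(d p q')\<^sup>2 + a*(d q q')\<^sup>2 - a*(1-a)*(d p q)\<^sup>2)"
    using pt_CN[of p q a q'] assms by (intro mult_left_mono) auto
  ultimately show ?thesis using 1 by (simp add: algebra_simps)
qed

subsection \<open>Projection to lines and flat strips\<close>

abbreviation line where "line \<equiv> geodesic_line M"

lemma line_in [simp]: "line s \<Longrightarrow> s t \<in> S"
  by (auto simp: geodesic_line_def)

lemma line_d: "line s \<Longrightarrow> d (s a) (s b) = \<bar>a - b\<bar>"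
  by (auto simp: geodesic_line_def)

lemma line_shift: "line s \<Longrightarrow> line (\<lambda>t. s (t + c))"
  by (auto simp: geodesic_line_def)

lemma line_rev: "line s \<Longrightarrow> line (\<lambda>t. s (- t))"
  by (auto simp: geodesic_line_def)

lemma line_pt: "line s \<Longrightarrow> 0 \<le> l \<Longrightarrow> l \<le> 1 \<Longrightarrow> pt (s a) (s b) l = s ((1 - l) * a + l * b)"
proof (rule pt_unique[symmetric])
  assume *: "line s" "0 \<le> l" "l \<le> 1"
  have "a - ((1 - l) * a + l * b) = l * (a - b)" "(1 - l) * a + l * b - b = (1 - l) * (a - b)"
    by (simp_all add: algebra_simps)
  with * show "d (s a) (s ((1 - l) * a + l * b)) = l * d (s a) (s b)"
    "d (s ((1 - l) * a + l * b)) (s b) = (1 - l) * d (s a) (s b)"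
    by (simp_all add: line_d abs_mult)
qed auto

lemma line_CN:
  assumes "line s" "0 \<le> l" "l \<le> 1" "x \<in> S"
  shows "(d x (s ((1 - l) * a + l * b)))\<^sup>2 \<le> (1-l) * (d x (s a))\<^sup>2 + l * (d x (s b))\<^sup>2 - l*(1-l)*(a-b)\<^sup>2"
  using pt_CN[of "s a" "s b" l x] assms by (simp add: line_pt line_d dsym)

lemma line_continuous:
  assumes "line s" "x \<in> S"
  shows "continuous_on A (\<lambda>t. d x (s t))"
proof (rule continuous_on_subset[of UNIV])
  show "continuous_on UNIV (\<lambda>t. d x (s t))"
    unfolding continuous_on_iff
  proof (intro ballI allI impI)
    fix t and e :: real assume "0 < e"
    have "dist (d x (s u)) (d x (s t)) \<le> dist u t" for u
      using tri'[of "s u" "s t" x] assms by (simp add: line_d dist_real_def dsym)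
    with \<open>0 < e\<close> show "\<exists>\<delta>>0. \<forall>u\<in>UNIV. dist u t < \<delta> \<longrightarrow> dist (d x (s u)) (d x (s t)) < e"
      by (meson order_le_less_trans)
  qed
qed auto

text \<open>The projection of a point to a line is recorded by its parameter.\<close>

definition prj where "prj s x = (SOME a. \<forall>t. d x (s a) \<le> d x (s t))"

lemma prj_ex:
  assumes "line s" "x \<in> S"
  shows "\<exists>a. \<forall>t. d x (s a) \<le> d x (s t)"
proof -
  \<comment> \<open>For parameters beyond \<open>B\<close> the triangle inequality gives a distance
    larger than that to \<open>s 0\<close>, so the minimum over the compact interval is
    global.\<close>
  define B where "B = 2 * d x (s 0)"
  have "\<exists>a\<in>{-B..B}. \<forall>t\<in>{-B..B}. d x (s a) \<le> d x (s t)"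
    by (rule continuous_attains_inf) (auto simp: B_def intro: line_continuous[OF assms])
  then obtain a where a: "a \<in> {-B..B}" "\<And>t. t \<in> {-B..B} \<Longrightarrow> d x (s a) \<le> d x (s t)" by auto
  have "d x (s a) \<le> d x (s t)" for t
  proof (cases "t \<in> {-B..B}")
    case False
    then have "\<bar>t\<bar> > B" by auto
    moreover have "\<bar>t\<bar> \<le> d x (s 0) + d x (s t)"
      using tri[of "s 0" x "s t"] assms by (simp add: line_d dsym)
    moreover have "d x (s a) \<le> d x (s 0)" using a(2)[of 0] by (simp add: B_def)
    ultimately show ?thesis by (simp add: B_def)
  qed (use a in auto)
  then show ?thesis by blast
qed

lemma prj_min: "line s \<Longrightarrow> x \<in> S \<Longrightarrow> d x (s (prj s x)) \<le> d x (s t)"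
  using someI_ex[OF prj_ex[of s x]] unfolding prj_def by blast

text \<open>First variation: the foot is compared with the point a fraction \<open>e\<close> of the
  way to \<open>s t\<close>, the result is divided by \<open>e\<close>, and \<open>e\<close> tends
  to \<open>0\<close>. Geometrically, the angle at the foot is at least a right angle.\<close>

lemma nearest_pythagoras:
  assumes "line s" "x \<in> S" "\<And>t. d x (s a) \<le> d x (s t)"
  shows "(d x (s a))\<^sup>2 + (t - a)\<^sup>2 \<le> (d x (s t))\<^sup>2"
proof (rule real_le_if_le_add_scaled)
  fix e :: real assume e: "0 < e" "e \<le> 1"
  have "(d x (s a))\<^sup>2 \<le> (d x (s ((1 - e) * a + e * t)))\<^sup>2"
    using assms by (intro power_mono) auto
  also have "\<dots> \<le> (1-e) * (d x (s a))\<^sup>2 + e * (d x (s t))\<^sup>2 - e*(1-e)*(a-t)\<^sup>2"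
    using assms e by (intro line_CN) auto
  finally have "e * ((d x (s a))\<^sup>2 + (1-e) * (a-t)\<^sup>2) \<le> e * (d x (s t))\<^sup>2" by (simp add: algebra_simps)
  then have "(d x (s a))\<^sup>2 + (1-e) * (a-t)\<^sup>2 \<le> (d x (s t))\<^sup>2" using e by simp
  then show "(d x (s a))\<^sup>2 + (t - a)\<^sup>2 \<le> (d x (s t))\<^sup>2 + e * (t - a)\<^sup>2"
    by (simp add: algebra_simps power2_commute)
qed

lemma prj_eqI:
  assumes "line s" "x \<in> S" "\<And>t. d x (s a) \<le> d x (s t)"
  shows "prj s x = a"
proof -
  have "(d x (s a))\<^sup>2 + (prj s x - a)\<^sup>2 \<le> (d x (s (prj s x)))\<^sup>2" using assms by (rule nearest_pythagoras)
  also have "\<dots> \<le> (d x (s a))\<^sup>2" using prj_min assms by (intro power_mono) auto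
  finally show ?thesis by simp
qed

lemma prj_pythagoras:
  assumes "line s" "x \<in> S"
  shows "(d x (s (prj s x)))\<^sup>2 + (t - prj s x)\<^sup>2 \<le> (d x (s t))\<^sup>2"
  by (rule nearest_pythagoras) (use assms prj_min in auto)

lemma prj_line: "line s \<Longrightarrow> prj s (s t) = t"
  by (rule prj_eqI) (auto simp: line_d)

lemma prj_between:
  assumes "line s" "x \<in> S" "z \<in> S" "d x z + d z (s (prj s x)) = d x (s (prj s x))"
  shows "prj s z = prj s x"
proof (rule prj_eqI)
  fix t
  have "d x (s (prj s x)) \<le> d x (s t)" "d x (s t) \<le> d x z + d z (s t)"
    using assms by (auto intro: prj_min tri)
  then show "d z (s (prj s x)) \<le> d z (s t)" using assms(4) by linarith
qed (use assms in auto)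

lemma prj_pt:
  assumes "line s" "x \<in> S" "0 \<le> l" "l \<le> 1"
  shows "prj s (pt x (s (prj s x)) l) = prj s x"
  by (rule prj_between) (use assms in \<open>auto simp: d_pt_simps algebra_simps\<close>)

text \<open>In the quadrilateral of the two points and their feet, \<open>prj_pythagoras\<close>
  bounds both diagonals from below.\<close>

lemma prj_lip:
  assumes "line s" "x \<in> S" "y \<in> S"
  shows "\<bar>prj s x - prj s y\<bar> \<le> d x y"
proof -
  let ?a = "prj s x" and ?b = "prj s y"
  have "(d x (s ?b))\<^sup>2 + (d y (s ?a))\<^sup>2 \<le> (d x y)\<^sup>2 + (d y (s ?b))\<^sup>2 + (d (s ?b) (s ?a))\<^sup>2 + (d (s ?a) x)\<^sup>2"
    using quadrilateral_ineq[of x y "s ?b" "s ?a"] assms by simp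
  moreover have "(d x (s ?a))\<^sup>2 + (?b - ?a)\<^sup>2 \<le> (d x (s ?b))\<^sup>2" "(d y (s ?b))\<^sup>2 + (?a - ?b)\<^sup>2 \<le> (d y (s ?a))\<^sup>2"
    using assms by (auto intro: prj_pythagoras)
  ultimately have "(?a - ?b)\<^sup>2 \<le> (d x y)\<^sup>2"
    using assms by (simp add: line_d dsym power2_commute)
  then show ?thesis by (metis abs_le_square_iff abs_of_nonneg mdist_nonneg)
qed

lemma prj_rev:
  assumes "line s" "x \<in> S" shows "prj (\<lambda>t. s (- t)) x = - prj s x"
  by (rule prj_eqI) (use assms prj_min in \<open>auto intro: line_rev\<close>)

text \<open>A bounded convex function on the whole real line is constant.\<close>

lemma bounded_parallel_const:
  assumes "line s" "line r" "\<And>t. d (s t) (r t) \<le> K"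
  shows "d (s t) (r t) = d (s u) (r u)"
proof -
  have *: "d (s t') (r t') \<le> d (s t) (r t)" for t t'
  proof (rule real_le_if_le_add_scaled)
    fix e :: real assume e: "0 < e" "e \<le> 1"
    \<comment> \<open>\<open>t'\<close> lies a fraction \<open>e\<close> of the way from
      \<open>t\<close> to the far parameter \<open>T\<close>, where the distance is still at most
      \<open>K\<close>.\<close>
    define T where "T = t + (t' - t) / e"
    have t': "t' = (1 - e) * t + e * T" using e by (simp add: T_def field_simps)
    have "d (pt (s t) (s T) e) (pt (r t) (r T) e) \<le> (1 - e) * d (s t) (r t) + e * d (s T) (r T)"
      using assms e by (intro pt_dist_convex) auto
    also have "\<dots> \<le> d (s t) (r t) + e * K"
      using e assms(3)[of T] by (intro add_mono mult_left_mono) (auto simp: mult_left_le_one_le)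
    finally show "d (s t') (r t') \<le> d (s t) (r t) + e * K"
      using e assms by (simp add: line_pt t')
  qed
  show ?thesis using *[of t u] *[of u t] by simp
qed

text \<open>First half of the flat strip theorem. By \<open>bounded_parallel_const\<close>, applied
  to shifted lines, the distance depends on \<open>u - t\<close> only.\<close>

lemma parallel_lines:
  assumes "line s" "line r" "\<And>t. d (s t) (r t) \<le> K"
  shows "\<exists>a w. 0 \<le> w \<and> (\<forall>u t. (d (s u) (r t))\<^sup>2 = w\<^sup>2 + (u - t - a)\<^sup>2)"
proof -
  have const: "d (s (t + c)) (r t) = d (s (u + c)) (r u)" for c t u
  proof (rule bounded_parallel_const[OF line_shift[OF assms(1)] assms(2)])
    fix v show "d (s (v + c)) (r v) \<le> \<bar>c\<bar> + K"
      using tri[of "s (v + c)" "s v" "r v"] assms(3)[of v] assms(1,2) by (simp add: line_d)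
  qed
  define a where "a = prj s (r 0)"
  define w where "w = d (r 0) (s a)"
  have w: "d (s (t + a)) (r t) = w" for t using const[of t a 0] by (simp add: w_def dsym)
  have lo: "w\<^sup>2 + (u - t - a)\<^sup>2 \<le> (d (s u) (r t))\<^sup>2" for u t
  proof -
    have "d (s u) (r t) = d (s (u - t)) (r 0)" using const[of t "u - t" 0] by simp
    then show ?thesis
      using prj_pythagoras[OF assms(1), of "r 0" "u - t"] assms by (simp add: w_def a_def dsym)
  qed
  have "(d (s u) (r t))\<^sup>2 = w\<^sup>2 + (u - t - a)\<^sup>2" for u t
  proof -
    \<comment> \<open>The four points are the corners of the expected rectangle with sides
      \<open>w\<close> and \<open>\<bar>u - t - a\<bar>\<close>. Neither diagonal is shorter than
      Pythagoras predicts, so the bound on their sum is attained by both.\<close>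
    define v where "v = u - a"
    have "(d (s u) (r t))\<^sup>2 + (d (r v) (s (t + a)))\<^sup>2 \<le>
        (d (s u) (r v))\<^sup>2 + (d (r v) (r t))\<^sup>2 + (d (r t) (s (t + a)))\<^sup>2 + (d (s (t + a)) (s u))\<^sup>2"
      using assms quadrilateral_ineq[of "s u" "r v" "r t" "s (t+a)"] by simp
    moreover have "(d (s u) (r v))\<^sup>2 = w\<^sup>2" "(d (r t) (s (t + a)))\<^sup>2 = w\<^sup>2"
      using w[of v] w[of t] by (simp_all add: v_def dsym)
    moreover have "w\<^sup>2 + (u - t - a)\<^sup>2 \<le> (d (r v) (s (t + a)))\<^sup>2"
      using lo[of "t + a" v] by (simp add: dsym v_def power2_commute algebra_simps)
    moreover have "(d (r v) (r t))\<^sup>2 = (u - t - a)\<^sup>2" "(d (s (t + a)) (s u))\<^sup>2 = (u - t - a)\<^sup>2"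
      using assms by (simp_all add: line_d v_def power2_commute algebra_simps)
    ultimately show ?thesis using lo[of u t] by linarith
  qed
  moreover have "0 \<le> w" by (simp add: w_def)
  ultimately show ?thesis by blast
qed

text \<open>The upper bound is \<open>CN_pt_pt\<close>. For the lower bound each curve
  \<open>?F u\<close> of constant height is shown to be a line, and \<open>prj_pythagoras\<close> is
  applied to the projection onto it.\<close>

lemma flat_strip:
  assumes s: "line s" and r: "line r" and w: "w > 0"
    and D: "\<And>u t. (d (s u) (r t))\<^sup>2 = w\<^sup>2 + (u - t)\<^sup>2"
    and u: "0 \<le> u" "u \<le> w" "0 \<le> u'" "u' \<le> w"
  shows "(d (pt (s t) (r t) (u / w)) (pt (s t') (r t') (u' / w)))\<^sup>2 = (u - u')\<^sup>2 + (t - t')\<^sup>2"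
proof -
  let ?F = "\<lambda>u t. pt (s t) (r t) (u / w)"
  have Fin: "?F u t \<in> S" if "0 \<le> u" "u \<le> w" for u t using that w s r by auto
  have dw: "d (s t) (r t) = w" for t
    using D[of t t] w mdist_nonneg[of M "s t" "r t"] by (simp add: power2_eq_iff_nonneg)
  have up: "(d (?F u t) (?F u' t'))\<^sup>2 \<le> (u - u')\<^sup>2 + (t - t')\<^sup>2"
    if "0 \<le> u" "u \<le> w" "0 \<le> u'" "u' \<le> w" for u u' t t'
  proof -
    define a b where "a = u / w" and "b = u' / w"
    have ab: "u = a * w" "u' = b * w" "0 \<le> a" "a \<le> 1" "0 \<le> b" "b \<le> 1" using that w by (auto simp: a_def b_def)
    have "(d (r t) (s t'))\<^sup>2 = w\<^sup>2 + (t - t')\<^sup>2" using D[of t' t] by (simp add: dsym power2_commute)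
    then have "(d (?F u t) (?F u' t'))\<^sup>2 \<le> (1-a)*(1-b)*(t-t')\<^sup>2 + (1-a)*b*(w\<^sup>2+(t-t')\<^sup>2) + a*(1-b)*(w\<^sup>2+(t-t')\<^sup>2)
     + a*b*(t-t')\<^sup>2 - b*(1-b)*w\<^sup>2 - a*(1-a)*w\<^sup>2"
      using CN_pt_pt[of "s t" "r t" "s t'" "r t'" a b] ab(3-6) s r
      by (simp add: D dw line_d flip: a_def b_def)
    also have "\<dots> = (u - u')\<^sup>2 + (t - t')\<^sup>2" unfolding ab(1,2) by (simp add: power2_eq_square algebra_simps)
    finally show ?thesis .
  qed
  have sF: "d (s t) (?F u t) = u" if "0 \<le> u" "u \<le> w" for u t
    using that w s r by (simp add: d_pt_simps dw)
  have pr: "prj s (r t) = t" for t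
  proof (rule prj_eqI)
    fix v have "(d (r t) (s t))\<^sup>2 \<le> (d (r t) (s v))\<^sup>2" using D[of v t] D[of t t] by (simp add: dsym)
    then show "d (r t) (s t) \<le> d (r t) (s v)" by (rule power2_le_imp_le) simp
  qed (use s r in auto)
  have prF: "prj s (?F u t) = t" if "0 \<le> u" "u \<le> w" for u t
  proof -
    have "prj s (?F u t) = prj s (r t)"
      by (rule prj_between) (use that w s r in \<open>auto simp: pr d_pt_simps dsym[of "r t"] dsym[of _ "s t"] dw field_simps\<close>)
    then show ?thesis by (simp add: pr)
  qed
  have lineF: "line (?F u)" if "0 \<le> u" "u \<le> w" for u
    unfolding geodesic_line_def
  proof (intro conjI allI)
    fix t t'
    have "d (?F u t) (?F u t') \<le> \<bar>t - t'\<bar>"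
      using up[of u u t t'] that abs_le_square_iff[of "d (?F u t) (?F u t')" "t - t'"] by simp
    moreover have "\<bar>t - t'\<bar> \<le> d (?F u t) (?F u t')"
      using prj_lip[OF s Fin Fin, of u u t t'] that by (simp add: prF)
    ultimately show "d (?F u t) (?F u t') = \<bar>t - t'\<bar>" by simp
  qed (use that Fin in auto)
  have sFD: "(d (s v) (?F u t))\<^sup>2 = u\<^sup>2 + (v - t)\<^sup>2" if "0 \<le> u" "u \<le> w" for u t v
  proof (rule antisym)
    show "(d (s v) (?F u t))\<^sup>2 \<le> u\<^sup>2 + (v - t)\<^sup>2"
      using up[of 0 u v t] that s r w by simp
    show "u\<^sup>2 + (v - t)\<^sup>2 \<le> (d (s v) (?F u t))\<^sup>2"
      using prj_pythagoras[OF s Fin, of u t v] that by (simp add: prF sF dsym[of _ "s v"] dsym[of _ "s t"])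
  qed
  have main: "(u - u')\<^sup>2 + (t - t')\<^sup>2 \<le> (d (?F u t) (?F u' t'))\<^sup>2"
    if "u \<le> u'" "0 \<le> u" "u' \<le> w" for u u' t t'
  proof -
    have u': "0 \<le> u'" "u \<le> w" using that by auto
    note L = lineF[OF u'(1) that(3)]
    have p: "prj (?F u') (s t) = t"
    proof (rule prj_eqI[OF L])
      fix v have "(d (s t) (?F u' t))\<^sup>2 \<le> (d (s t) (?F u' v))\<^sup>2" using that u' by (simp add: sFD)
      then show "d (s t) (?F u' t) \<le> d (s t) (?F u' v)" by (rule power2_le_imp_le) simp
    qed (use s in auto)
    have FF: "d (?F u t) (?F u' t) = u' - u"
      using that u' w s r by (simp add: d_pt_pt dw abs_if field_simps)
    have "prj (?F u') (?F u t) = prj (?F u') (s t)"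
      by (rule prj_between[OF L]) (use that u' s Fin in \<open>auto simp: p sF FF\<close>)
    then show ?thesis
      using prj_pythagoras[OF L Fin, of u t t'] that u' p by (simp add: FF power2_commute)
  qed
  show ?thesis
  proof (cases "u \<le> u'")
    case True then show ?thesis using main[of u u' t t'] up[of u u' t t'] u by simp
  next
    case False then show ?thesis using main[of u' u t' t] up[of u u' t t'] u by (simp add: dsym power2_commute)
  qed
qed

section \<open>Flat half planes as limits of flat strips\<close>

lemma uconv_sq_eq:
  assumes "uconv x z" "uconv y w" "eventually (\<lambda>n. (d (x n) (y n))\<^sup>2 = c) ufil"
  shows "(d z w)\<^sup>2 = c"
proof (rule tendsto_unique[OF ufil(2) tendsto_power[OF uconv_dist[OF assms(1,2)]]])
  show "((\<lambda>n. (d (x n) (y n))\<^sup>2) \<longlongrightarrow> c) ufil"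
    using assms(3) by (rule tendsto_eventually)
qed

text \<open>For closedness, the coordinates along a convergent sequence are bounded, and their
  ultrafilter limits are the coordinates of the limit. Convexity is the uniqueness of
  \<open>pt\<close>.\<close>

lemma flat_image_closed_convex:
  assumes G: "\<And>u t. 0 \<le> u \<Longrightarrow> G u t \<in> S"
    and D: "\<And>u t u' t'. 0 \<le> u \<Longrightarrow> 0 \<le> u' \<Longrightarrow> (d (G u t) (G u' t'))\<^sup>2 = (u - u')\<^sup>2 + (t - t')\<^sup>2"
  defines "F \<equiv> (\<lambda>(u, t). G u t) ` ({0..} \<times> (UNIV :: real set))"
  shows "closedin (mtopology_of M) F" "geodesically_convex M F"
proof -
  interpret Metric_space S d by simp
  show "closedin (mtopology_of M) F"
    unfolding mtopology_of_def metric_closedin_iff_sequentially_closed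
  proof (intro conjI allI impI)
    show "F \<subseteq> S" using G by (auto simp: F_def)
    fix \<sigma> l assume *: "range \<sigma> \<subseteq> F \<and> limitin mtopology \<sigma> l sequentially"
    then have "\<sigma> n \<in> F" for n by auto
    moreover have "\<exists>u t. 0 \<le> u \<and> y = G u t" if "y \<in> F" for y using that by (auto simp: F_def)
    ultimately have "\<forall>n. \<exists>u t. 0 \<le> u \<and> \<sigma> n = G u t" by blast
    then obtain u t where ut: "\<And>n. 0 \<le> u n" "\<And>n. \<sigma> n = G (u n) (t n)"
      unfolding choice_iff by blast
    have L: "l \<in> S \<and> (\<forall>e>0. eventually (\<lambda>n. \<sigma> n \<in> S \<and> d (\<sigma> n) l < e) sequentially)"
      using * unfolding limitin_metric by blast
    then have l: "l \<in> S" by blast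
    have lim: "eventually (\<lambda>n. d (\<sigma> n) l < e) sequentially" if "0 < e" for e
    proof -
      have "eventually (\<lambda>n. \<sigma> n \<in> S \<and> d (\<sigma> n) l < e) sequentially" using L that by blast
      then show ?thesis by (rule eventually_mono) blast
    qed
    have s: "\<sigma> n \<in> S" for n using ut G by simp
    have "((\<lambda>n. d (\<sigma> n) l) \<longlongrightarrow> 0) sequentially"
    proof (rule tendstoI)
      fix e :: real assume "0 < e"
      from lim[OF this] show "eventually (\<lambda>n. dist (d (\<sigma> n) l) 0 < e) sequentially"
        by (rule eventually_mono) (simp add: dist_real_def)
    qed
    then have cl: "uconv \<sigma> l" using l s by (auto simp: uconv_def intro: tendsto_ufil)
    define B where "B = d l (G 0 0) + 1"
    have ev: "eventually (\<lambda>n. d (\<sigma> n) (G 0 0) \<le> B) ufil"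
      using eventually_ufil[OF lim[OF zero_less_one]]
    proof (rule eventually_mono)
      fix n assume "d (\<sigma> n) l < 1"
      moreover have "d (\<sigma> n) (G 0 0) \<le> d (\<sigma> n) l + d l (G 0 0)" using s l G by (intro tri) auto
      ultimately show "d (\<sigma> n) (G 0 0) \<le> B" by (simp add: B_def)
    qed
    have e1: "\<bar>u n\<bar> \<le> d (\<sigma> n) (G 0 0)" "\<bar>t n\<bar> \<le> d (\<sigma> n) (G 0 0)" for n
    proof -
      have "(u n)\<^sup>2 \<le> (d (\<sigma> n) (G 0 0))\<^sup>2" "(t n)\<^sup>2 \<le> (d (\<sigma> n) (G 0 0))\<^sup>2"
        using D[of "u n" 0 "t n" 0] ut(1)[of n] by (auto simp: ut(2))
      then show "\<bar>u n\<bar> \<le> d (\<sigma> n) (G 0 0)" "\<bar>t n\<bar> \<le> d (\<sigma> n) (G 0 0)"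
        using abs_le_square_iff[of "u n" "d (\<sigma> n) (G 0 0)"] abs_le_square_iff[of "t n" "d (\<sigma> n) (G 0 0)"]
        by simp_all
    qed
    have "eventually (\<lambda>n. \<bar>u n\<bar> \<le> B) ufil" "eventually (\<lambda>n. \<bar>t n\<bar> \<le> B) ufil"
      using ev e1 by (auto elim!: eventually_mono dest: order_trans[OF e1(1)] order_trans[OF e1(2)])
    then obtain u0 t0 where lims: "(u \<longlongrightarrow> u0) ufil" "(t \<longlongrightarrow> t0) ufil" using real_ufil_limit by blast
    have u0: "0 \<le> u0" by (rule tendsto_lowerbound[OF lims(1)]) (use ut ufil in auto)
    have "((\<lambda>n. sqrt ((u n - u0)\<^sup>2 + (t n - t0)\<^sup>2)) \<longlongrightarrow> sqrt ((u0 - u0)\<^sup>2 + (t0 - t0)\<^sup>2)) ufil"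
      by (intro tendsto_intros lims)
    moreover have "d (\<sigma> n) (G u0 t0) = sqrt ((u n - u0)\<^sup>2 + (t n - t0)\<^sup>2)" for n
      using D[of "u n" u0 "t n" t0] ut(1)[of n] u0 by (simp add: ut(2) real_sqrt_unique)
    ultimately have "uconv \<sigma> (G u0 t0)" using G u0 s by (simp add: uconv_def)
    then have "l = G u0 t0" using cl uconv_unique by blast
    then show "l \<in> F" using u0 by (auto simp: F_def)
  qed
  show "geodesically_convex M F"
    unfolding geodesically_convex_def
  proof (intro ballI allI impI subsetI)
    fix x y c z assume "x \<in> F" "y \<in> F" and c: "geodesic_segment M x y c" and "z \<in> c ` {0..d x y}"
    then obtain u t u' t' r where *: "0 \<le> u" "x = G u t" "0 \<le> u'" "y = G u' t'" "0 \<le> r" "r \<le> d x y" "z = c r"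
      by (auto simp: F_def)
    have xy: "x \<in> S" "y \<in> S" using * G by auto
    define l where "l = r / d x y"
    have l: "0 \<le> l" "l \<le> 1" using * by (auto simp: l_def divide_le_eq_1)
    define v w where "v = (1 - l) * u + l * u'" and "w = (1 - l) * t + l * t'"
    have v: "0 \<le> v" using * l by (simp add: v_def)
    have e: "u - v = l * (u - u')" "t - w = l * (t - t')" "v - u' = (1 - l) * (u - u')" "w - t' = (1 - l) * (t - t')"
      by (simp_all add: v_def w_def algebra_simps)
    have zz: "z = pt x y l" using seg_pt[OF xy c] * by (simp add: l_def)
    have "G v w = pt x y l"
    proof (rule pt_unique[OF xy l G[OF v]])
      have "(d x (G v w))\<^sup>2 = l\<^sup>2 * ((u - u')\<^sup>2 + (t - t')\<^sup>2)"
        unfolding *(2) D[OF *(1) v] e by (simp add: power_mult_distrib distrib_left)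
      also have "\<dots> = (l * d x y)\<^sup>2" using D[OF *(1,3), of t t'] *(2,4) by (simp add: power_mult_distrib)
      finally show "d x (G v w) = l * d x y" using l by (simp add: power2_eq_iff_nonneg)
      have "(d (G v w) y)\<^sup>2 = (1 - l)\<^sup>2 * ((u - u')\<^sup>2 + (t - t')\<^sup>2)"
        unfolding *(4) D[OF v *(3)] e by (simp add: power_mult_distrib distrib_left)
      also have "\<dots> = ((1 - l) * d x y)\<^sup>2" using D[OF *(1,3), of t t'] *(2,4) by (simp add: power_mult_distrib)
      finally show "d (G v w) y = (1 - l) * d x y" using l by (simp add: power2_eq_iff_nonneg)
    qed
    moreover have "(\<lambda>(u, t). G u t) (v, w) \<in> F" unfolding F_def by (rule imageI) (use v in auto)
    ultimately show "z \<in> F" using zz by simp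
  qed
qed

text \<open>The strips for different \<open>n\<close> need not be nested. Still, the points with
  fixed coordinates \<open>u\<close> and \<open>t\<close> stay within \<open>u\<close> of
  \<open>s t\<close>, and their ultrafilter limits inherit the Euclidean distances.\<close>

lemma flat_half_plane_from_parallels:
  assumes s: "line s"
    and H: "\<And>n::nat. \<exists>r w. line r \<and> real n \<le> w \<and> 0 < w \<and> (\<forall>u t. (d (s u) (r t))\<^sup>2 = w\<^sup>2 + (u - t)\<^sup>2)"
  shows "bounds_flat_half_plane M s"
proof -
  obtain r w where r: "\<And>n. line (r n)" and w: "\<And>n::nat. real n \<le> w n" "\<And>n. 0 < w n"
    and D: "\<And>n u t. (d (s u) (r n t))\<^sup>2 = (w n)\<^sup>2 + (u - t)\<^sup>2"
    using H by metis
  define F where "F n u t = pt (s t) (r n t) (u / w n)" for n u t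
  have dw: "d (s t) (r n t) = w n" for n t
    using D[of t n t] w(2)[of n] mdist_nonneg[of M "s t" "r n t"] by (simp add: power2_eq_iff_nonneg)
  have ev: "eventually (\<lambda>n. u \<le> w n) ufil" for u
  proof (rule eventually_ufil)
    have "eventually (\<lambda>n. u \<le> real n) sequentially"
      using filterlim_real_sequentially by (simp add: filterlim_at_top)
    then show "eventually (\<lambda>n. u \<le> w n) sequentially"
      by (rule eventually_mono) (use w(1) order_trans in blast)
  qed
  have "\<exists>z. uconv (\<lambda>n. F n u t) z" if "0 \<le> u" for u t
  proof (rule uconv_bounded[of "s t" _ u])
    show "eventually (\<lambda>n. F n u t \<in> S \<and> d (s t) (F n u t) \<le> u) ufil"
      using ev[of u]
    proof eventually_elim
      case (elim n)
      then show ?case using that s r w(2)[of n] by (auto simp: F_def d_pt_simps dw)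
    qed
  qed (use s in auto)
  then obtain G where G: "\<And>u t. 0 \<le> u \<Longrightarrow> uconv (\<lambda>n. F n u t) (G u t)" by metis
  have DG: "(d (G u t) (G u' t'))\<^sup>2 = (u - u')\<^sup>2 + (t - t')\<^sup>2" if "0 \<le> u" "0 \<le> u'" for u t u' t'
  proof (rule uconv_sq_eq[OF G G])
    show "eventually (\<lambda>n. (d (F n u t) (F n u' t'))\<^sup>2 = (u - u')\<^sup>2 + (t - t')\<^sup>2) ufil"
      using ev[of u] ev[of u']
    proof eventually_elim
      case (elim n)
      then show ?case unfolding F_def using that by (intro flat_strip s r w D) auto
    qed
  qed (use that in auto)
  have G0: "G 0 t = s t" for t
  proof (rule uconv_unique[OF G])
    show "uconv (\<lambda>n. F n 0 t) (s t)" using s r by (simp add: F_def uconv_const)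
  qed simp
  have GS: "G u t \<in> S" if "0 \<le> u" for u t using G[OF that] by (rule uconv_in)
  let ?f = "\<lambda>(u, t). G u t"
  show ?thesis
    unfolding bounds_flat_half_plane_def
  proof (intro exI[of _ "?f ` ({0..} \<times> UNIV)"] conjI exI[of _ ?f] ballI)
    show "closedin (mtopology_of M) (?f ` ({0..} \<times> UNIV))" "geodesically_convex M (?f ` ({0..} \<times> UNIV))"
      using flat_image_closed_convex[of G] GS DG by auto
    fix p q :: "real \<times> real" assume "p \<in> {0..} \<times> UNIV" "q \<in> {0..} \<times> UNIV"
    then show "d (?f p) (?f q) = dist p q"
      using DG[of "fst p" "fst q" "snd p" "snd q"]
      by (auto simp: case_prod_beta dist_prod_def dist_real_def real_sqrt_unique)
  next
    show "?f ` ({0} \<times> UNIV) = range s" by (auto simp: G0 image_iff)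
  qed simp
qed

text \<open>Each \<open>s t\<close> is moved by about \<open>u\<close> towards \<open>x n\<close>.
  As the horofunction is affine along \<open>s\<close> with slope \<open>k\<close>, the limits form
  a line parallel to \<open>s\<close> at height \<open>u * sqrt (1 - k^2)\<close>, which can be
  prescribed because \<open>\<bar>k\<bar> < 1\<close>.\<close>

lemma flat_half_plane_from_horofunction:
  assumes s: "line s" and x: "\<And>n. x n \<in> S" and inf: "filterlim (\<lambda>n. d (x n) (s 0)) at_top ufil"
    and k: "\<bar>k\<bar> < 1" and B: "\<And>t. ((\<lambda>n. d (x n) (s t) - d (x n) (s 0)) \<longlongrightarrow> k * t) ufil"
  shows "bounds_flat_half_plane M s"
proof (rule flat_half_plane_from_parallels[OF s])
  fix m :: nat
  define w where "w = real m + 1"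
  have k2: "k\<^sup>2 < 1" using k by (simp add: abs_square_less_1)
  define u where "u = w / sqrt (1 - k\<^sup>2)"
  have w: "w > 0" by (simp add: w_def)
  have u: "u > 0" using k2 w by (simp add: u_def)
  have uw: "u\<^sup>2 * (1 - k\<^sup>2) = w\<^sup>2" using k2 by (simp add: u_def power_divide)
  define b where "b n t = d (x n) (s t)" for n t
  \<comment> \<open>The same ratio is used for all \<open>t\<close>: this makes the limit curve
    1-Lipschitz by convexity, while the distances moved still tend to \<open>u\<close> for every
    \<open>t\<close>.\<close>
  define q where "q n = u / b n 0" for n
  have q0: "(q \<longlongrightarrow> 0) ufil"
    unfolding q_def b_def by (rule tendsto_divide_0[OF tendsto_const filterlim_at_top_imp_at_infinity[OF inf]])
  have big: "eventually (\<lambda>n. u \<le> b n 0) ufil"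
    using inf by (simp add: filterlim_at_top b_def)
  then have qu: "eventually (\<lambda>n. q n * b n 0 = u) ufil" and q01: "eventually (\<lambda>n. 0 \<le> q n \<and> q n \<le> 1) ufil"
    by (eventually_elim, use u in \<open>auto simp: q_def\<close>)+
  have qb0: "((\<lambda>n. q n * b n 0) \<longlongrightarrow> u) ufil" using qu by (rule tendsto_eventually)
  have bt: "((\<lambda>n. b n t - b n 0) \<longlongrightarrow> k * t) ufil" for t using B by (simp add: b_def)
  have qb: "((\<lambda>n. q n * b n t) \<longlongrightarrow> u) ufil" for t
  proof -
    have "((\<lambda>n. q n * b n 0 + q n * (b n t - b n 0)) \<longlongrightarrow> u + 0 * (k * t)) ufil"
      by (intro tendsto_intros qb0 q0 bt)
    then show ?thesis by (simp add: algebra_simps)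
  qed
  define Z where "Z n t = pt (s t) (x n) (q n)" for n t
  have dZ: "eventually (\<lambda>n. Z n t \<in> S \<and> d (s t) (Z n t) = q n * b n t) ufil" for t
    using q01 by eventually_elim (use s x in \<open>auto simp: Z_def d_pt_simps b_def dsym\<close>)
  have "\<exists>z. uconv (\<lambda>n. Z n t) z" for t
  proof (rule uconv_bounded[of "s t" _ "u + 1"])
    have "eventually (\<lambda>n. q n * b n t < u + 1) ufil" by (rule order_tendstoD[OF qb]) simp
    with dZ[of t] show "eventually (\<lambda>n. Z n t \<in> S \<and> d (s t) (Z n t) \<le> u + 1) ufil"
      by eventually_elim auto
  qed (use s in auto)
  then obtain r where r: "\<And>t. uconv (\<lambda>n. Z n t) (r t)" by metis
  have rS [simp]: "r t \<in> S" for t using r by (rule uconv_in)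
  have r1: "d (r t) (r t') \<le> \<bar>t - t'\<bar>" for t t'
  proof (rule uconv_le[OF r r tendsto_const])
    show "eventually (\<lambda>n. d (Z n t) (Z n t') \<le> \<bar>t - t'\<bar>) ufil"
      using q01
    proof eventually_elim
      case (elim n)
      have "d (Z n t) (Z n t') \<le> (1 - q n) * d (s t) (s t') + q n * d (x n) (x n)"
        unfolding Z_def using elim s x by (intro pt_dist_convex) auto
      also have "\<dots> \<le> \<bar>t - t'\<bar>" using elim s x by (simp add: line_d mult_left_le_one_le)
      finally show ?case .
    qed
  qed
  have r2: "(d (s t) (r t))\<^sup>2 = u\<^sup>2" for t
  proof -
    have "((\<lambda>n. d (s t) (Z n t)) \<longlongrightarrow> u) ufil"
      using qb[of t] by (rule tendsto_cong[THEN iffD1, rotated]) (use dZ[of t] in eventually_elim, auto)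
    then show ?thesis using uconv_eq[OF uconv_const r, of "s t"] s by simp
  qed
  have up: "(d (r t) (s v))\<^sup>2 \<le> (v - t)\<^sup>2 + 2 * u * k * (v - t) + u\<^sup>2" for v t
  proof (rule uconv_sq_le[OF r uconv_const])
    \<comment> \<open>The bound from \<open>CN\<close>, rewritten in terms of the convergent
      differences \<open>b n t - b n 0\<close> and the products \<open>q n * b n t\<close>, which
      tend to \<open>u\<close>.\<close>
    let ?f = "\<lambda>n. (1 - q n) * (v - t)\<^sup>2 + 2 * (q n * b n 0) * ((b n v - b n 0) - (b n t - b n 0))
       + q n * ((b n v - b n 0) - (b n t - b n 0)) * ((b n v - b n 0) + (b n t - b n 0)) + (q n * b n t)\<^sup>2"
    have "(?f \<longlongrightarrow> (1 - 0) * (v - t)\<^sup>2 + 2 * u * (k * v - k * t) + 0 * (k * v - k * t) * (k * v + k * t) + u\<^sup>2) ufil"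
      by (intro tendsto_intros q0 qb0 bt qb)
    then show "(?f \<longlongrightarrow> (v - t)\<^sup>2 + 2 * u * k * (v - t) + u\<^sup>2) ufil" by (simp add: algebra_simps)
    show "eventually (\<lambda>n. (d (Z n t) (s v))\<^sup>2 \<le> ?f n) ufil"
      using q01
    proof eventually_elim
      case (elim n)
      have "(d (Z n t) (s v))\<^sup>2 \<le> (1 - q n) * (t - v)\<^sup>2 + q n * (b n v)\<^sup>2 - q n * (1 - q n) * (b n t)\<^sup>2"
        using pt_CN[of "s t" "x n" "q n" "s v"] elim s x by (simp add: Z_def b_def line_d dsym)
      also have "\<dots> = ?f n" by (simp add: power2_eq_square algebra_simps)
      finally show ?case .
    qed
  qed (use s in auto)
  \<comment> \<open>\<open>s t\<close>, at distance \<open>u\<close> from \<open>r t\<close>, is the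
    midpoint of \<open>s v\<close> and \<open>s (2*t - v)\<close>. The upper bounds at these two
    points add up to what \<open>CN\<close> requires, so both are equalities.\<close>
  have eq: "(d (r t) (s v))\<^sup>2 = (v - t)\<^sup>2 + 2 * u * k * (v - t) + u\<^sup>2" for v t
  proof -
    have "u\<^sup>2 \<le> (d (r t) (s v))\<^sup>2 / 2 + (d (r t) (s (2*t - v)))\<^sup>2 / 2 - (v - t)\<^sup>2"
      using line_CN[OF s, of "1/2" "r t" v "2*t-v"] r2[of t] by (simp add: dsym power2_eq_square algebra_simps)
    moreover have "(d (r t) (s (2*t - v)))\<^sup>2 \<le> (t - v)\<^sup>2 + 2 * u * k * (t - v) + u\<^sup>2"
      using up[of t "2*t-v"] by simp
    ultimately show ?thesis using up[of t v] by (simp add: power2_commute algebra_simps)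
  qed
  have eq': "(d (r t) (s v))\<^sup>2 = (v - (t - u*k))\<^sup>2 + w\<^sup>2" for v t
    unfolding eq uw[symmetric] by (simp add: power2_eq_square algebra_simps)
  have pr: "prj s (r t) = t - u*k" for t
  proof (rule prj_eqI[OF s])
    fix v have "(d (r t) (s (t - u*k)))\<^sup>2 \<le> (d (r t) (s v))\<^sup>2" by (simp add: eq')
    then show "d (r t) (s (t - u*k)) \<le> d (r t) (s v)" by (rule power2_le_imp_le) simp
  qed simp
  \<comment> \<open>The feet move at unit speed and projection does not increase distances, so the
    1-Lipschitz curve \<open>r\<close> preserves distances.\<close>
  have lr: "line r"
    unfolding geodesic_line_def
  proof (intro conjI allI)
    fix t t' show "d (r t) (r t') = \<bar>t - t'\<bar>"
      using r1[of t t'] prj_lip[OF s, of "r t" "r t'"] by (simp add: pr)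
  qed auto
  show "\<exists>r w. line r \<and> real m \<le> w \<and> 0 < w \<and> (\<forall>u t. (d (s u) (r t))\<^sup>2 = w\<^sup>2 + (u - t)\<^sup>2)"
  proof (intro exI[of _ "\<lambda>t. r (t + u*k)"] exI[of _ w] conjI allI)
    show "line (\<lambda>t. r (t + u*k))" using lr by (rule line_shift)
    fix v t show "(d (s v) (r (t + u*k)))\<^sup>2 = w\<^sup>2 + (v - t)\<^sup>2" using eq'[of "t + u*k" v] by (simp add: dsym)
  qed (use w in \<open>auto simp: w_def\<close>)
qed

subsection \<open>Axes without flat half planes are contracting\<close>

abbreviation IG where "IG \<equiv> isometry_group M"
abbreviation isom where "isom f \<equiv> f \<in> carrier IG"

lemma isom_iff: "isom f \<longleftrightarrow> f \<in> Bij S \<and> (\<forall>x\<in>S. \<forall>y\<in>S. d (f x) (f y) = d x y)"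
  by (simp add: isometry_group_def)

lemma isom_in: assumes "isom f" "x \<in> S" shows "f x \<in> S"
proof -
  have "f \<in> Bij S" using assms(1) isom_iff by blast
  then show ?thesis using Bij_imp_funcset assms(2) by blast
qed

lemma isom_d: "isom f \<Longrightarrow> x \<in> S \<Longrightarrow> y \<in> S \<Longrightarrow> d (f x) (f y) = d x y"
  using isom_iff by blast

lemma isom_mult: "isom f \<Longrightarrow> isom g \<Longrightarrow> isom (f \<otimes>\<^bsub>IG\<^esub> g)"
  by (rule monoid.m_closed[OF group.is_monoid[OF group_isometry_group]])

lemma isom_mult_app:
  assumes "isom f" "isom g" "x \<in> S"
  shows "(f \<otimes>\<^bsub>IG\<^esub> g) x = f (g x)"
proof -
  have "f \<in> Bij S" "g \<in> Bij S" using assms isom_iff by blast+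
  then have "f \<otimes>\<^bsub>IG\<^esub> g = compose S f g" by (simp add: isometry_group_def BijGroup_def)
  then show ?thesis using assms(3) by (simp add: compose_eq)
qed

lemma isom_one: "isom \<one>\<^bsub>IG\<^esub>"
  by (rule monoid.one_closed[OF group.is_monoid[OF group_isometry_group]])

lemma isom_one_app: "x \<in> S \<Longrightarrow> \<one>\<^bsub>IG\<^esub> x = x"
  by (simp add: isometry_group_def BijGroup_def)

lemma isom_inv: "isom f \<Longrightarrow> isom (inv\<^bsub>IG\<^esub> f)"
  by (rule group.inv_closed[OF group_isometry_group])

lemma isom_inv_app:
  assumes f: "isom f" and x: "x \<in> S"
  shows "(inv\<^bsub>IG\<^esub> f) (f x) = x" "f ((inv\<^bsub>IG\<^esub> f) x) = x"
proof -
  have "(inv\<^bsub>IG\<^esub> f) (f x) = (inv\<^bsub>IG\<^esub> f \<otimes>\<^bsub>IG\<^esub> f) x" by (rule isom_mult_app[OF isom_inv[OF f] f x, symmetric])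
  also have "\<dots> = x" unfolding group.l_inv[OF group_isometry_group f] by (rule isom_one_app[OF x])
  finally show "(inv\<^bsub>IG\<^esub> f) (f x) = x" .
  have "f ((inv\<^bsub>IG\<^esub> f) x) = (f \<otimes>\<^bsub>IG\<^esub> inv\<^bsub>IG\<^esub> f) x" by (rule isom_mult_app[OF f isom_inv[OF f] x, symmetric])
  also have "\<dots> = x" unfolding group.r_inv[OF group_isometry_group f] by (rule isom_one_app[OF x])
  finally show "f ((inv\<^bsub>IG\<^esub> f) x) = x" .
qed

lemma isom_pt:
  assumes "isom f" "x \<in> S" "y \<in> S" "0 \<le> l" "l \<le> 1"
  shows "f (pt x y l) = pt (f x) (f y) l"
proof (rule pt_unique)
  have p: "pt x y l \<in> S" using assms by (intro pt_in)
  show "f x \<in> S" "f y \<in> S" "f (pt x y l) \<in> S" using assms p by (simp_all add: isom_in)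
  show "d (f x) (f (pt x y l)) = l * d (f x) (f y)" "d (f (pt x y l)) (f y) = (1 - l) * d (f x) (f y)"
    using assms p isom_d[OF assms(1)] by (simp_all add: d_pt_simps)
qed (use assms in auto)

abbreviation axis where "axis \<equiv> is_axis M"

lemma axis_line: "axis h s l \<Longrightarrow> line s" by (simp add: is_axis_def)

lemma axis_rev:
  assumes "isom h" "axis h s l"
  shows "axis (inv\<^bsub>IG\<^esub> h) (\<lambda>t. s (- t)) l"
proof -
  have "(inv\<^bsub>IG\<^esub> h) (s (- t)) = s (- (t + l))" for t
  proof -
    have "s (- t) = h (s (- (t + l)))" using assms by (simp add: is_axis_def)
    then show ?thesis using isom_inv_app(1)[OF assms(1)] axis_line[OF assms(2)] by simp
  qed
  then show ?thesis using assms by (simp add: is_axis_def line_rev)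
qed

lemma half_plane_rev: "bounds_flat_half_plane M (\<lambda>t. s (- t)) = bounds_flat_half_plane M s"
proof -
  have "range (\<lambda>t. s (- t)) = range s"
    by (auto simp: image_iff) (metis minus_minus)
  then show ?thesis by (simp add: bounds_flat_half_plane_def)
qed

lemma axis_translate:
  assumes "isom h" "axis h s l"
  shows "\<exists>f. isom f \<and> (\<forall>t. f (s t) = s (t + of_int j * l))"
proof -
  have *: "\<exists>f. isom f \<and> (\<forall>t. f (s t) = s (t + real n * l))" if "isom h" "\<And>t. h (s t) = s (t + l)" for h l n
  proof (induction n)
    case 0
    have "\<one>\<^bsub>IG\<^esub> (s t) = s (t + real 0 * l)" for t
      using isom_one_app[of "s t"] axis_line[OF assms(2)] by simp
    then show ?case using isom_one by blast
  next
    case (Suc n)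
    then obtain f where "isom f" "\<And>t. f (s t) = s (t + real n * l)" by auto
    then have "(h \<otimes>\<^bsub>IG\<^esub> f) (s t) = s (t + real (Suc n) * l)" for t
      using that axis_line[OF assms(2)] isom_mult_app[of h f "s t"] by (simp add: algebra_simps)
    then show ?case using isom_mult[OF that(1) \<open>isom f\<close>] by blast
  qed
  show ?thesis
  proof (cases "0 \<le> j")
    case True
    then show ?thesis using *[of h l "nat j"] assms by (simp add: is_axis_def)
  next
    case False
    have "(inv\<^bsub>IG\<^esub> h) (s t) = s (t + - l)" for t
      using axis_rev[OF assms] unfolding is_axis_def by (metis add.inverse_inverse minus_add_distrib)
    then show ?thesis using *[of "inv\<^bsub>IG\<^esub> h" "-l" "nat (-j)"] assms False by (simp add: isom_inv)
  qed
qed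

lemma prj_isom_line:
  assumes "isom f" "line s" "x \<in> S" "\<And>t. f (s t) = s (t + c)"
  shows "prj s (f x) = prj s x + c"
proof (rule prj_eqI[OF assms(2)])
  fix t
  have "d (f x) (s (prj s x + c)) = d (f x) (f (s (prj s x)))" by (simp add: assms(4))
  also have "\<dots> = d x (s (prj s x))" using assms by (intro isom_d) simp_all
  also have "\<dots> \<le> d x (s (t - c))" using assms by (intro prj_min)
  also have "\<dots> = d (f x) (f (s (t - c)))" using assms by (intro isom_d[symmetric]) auto
  also have "\<dots> = d (f x) (s t)" by (simp add: assms(4))
  finally show "d (f x) (s (prj s x + c)) \<le> d (f x) (s t)" .
qed (rule isom_in[OF assms(1,3)])

section \<open>Growth of the distance to a point along an axis\<close>

lemma dist_convex:
  assumes "line s" "x \<in> S"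
  shows "convex_on UNIV (\<lambda>t. d x (s t))"
proof (rule convex_onI)
  fix l a b :: real assume l: "0 < l" "l < 1"
  have "d (pt x x l) (pt (s a) (s b) l) \<le> (1 - l) * d x (s a) + l * d x (s b)"
    using assms l by (intro pt_dist_convex) auto
  moreover have "pt x x l = x" using assms l by (intro pt_unique[symmetric]) auto
  ultimately show "d x (s ((1 - l) *\<^sub>R a + l *\<^sub>R b)) \<le> (1 - l) * d x (s a) + l * d x (s b)"
    using assms l by (simp add: line_pt)
qed simp

lemma convex_chord:
  fixes b :: "real \<Rightarrow> real"
  assumes "convex_on UNIV b" "a < a'" "a' \<le> c" "c < c'"
  shows "(b a' - b a) / (a' - a) \<le> (b c' - b c) / (c' - c)"
proof -
  have *: "(b y - b x) / (y - x) \<le> (b z - b y) / (z - y)" if "x < y" "y < z" for x y z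
  proof -
    define m where "m = (y - x) / (z - x)"
    have m: "0 \<le> m" "m \<le> 1" "m * (z - x) = y - x" using that by (auto simp: m_def)
    then have e: "(1 - m) * x + m * z = y" by (simp add: algebra_simps)
    have "b y \<le> (1 - m) * b x + m * b z"
      using convex_onD[OF assms(1), of m x z] m e by simp
    then have "(z - x) * b y \<le> (z - x) * ((1 - m) * b x + m * b z)"
      using that by (intro mult_left_mono) auto
    also have "\<dots> = ((z - x) - m * (z - x)) * b x + (m * (z - x)) * b z" by (simp add: algebra_simps)
    also have "\<dots> = (z - y) * b x + (y - x) * b z" unfolding m(3) by simp
    finally have "(z - y) * (b y - b x) \<le> (y - x) * (b z - b y)" by (simp add: algebra_simps)
    then show ?thesis using that by (simp add: divide_simps mult.commute)
  qed
  show ?thesis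
  proof (cases "a' = c")
    case True then show ?thesis using * assms by auto
  next
    case False
    have "(b a' - b a) / (a' - a) \<le> (b c - b a') / (c - a')" using False assms by (intro *) auto
    also have "\<dots> \<le> (b c' - b c) / (c' - c)" using False assms by (intro *) auto
    finally show ?thesis .
  qed
qed

lemma ex_small_increment:
  fixes q :: "nat \<Rightarrow> real"
  assumes "K > 0" "q K - q 0 < 1"
  shows "\<exists>j<K. q (Suc j) - q j \<le> 1 / real K"
proof (rule ccontr)
  assume "\<not> ?thesis"
  then have "1 / real K \<le> q (Suc j) - q j" if "j < K" for j using that by force
  then have "(\<Sum>j<K. 1 / real K) \<le> (\<Sum>j<K. q (Suc j) - q j)" by (intro sum_mono) auto
  then show False using assms by (simp add: sum_lessThan_telescope)
qed

text \<open>If the slopes stayed below \<open>1 - e\<close> on ever longer intervals, they would be nearly constant on long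
  subintervals; translating these to the base point by powers of the isometry produces a horofunction
  which is affine along the axis with slope less than one, hence a flat half plane.\<close>

lemma axis_almost_affine:
  assumes h: "isom h" and s: "axis h s l" and e: "0 < e" and K: "0 < K"
    and x: "x \<in> S" and t: "prj s x + (1 + (real K + 1) * real K) * l \<le> t" and r: "0 \<le> r"
    and lt: "d x (s (t + r)) - d x (s t) < (1 - e) * r"
  shows "\<exists>y\<in>S. \<exists>q. 0 \<le> q \<and> q \<le> 1 - e \<and> real K * l \<le> d y (s 0) \<and>
      (\<forall>v. \<bar>v\<bar> \<le> real K * l \<longrightarrow> \<bar>d y (s v) - d y (s 0) - q * v\<bar> \<le> \<bar>v\<bar> / real K)"
proof -
  have sl: "line s" and l: "l > 0" using s by (auto simp: is_axis_def)
  define b where "b v = d x (s v)" for v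
  have bc: "convex_on UNIV b" unfolding b_def by (rule dist_convex[OF sl x])
  define p where "p = prj s x"
  define W where "W = real K * l"
  have W: "W > 0" using K l by (simp add: W_def)
  define z where "z = \<lceil>p / l\<rceil>"
  \<comment> \<open>Grid points are multiples of \<open>l\<close>, so that powers of
    \<open>h\<close> can move them to \<open>s 0\<close>. The grid starts at the first multiple not
    below the foot of \<open>x\<close>, from where on the slopes are nonnegative.\<close>
  define c where "c j = of_int z * l + real j * W" for j
  have c0: "p \<le> c 0" "c 0 \<le> p + l"
  proof -
    have "p / l \<le> of_int z" "of_int z < p / l + 1" by (auto simp: z_def) linarith
    then show "p \<le> c 0" "c 0 \<le> p + l" using l by (auto simp: c_def field_simps)
  qed
  have cS: "c (Suc j) = c j + W" for j by (simp add: c_def algebra_simps)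
  have cge: "c 0 \<le> c j" for j using W by (simp add: c_def)
  define q where "q j = (b (c (Suc j)) - b (c j)) / W" for j
  have chord: "(b a' - b a) / (a' - a) \<le> (b y' - b y) / (y' - y)" if "a < a'" "a' \<le> y" "y < y'" for a a' y y'
    using convex_chord[OF bc that] .
  have bmin: "b p \<le> b v" for v unfolding b_def p_def using sl x by (rule prj_min)
  have "0 \<le> q 0"
  proof (cases "p = c 0")
    case True then show ?thesis using bmin W by (simp add: q_def)
  next
    case False
    then have "p < c 0" using c0 by simp
    then have "0 \<le> (b (c 0) - b p) / (c 0 - p)" using bmin by simp
    also have "\<dots> \<le> (b (c (Suc 0)) - b (c 0)) / (c (Suc 0) - c 0)"
      using \<open>p < c 0\<close> W by (intro chord) (auto simp: cS)
    finally show ?thesis by (simp add: q_def cS)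
  qed
  have qmono: "q j \<le> q (Suc j)" for j
    using chord[of "c j" "c (Suc j)" "c (Suc j)" "c (Suc (Suc j))"] W by (simp add: q_def cS)
  then have qle: "q i \<le> q j" if "i \<le> j" for i j using that by (rule lift_Suc_mono_le)
  have r0: "r > 0" using lt r by (cases "r = 0") auto
  \<comment> \<open>The hypothesis on \<open>t\<close> leaves room for \<open>K + 1\<close>
    intervals of length \<open>W\<close> after \<open>c 0\<close>, so all slopes up to
    \<open>q K\<close> lie below the small slope found beyond \<open>t\<close>.\<close>
  have "c (Suc K) \<le> t"
  proof -
    have "c (Suc K) \<le> p + l + (real K + 1) * W" using c0 by (simp add: c_def algebra_simps)
    also have "\<dots> \<le> t" using t by (simp add: p_def W_def algebra_simps)
    finally show ?thesis .
  qed
  then have "q K \<le> (b (t + r) - b t) / ((t + r) - t)"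
    using chord[of "c K" "c (Suc K)" t "t + r"] W r0 by (simp add: q_def cS)
  also have "\<dots> < 1 - e" using lt r0 by (simp add: b_def field_simps)
  finally have qK: "q K < 1 - e" .
  \<comment> \<open>The \<open>K\<close> increments add up to less than \<open>1\<close>, so one of
    them is at most \<open>1 / K\<close>.\<close>
  then obtain j where j: "j < K" "q (Suc j) - q j \<le> 1 / real K"
    using ex_small_increment[of K q] K e \<open>0 \<le> q 0\<close> by auto
  have qj: "0 \<le> q j" "q j \<le> 1 - e"
    using qle[of 0 j] qle[of j K] \<open>0 \<le> q 0\<close> qK j by auto
  define m where "m = z + int (Suc j * K)"
  have cm: "c (Suc j) = of_int m * l" by (simp add: c_def m_def W_def algebra_simps)
  obtain f where f: "isom f" "\<And>t. f (s t) = s (t + of_int (- m) * l)" using axis_translate[OF h s] by blast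
  have fd: "d (f x) (s v) = b (c (Suc j) + v)" for v
    using isom_d[OF f(1) x, of "s (c (Suc j) + v)"] sl by (simp add: f(2) cm b_def)
  show ?thesis
  proof (intro bexI[of _ "f x"] exI[of _ "q j"] conjI qj allI impI)
    have "(c (Suc j) - p)\<^sup>2 \<le> (b (c (Suc j)))\<^sup>2"
      using prj_pythagoras[OF sl x, of "c (Suc j)"] by (simp add: b_def p_def) (smt (verit) zero_le_power2)
    then have "c (Suc j) - p \<le> b (c (Suc j))" by (rule power2_le_imp_le) (simp add: b_def)
    then show "real K * l \<le> d (f x) (s 0)" using c0 cge[of j] by (simp add: fd cS W_def)
  next
    fix v assume v: "\<bar>v\<bar> \<le> real K * l"
    let ?c = "c (Suc j)"
    consider "v = 0" | "v > 0" | "v < 0" by linarith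
    \<comment> \<open>Chords ending at \<open>c (Suc j)\<close> of length at most \<open>W\<close>,
      on either side, have slopes between \<open>q j\<close> and \<open>q (Suc j)\<close>.\<close>
    then have "\<bar>b (?c + v) - b ?c - q j * v\<bar> \<le> \<bar>v\<bar> * (q (Suc j) - q j)"
    proof cases
      case 2
      have "q j \<le> (b (?c + v) - b ?c) / v"
        using chord[of "c j" ?c ?c "?c + v"] 2 W by (simp add: q_def cS)
      moreover have "(b (?c + v) - b ?c) / v \<le> q (Suc j)"
      proof (cases "v = W")
        case True then show ?thesis by (simp add: q_def cS)
      next
        case False
        then have "v < W" using v 2 by (simp add: W_def)
        then have a: "(b (?c + v) - b ?c) / v \<le> (b (?c + W) - b (?c + v)) / (W - v)"
          using chord[of ?c "?c+v" "?c+v" "?c+W"] 2 by simp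
        define al be where "al = (b (?c + v) - b ?c) / v" and "be = (b (?c + W) - b (?c + v)) / (W - v)"
        have "b (?c + W) - b ?c = v * al + (W - v) * be"
          using 2 \<open>v < W\<close> by (simp add: al_def be_def)
        moreover have "(W - v) * al \<le> (W - v) * be"
          using a \<open>v < W\<close> by (intro mult_left_mono) (auto simp: al_def be_def)
        ultimately have "W * al \<le> b (?c + W) - b ?c" by (simp add: algebra_simps)
        then show ?thesis using W by (simp add: q_def cS[of "Suc j"] pos_le_divide_eq mult.commute flip: al_def)
      qed
      ultimately have "q j * v \<le> b (?c + v) - b ?c" "b (?c + v) - b ?c \<le> q (Suc j) * v"
        using 2 by (simp_all add: pos_le_divide_eq pos_divide_le_eq)
      then show ?thesis using 2 by (simp add: algebra_simps abs_le_iff)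
    next
      case 3
      define u where "u = - v"
      have u: "u > 0" "v = - u" "u \<le> W" using 3 v by (auto simp: u_def W_def)
      have "(b ?c - b (?c - u)) / u \<le> q (Suc j)"
        using chord[of "?c - u" ?c ?c "c (Suc (Suc j))"] u W by (simp add: q_def cS[of "Suc j"])
      moreover have "q j \<le> (b ?c - b (?c - u)) / u"
      proof (cases "u = W")
        case True then show ?thesis by (simp add: q_def cS)
      next
        case False
        then have "u < W" using u by simp
        have cj: "c j = ?c - W" by (simp add: cS)
        have a: "(b (?c - u) - b (c j)) / (W - u) \<le> (b ?c - b (?c - u)) / u"
          using chord[of "c j" "?c - u" "?c - u" ?c] u \<open>u < W\<close> by (simp add: cj)
        define al be where "al = (b ?c - b (?c - u)) / u" and "be = (b (?c - u) - b (c j)) / (W - u)"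
        have "b ?c - b (c j) = u * al + (W - u) * be"
          using u \<open>u < W\<close> by (simp add: al_def be_def)
        moreover have "(W - u) * be \<le> (W - u) * al"
          using a \<open>u < W\<close> by (intro mult_left_mono) (auto simp: al_def be_def)
        ultimately have "b ?c - b (c j) \<le> W * al" by (simp add: algebra_simps)
        then show ?thesis using W by (simp add: q_def pos_divide_le_eq mult.commute flip: al_def)
      qed
      ultimately have "q j * u \<le> b ?c - b (?c - u)" "b ?c - b (?c - u) \<le> q (Suc j) * u"
        using u by (simp_all add: pos_le_divide_eq pos_divide_le_eq)
      then show ?thesis using u by (simp add: algebra_simps abs_le_iff)
    qed simp
    also have "\<dots> \<le> \<bar>v\<bar> * (1 / real K)" using j by (intro mult_left_mono) auto
    finally show "\<bar>d (f x) (s v) - d (f x) (s 0) - q j * v\<bar> \<le> \<bar>v\<bar> / real K" by (simp add: fd)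
  qed (rule isom_in[OF f(1) x])
qed

lemma axis_slopes:
  assumes h: "isom h" and s: "axis h s l" and nb: "\<not> bounds_flat_half_plane M s" and e: "0 < e"
  shows "\<exists>A\<ge>0. \<forall>x\<in>S. \<forall>t r. prj s x + A \<le> t \<longrightarrow> 0 \<le> r \<longrightarrow> (1 - e) * r \<le> d x (s (t + r)) - d x (s t)"
proof (rule ccontr)
  assume contra: "\<not> ?thesis"
  have sl: "line s" and l: "l > 0" using s by (auto simp: is_axis_def)
  have "\<exists>y q. y \<in> S \<and> 0 \<le> q \<and> q \<le> 1 - e \<and> real (Suc m) * l \<le> d y (s 0) \<and>
      (\<forall>v. \<bar>v\<bar> \<le> real (Suc m) * l \<longrightarrow> \<bar>d y (s v) - d y (s 0) - q * v\<bar> \<le> \<bar>v\<bar> / real (Suc m))" for m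
  proof -
    define A where "A = (1 + (real (Suc m) + 1) * real (Suc m)) * l"
    have "0 \<le> A" using l by (simp add: A_def)
    then obtain x t r where "x \<in> S" "prj s x + A \<le> t" "0 \<le> r" "d x (s (t + r)) - d x (s t) < (1 - e) * r"
      using contra by (meson not_less)
    then show ?thesis using axis_almost_affine[OF h s e, of "Suc m" x t r] by (auto simp: A_def)
  qed
  then obtain y q where y: "\<And>m. y m \<in> S" and q: "\<And>m. 0 \<le> q m" "\<And>m. q m \<le> 1 - e"
    and far: "\<And>m. real (Suc m) * l \<le> d (y m) (s 0)"
    and aff: "\<And>m v. \<bar>v\<bar> \<le> real (Suc m) * l \<Longrightarrow> \<bar>d (y m) (s v) - d (y m) (s 0) - q m * v\<bar> \<le> \<bar>v\<bar> / real (Suc m)"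
    by metis
  have "eventually (\<lambda>m. \<bar>q m\<bar> \<le> 1) ufil" using q e by (auto simp: abs_le_iff) (smt (verit) always_eventually)
  then obtain k where k: "(q \<longlongrightarrow> k) ufil" using real_ufil_limit by blast
  have "0 \<le> k" by (rule tendsto_lowerbound[OF k]) (use q ufil in auto)
  have "k \<le> 1 - e" by (rule tendsto_upperbound[OF k]) (use q ufil in auto)
  have lin: "filterlim (\<lambda>m. real (Suc m) * l) at_top sequentially"
    using filterlim_tendsto_pos_mult_at_top[OF tendsto_const l filterlim_compose[OF filterlim_real_sequentially filterlim_Suc]]
    by (simp add: mult.commute)
  have "bounds_flat_half_plane M s"
  proof (rule flat_half_plane_from_horofunction[OF sl y])
    show "filterlim (\<lambda>n. d (y n) (s 0)) at_top ufil"
      by (rule filterlim_ufil, rule filterlim_at_top_mono[OF lin]) (use far in auto)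
    show "\<bar>k\<bar> < 1" using \<open>0 \<le> k\<close> \<open>k \<le> 1 - e\<close> e by simp
    fix v
    have "((\<lambda>n. \<bar>v\<bar> * inverse (real (Suc n))) \<longlongrightarrow> \<bar>v\<bar> * 0) ufil"
      by (intro tendsto_mult tendsto_const tendsto_ufil[OF LIMSEQ_inverse_real_of_nat])
    then have z: "((\<lambda>n. \<bar>v\<bar> / real (Suc n)) \<longlongrightarrow> 0) ufil" by (simp add: divide_inverse)
    have "eventually (\<lambda>n. \<bar>v\<bar> \<le> real (Suc n) * l) ufil"
      using eventually_ufil lin by (auto simp: filterlim_at_top)
    then have "eventually (\<lambda>n. norm (d (y n) (s v) - d (y n) (s 0) - q n * v) \<le> \<bar>v\<bar> / real (Suc n)) ufil"
      by eventually_elim (use aff in auto)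
    then have "((\<lambda>n. d (y n) (s v) - d (y n) (s 0) - q n * v) \<longlongrightarrow> 0) ufil"
      by (rule Lim_null_comparison) (rule z)
    moreover have "((\<lambda>n. q n * v) \<longlongrightarrow> k * v) ufil" by (intro tendsto_intros k)
    ultimately have "((\<lambda>n. (d (y n) (s v) - d (y n) (s 0) - q n * v) + q n * v) \<longlongrightarrow> 0 + k * v) ufil"
      by (rule tendsto_add)
    then show "((\<lambda>n. d (y n) (s v) - d (y n) (s 0)) \<longlongrightarrow> k * v) ufil" by simp
  qed
  with nb show False by blast
qed

text \<open>Once the feet have escaped, \<open>s 0\<close> and \<open>s t\<close> both lie far past
  them and \<open>axis_slopes\<close> applies for every \<open>e\<close>; the opposite bound is the
  triangle inequality.\<close>

lemma axis_horofunction: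
  assumes h: "isom h" and s: "axis h s l" and nb: "\<not> bounds_flat_half_plane M s"
    and x: "\<And>n. x n \<in> S" and p: "filterlim (\<lambda>n. prj s (x n)) at_bot ufil"
  shows "((\<lambda>n. d (x n) (s t) - d (x n) (s 0)) \<longlongrightarrow> t) ufil"
proof (rule tendstoI)
  have sl: "line s" using s by (rule axis_line)
  fix e' :: real assume e': "0 < e'"
  define k where "k = \<bar>t\<bar> + 1"
  have k: "0 < k" "\<bar>t\<bar> \<le> k" by (auto simp: k_def)
  define e where "e = e' / (2 * k)"
  have e: "0 < e" using e' k by (simp add: e_def)
  have "e * \<bar>t\<bar> \<le> e * k" using e k by (intro mult_left_mono) auto
  also have "\<dots> = e' / 2" using k by (simp add: e_def)
  finally have et: "e * \<bar>t\<bar> < e'" using e' by linarith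
  obtain A where A: "\<And>x t r. x \<in> S \<Longrightarrow> prj s x + A \<le> t \<Longrightarrow> 0 \<le> r \<Longrightarrow> (1 - e) * r \<le> d x (s (t + r)) - d x (s t)"
    using axis_slopes[OF h s nb e] by blast
  have "eventually (\<lambda>n. prj s (x n) \<le> min 0 t - A) ufil"
    using p by (simp add: filterlim_at_bot)
  then show "eventually (\<lambda>n. dist (d (x n) (s t) - d (x n) (s 0)) t < e') ufil"
  proof eventually_elim
    case (elim n)
    have up: "\<bar>d (x n) (s t) - d (x n) (s 0)\<bar> \<le> \<bar>t\<bar>"
      using tri'[of "s t" "s 0" "x n"] sl x by (simp add: line_d dsym)
    have "\<bar>(d (x n) (s t) - d (x n) (s 0)) - t\<bar> \<le> e * \<bar>t\<bar>"
    proof (cases "0 \<le> t")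
      case True
      then show ?thesis using A[OF x, of n 0 t] elim up by (simp add: algebra_simps abs_le_iff)
    next
      case False
      then show ?thesis using A[OF x, of n t "-t"] elim up by (simp add: algebra_simps abs_le_iff)
    qed
    then show ?case using et by (simp add: dist_real_def)
  qed
qed

text \<open>Because the horofunction has slope one, the \<open>CN\<close> bound for the squared
  distance to \<open>s (- u)\<close> tends to \<open>u^2 - 2 u^2 + u^2 = 0\<close>: segments towards
  \<open>x n\<close> leave \<open>s 0\<close> along the axis.\<close>

lemma axis_direction_limit:
  assumes h: "isom h" and s: "axis h s l" and nb: "\<not> bounds_flat_half_plane M s"
    and x: "\<And>n. x n \<in> S" and p: "filterlim (\<lambda>n. prj s (x n)) at_bot ufil" and u: "0 \<le> u"
  shows "uconv (\<lambda>n. pt (s 0) (x n) (u / d (s 0) (x n))) (s (- u))"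
proof -
  have sl: "line s" using s by (rule axis_line)
  define b where "b n t = d (x n) (s t)" for n t
  define q where "q n = u / b n 0" for n
  have bt: "((\<lambda>n. b n t - b n 0) \<longlongrightarrow> t) ufil" for t
    unfolding b_def by (rule axis_horofunction[OF h s nb x p])
  have inf: "filterlim (\<lambda>n. b n 0) at_top ufil"
  proof (rule filterlim_at_top_mono)
    show "filterlim (\<lambda>n. - prj s (x n)) at_top ufil" using p by (simp add: filterlim_uminus_at_top)
    have "- prj s (x n) \<le> b n 0" for n
      using prj_lip[OF sl x, of "s 0" n] sl by (simp add: prj_line b_def)
    then show "eventually (\<lambda>n. - prj s (x n) \<le> b n 0) ufil" by simp
  qed
  have q0: "(q \<longlongrightarrow> 0) ufil"
    unfolding q_def by (rule tendsto_divide_0[OF tendsto_const filterlim_at_top_imp_at_infinity[OF inf]])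
  have big: "eventually (\<lambda>n. u + 1 \<le> b n 0) ufil" using inf by (simp add: filterlim_at_top)
  then have qu: "eventually (\<lambda>n. q n * b n 0 = u) ufil" and q01: "eventually (\<lambda>n. 0 \<le> q n \<and> q n \<le> 1) ufil"
    by (eventually_elim, use u in \<open>auto simp: q_def\<close>)+
  have qb0: "((\<lambda>n. q n * b n 0) \<longlongrightarrow> u) ufil" using qu by (rule tendsto_eventually)
  define Z where "Z n = pt (s 0) (x n) (q n)" for n
  let ?f = "\<lambda>n. (1 - q n) * u\<^sup>2 + 2 * (q n * b n 0) * (b n (- u) - b n 0) + q n * (b n (- u) - b n 0)\<^sup>2 + (q n * b n 0)\<^sup>2"
  have "(?f \<longlongrightarrow> (1 - 0) * u\<^sup>2 + 2 * u * (- u) + 0 * (- u)\<^sup>2 + u\<^sup>2) ufil"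
    by (intro tendsto_intros q0 qb0 bt)
  then have f: "(?f \<longlongrightarrow> 0) ufil" by (simp add: power2_eq_square)
  have "eventually (\<lambda>n. norm ((d (Z n) (s (- u)))\<^sup>2) \<le> ?f n) ufil"
    using q01
  proof eventually_elim
    case (elim n)
    have "(d (Z n) (s (- u)))\<^sup>2 \<le> (1 - q n) * u\<^sup>2 + q n * (b n (- u))\<^sup>2 - q n * (1 - q n) * (b n 0)\<^sup>2"
      using pt_CN[of "s 0" "x n" "q n" "s (- u)"] elim sl x by (simp add: Z_def b_def line_d dsym)
    also have "\<dots> = ?f n" by (simp add: power2_eq_square algebra_simps)
    finally show ?case by simp
  qed
  then have "((\<lambda>n. (d (Z n) (s (- u)))\<^sup>2) \<longlongrightarrow> 0) ufil" by (rule Lim_null_comparison) (rule f)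
  then have "((\<lambda>n. sqrt ((d (Z n) (s (- u)))\<^sup>2)) \<longlongrightarrow> sqrt 0) ufil" by (rule tendsto_real_sqrt)
  moreover have "eventually (\<lambda>n. Z n \<in> S) ufil" using q01 by eventually_elim (use sl x in \<open>auto simp: Z_def\<close>)
  ultimately have "uconv Z (s (- u))" using sl by (simp add: uconv_def)
  then show ?thesis by (simp add: Z_def[abs_def] q_def b_def dsym)
qed

section \<open>Geodesics whose end points project to opposite ends of an axis\<close>

lemma pt_toward_start:
  assumes "x \<in> S" "y \<in> S" "0 < d x y" "0 < l" "l \<le> 1" "0 \<le> u" "u \<le> l * d x y"
  shows "pt x y (l - u / d x y) = pt (pt x y l) x (u / d (pt x y l) x)"
proof -
  define m where "m = 1 - u / (l * d x y)"
  have p: "0 < l * d x y" using assms by simp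
  then have u: "0 \<le> u / (l * d x y)" "u / (l * d x y) \<le> 1"
    using assms by (simp_all only: divide_nonneg_pos divide_le_eq_1_pos)
  have "pt (pt x y l) x (u / (l * d x y)) = pt x (pt x y l) m"
    unfolding m_def using assms u by (intro pt_sym) auto
  also have "\<dots> = pt x y (l * m)" using assms u by (intro pt_pt) (auto simp: m_def)
  also have "l * m = l - u / d x y" using assms by (simp add: m_def right_diff_distrib)
  finally show ?thesis using assms by (simp add: dsym[of "pt x y l"] d_pt_simps)
qed

text \<open>Points at equal ratio are compared by convexity, and the ratio on the geodesic from
  \<open>q\<close> is then corrected; each of the two costs at most \<open>d p q\<close>.\<close>

lemma fan_distance:
  assumes "p \<in> S" "q \<in> S" "x \<in> S" "0 \<le> u" "u \<le> d p x" "u \<le> d q x" "0 < d p x" "0 < d q x"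
  shows "d (pt p x (u / d p x)) (pt q x (u / d q x)) \<le> 2 * d p q"
proof -
  define a b where "a = u / d p x" and "b = u / d q x"
  have ab: "0 \<le> a" "a \<le> 1" "0 \<le> b" "b \<le> 1" using assms by (auto simp: a_def b_def)
  have "d (pt p x a) (pt q x a) \<le> (1 - a) * d p q + a * d x x" using assms ab by (intro pt_dist_convex) auto
  also have "\<dots> \<le> d p q" using assms ab by (simp add: mult_left_le_one_le)
  finally have 1: "d (pt p x a) (pt q x a) \<le> d p q" .
  have "d (pt q x a) (pt q x b) = \<bar>a - b\<bar> * d q x" using assms ab by (intro d_pt_pt) auto
  also have "\<dots> = \<bar>(a - b) * d q x\<bar>" by (simp add: abs_mult)
  also have "(a - b) * d q x = a * (d q x - d p x)"
  proof -
    have "(u / P - u / Q) * Q = u / P * (Q - P)" if "0 < P" "0 < Q" for P Q :: real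
      using that by (simp add: field_simps)
    then show ?thesis using assms(7,8) by (simp only: a_def b_def)
  qed
  also have "\<bar>a * (d q x - d p x)\<bar> = a * \<bar>d q x - d p x\<bar>" using ab by (simp add: abs_mult)
  also have "\<dots> \<le> \<bar>d q x - d p x\<bar>" using ab by (simp add: mult_left_le_one_le)
  also have "\<dots> \<le> d p q" using tri'[of q p x] assms by (simp add: dsym)
  finally have 2: "d (pt q x a) (pt q x b) \<le> d p q" .
  have "d (pt p x a) (pt q x b) \<le> d (pt p x a) (pt q x a) + d (pt q x a) (pt q x b)"
    using assms ab by (intro tri) auto
  then show ?thesis using 1 2 by (simp add: a_def b_def)
qed

text \<open>Intermediate value theorem for the distance \<open>f v\<close> from \<open>s 0\<close>
  to the geodesic joining \<open>X v\<close> and \<open>Y v\<close>. These points slide from the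
  feet at \<open>v = 0\<close> to \<open>x\<close> and \<open>y\<close> at \<open>v = 1\<close>
  without changing their projections. The \<open>+ 1\<close> is there because the infimum
  \<open>f v\<close> is only approximated.\<close>

lemma interpolate_to_distance:
  assumes s: "line s" and x: "x \<in> S" and y: "y \<in> S" and px: "prj s x \<le> 0" and py: "0 \<le> prj s y"
    and R: "0 < R" and av: "\<And>l. 0 \<le> l \<Longrightarrow> l \<le> 1 \<Longrightarrow> R < d (pt x y l) (s 0)"
  shows "\<exists>x' y' l'. x' \<in> S \<and> y' \<in> S \<and> prj s x' = prj s x \<and> prj s y' = prj s y \<and>
     (\<forall>l. 0 \<le> l \<longrightarrow> l \<le> 1 \<longrightarrow> R \<le> d (pt x' y' l) (s 0)) \<and> 0 \<le> l' \<and> l' \<le> 1 \<and> d (pt x' y' l') (s 0) \<le> R + 1"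
proof -
  define X where "X v = pt (s (prj s x)) x v" for v
  define Y where "Y v = pt (s (prj s y)) y v" for v
  define g where "g v l = d (pt (X v) (Y v) l) (s 0)" for v l
  define f where "f v = (INF l\<in>{0..1}. g v l)" for v
  define C where "C = d (s (prj s x)) x + d (s (prj s y)) y"
  have XY: "X v \<in> S" "Y v \<in> S" if "v \<in> {0..1}" for v using that s x y by (auto simp: X_def Y_def)
  have gd: "g v l \<le> g v' l + C * \<bar>v - v'\<bar>" if "v \<in> {0..1}" "v' \<in> {0..1}" "l \<in> {0..1}" for v v' l
  proof -
    have "g v l \<le> d (pt (X v) (Y v) l) (pt (X v') (Y v') l) + g v' l"
      unfolding g_def using that XY s by (intro tri) auto
    also have "d (pt (X v) (Y v) l) (pt (X v') (Y v') l) \<le> (1 - l) * d (X v) (X v') + l * d (Y v) (Y v')"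
      using that XY by (intro pt_dist_convex) auto
    also have "\<dots> \<le> d (X v) (X v') + d (Y v) (Y v')"
      using that by (intro add_mono) (auto simp: mult_left_le_one_le)
    also have "\<dots> = C * \<bar>v - v'\<bar>"
      using that s x y by (simp add: X_def Y_def C_def d_pt_pt algebra_simps)
    finally show ?thesis by simp
  qed
  have bd: "bdd_below (g v ` {0..1})" for v by (rule bdd_belowI[of _ 0]) (auto simp: g_def)
  have fle: "f v \<le> f v' + C * \<bar>v - v'\<bar>" if "v \<in> {0..1}" "v' \<in> {0..1}" for v v'
  proof -
    have "f v - C * \<bar>v - v'\<bar> \<le> f v'"
      unfolding f_def[of v']
    proof (rule cINF_greatest)
      fix l :: real assume l: "l \<in> {0..1}"
      have "f v \<le> g v l" unfolding f_def by (rule cINF_lower[OF bd l])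
      then show "f v - C * \<bar>v - v'\<bar> \<le> g v' l" using gd[OF that l] by linarith
    qed simp
    then show ?thesis by simp
  qed
  have "continuous_on {0..1} f"
  proof (rule lipschitz_on_continuous_on[of C], rule lipschitz_onI)
    fix v v' :: real assume v: "v \<in> {0..1}" "v' \<in> {0..1}"
    have "\<bar>f v - f v'\<bar> \<le> C * \<bar>v - v'\<bar>"
      using fle[OF v] fle[OF v(2,1)] by (simp add: abs_minus_commute abs_le_iff)
    then show "dist (f v) (f v') \<le> C * dist v v'" by (simp add: dist_real_def)
  qed (simp add: C_def)
  moreover have "f 0 \<le> R"
  proof -
    \<comment> \<open>For \<open>v = 0\<close> the geodesic is the piece of \<open>s\<close> between
      the two feet, and this is the ratio at which it meets \<open>s 0\<close>.\<close>
    define l where "l = (if prj s y = prj s x then 0 else - prj s x / (prj s y - prj s x))"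
    have l: "l \<in> {0..1}" "(1 - l) * prj s x + l * prj s y = 0"
    proof -
      show "l \<in> {0..1}" using px py by (auto simp: l_def field_simps)
      show "(1 - l) * prj s x + l * prj s y = 0"
      proof (cases "prj s y = prj s x")
        case False
        then have "l * (prj s y - prj s x) = - prj s x" by (simp add: l_def)
        then show ?thesis by (simp add: algebra_simps)
      qed (use px py in \<open>simp add: l_def\<close>)
    qed
    have "f 0 \<le> g 0 l" unfolding f_def by (rule cINF_lower[OF bd l(1)])
    also have "g 0 l = 0" using l s x y by (simp add: g_def X_def Y_def line_pt)
    finally show ?thesis using R by simp
  qed
  moreover have "R \<le> f 1"
    unfolding f_def using av s x y by (intro cINF_greatest) (auto simp: g_def X_def Y_def less_imp_le)
  ultimately obtain v where v: "0 \<le> v" "v \<le> 1" "f v = R" using IVT'[of f 0 R 1] by auto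
  then have v': "v \<in> {0..1}" by simp
  have "\<exists>l\<in>{0..1}. g v l < R + 1"
    using cINF_less_iff[OF _ bd, of v "R + 1"] v by (auto simp: f_def)
  then obtain l where l: "0 \<le> l" "l \<le> 1" "g v l < R + 1" by auto
  have lo: "R \<le> g v l" if "0 \<le> l" "l \<le> 1" for l
    using cINF_lower[OF bd, of l v] that v by (auto simp: f_def)
  have "prj s (X v) = prj s x" "prj s (Y v) = prj s y"
    using prj_pt[OF s x, of "1 - v"] prj_pt[OF s y, of "1 - v"] pt_sym[of x "s (prj s x)" v] pt_sym[of y "s (prj s y)" v] v s x y
    by (simp_all add: X_def Y_def)
  then show ?thesis using XY[OF v'] lo l unfolding g_def
    by (intro exI[of _ "X v"] exI[of _ "Y v"] exI[of _ l]) auto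
qed

text \<open>A geodesic passing the axis at distance \<open>R\<close> but having end points which project far out on both
  sides can be deformed, by moving the end points towards their projections, until its distance from
  \<open>s 0\<close> is about \<open>R\<close>. The limit of such geodesics is parallel to the axis.\<close>

lemma axis_near_zero:
  assumes h: "isom h" and s: "axis h s l" and nb: "\<not> bounds_flat_half_plane M s"
  shows "\<exists>R T. \<forall>x\<in>S. \<forall>y\<in>S. prj s x \<le> - T \<longrightarrow> T \<le> prj s y \<longrightarrow> (\<exists>l\<in>{0..1}. d (pt x y l) (s 0) \<le> R)"
proof (rule ccontr)
  assume contra: "\<not> ?thesis"
  have sl: "line s" using s by (rule axis_line)
  have s0: "s 0 \<in> S" using sl by simp
  have "bounds_flat_half_plane M s"
  proof (rule flat_half_plane_from_parallels[OF sl])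
    fix k :: nat
    \<comment> \<open>A geodesic limit that avoids the ball of radius \<open>R\<close> around
      \<open>s 0\<close> will be a parallel line at distance at least \<open>R\<close>, hence at
      least \<open>k\<close>.\<close>
    define R where "R = real k + 1"
    have R: "0 < R" by (simp add: R_def)
    have "\<exists>x y l. x \<in> S \<and> y \<in> S \<and> prj s x \<le> - real m \<and> real m \<le> prj s y \<and>
       (\<forall>l. 0 \<le> l \<longrightarrow> l \<le> 1 \<longrightarrow> R \<le> d (pt x y l) (s 0)) \<and> 0 \<le> l \<and> l \<le> 1 \<and> d (pt x y l) (s 0) \<le> R + 1" for m
    proof -
      obtain x y where xy: "x \<in> S" "y \<in> S" "prj s x \<le> - real m" "real m \<le> prj s y"
         "\<And>l. l \<in> {0..1} \<Longrightarrow> \<not> d (pt x y l) (s 0) \<le> R" using contra by meson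
      obtain x' y' l' where "x' \<in> S" "y' \<in> S" "prj s x' = prj s x" "prj s y' = prj s y"
         "\<forall>l. 0 \<le> l \<longrightarrow> l \<le> 1 \<longrightarrow> R \<le> d (pt x' y' l) (s 0)" "0 \<le> l'" "l' \<le> 1" "d (pt x' y' l') (s 0) \<le> R + 1"
        using interpolate_to_distance[OF sl xy(1,2) _ _ R] xy(3-5) by fastforce
      then show ?thesis using xy(3,4) by (intro exI[of _ x'] exI[of _ y'] exI[of _ l']) simp
    qed
    then obtain x y l where x: "\<And>m. x m \<in> S" and y: "\<And>m. y m \<in> S" and px: "\<And>m. prj s (x m) \<le> - real m"
      and py: "\<And>m. real m \<le> prj s (y m)" and far: "\<And>m l. 0 \<le> l \<Longrightarrow> l \<le> 1 \<Longrightarrow> R \<le> d (pt (x m) (y m) l) (s 0)"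
      and l: "\<And>m. 0 \<le> l m" "\<And>m. l m \<le> 1" and near: "\<And>m. d (pt (x m) (y m) (l m)) (s 0) \<le> R + 1"
      by metis
    define L where "L m = d (x m) (y m)" for m
    define q where "q m = pt (x m) (y m) (l m)" for m
    have q: "q m \<in> S" for m using x y l by (simp add: q_def)
    have xs: "real m \<le> d (s 0) (x m)" and ys: "real m \<le> d (s 0) (y m)" for m
      using prj_lip[OF sl x s0, of m] prj_lip[OF sl y s0, of m] px[of m] py[of m] sl
      by (simp_all add: prj_line dsym[of "s 0"])
    have xq: "d (q m) (x m) = l m * L m" and yq: "d (q m) (y m) = (1 - l m) * L m" for m
      using x y l by (simp_all add: q_def L_def d_pt_simps dsym[of _ "x m"])
    have lL: "real m - (R + 1) \<le> l m * L m" and lL': "real m - (R + 1) \<le> (1 - l m) * L m" for m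
      using tri[of "s 0" "q m" "x m"] tri[of "s 0" "q m" "y m"] xs[of m] ys[of m] near[of m] q x y s0
      by (simp_all add: xq yq q_def[symmetric] dsym[of "s 0"])
    have ev: "eventually (\<lambda>m. 0 < L m \<and> 0 < l m \<and> 0 < 1 - l m \<and> \<bar>t\<bar> \<le> l m * L m \<and> \<bar>t\<bar> \<le> (1 - l m) * L m \<and> \<bar>t\<bar> \<le> real m \<and> 0 < real m) ufil" for t
    proof -
      have "eventually (\<lambda>m. \<bar>t\<bar> + R + 2 \<le> real m) ufil"
        using eventually_ufil filterlim_real_sequentially by (auto simp: filterlim_at_top)
      then show ?thesis
      proof (rule eventually_mono)
        fix m assume m: "\<bar>t\<bar> + R + 2 \<le> real m"
        then have 1: "1 + \<bar>t\<bar> \<le> l m * L m" "1 + \<bar>t\<bar> \<le> (1 - l m) * L m" using lL[of m] lL'[of m] by auto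
        then have "l m * L m > 0" "(1 - l m) * L m > 0" by linarith+
        then have "0 < L m \<and> 0 < l m \<and> 0 < 1 - l m" using l[of m]
          by (auto simp: zero_less_mult_iff)
        then show "0 < L m \<and> 0 < l m \<and> 0 < 1 - l m \<and> \<bar>t\<bar> \<le> l m * L m \<and> \<bar>t\<bar> \<le> (1 - l m) * L m \<and> \<bar>t\<bar> \<le> real m \<and> 0 < real m"
          using 1 m R by auto
      qed
    qed
    \<comment> \<open>Arc length parameter on the geodesic, counted from its point
      \<open>q m\<close> close to \<open>s 0\<close>.\<close>
    define c where "c m t = pt (x m) (y m) (l m + t / L m)" for m t
    have ev01: "eventually (\<lambda>m. 0 < L m \<and> 0 \<le> l m + t / L m \<and> l m + t / L m \<le> 1) ufil" for t
      using ev[of t]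
    proof (rule eventually_mono)
      fix m assume *: "0 < L m \<and> 0 < l m \<and> 0 < 1 - l m \<and> \<bar>t\<bar> \<le> l m * L m \<and> \<bar>t\<bar> \<le> (1 - l m) * L m \<and> \<bar>t\<bar> \<le> real m \<and> 0 < real m"
      then have "- (l m * L m) \<le> t" "t \<le> (1 - l m) * L m" by auto
      then have "- l m \<le> t / L m" "t / L m \<le> 1 - l m" using * by (simp_all add: pos_le_divide_eq pos_divide_le_eq)
      then show "0 < L m \<and> 0 \<le> l m + t / L m \<and> l m + t / L m \<le> 1" using * by simp
    qed
    have cd: "eventually (\<lambda>m. d (c m t) (c m t') = \<bar>t - t'\<bar>) ufil" for t t'
      using ev01[of t] ev01[of t']
    proof eventually_elim
      case (elim m)
      then have "d (c m t) (c m t') = \<bar>(l m + t / L m) - (l m + t' / L m)\<bar> * L m"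
        unfolding c_def L_def using x y by (intro d_pt_pt) auto
      also have "\<dots> = \<bar>(t - t') / L m * L m\<bar>" using elim by (simp add: abs_mult diff_divide_distrib)
      finally show ?case using elim by simp
    qed
    have "\<exists>z. uconv (\<lambda>m. c m t) z" for t
    proof (rule uconv_bounded[OF s0, of _ "R + 1 + \<bar>t\<bar>"])
      show "eventually (\<lambda>m. c m t \<in> S \<and> d (s 0) (c m t) \<le> R + 1 + \<bar>t\<bar>) ufil"
        using ev01[of t] cd[of 0 t]
      proof eventually_elim
        case (elim m)
        then have c: "c m t \<in> S" using x y by (simp add: c_def)
        have "c m 0 = q m" by (simp add: c_def q_def)
        then show ?case using c elim near[of m] tri[of "s 0" "q m" "c m t"] q s0 by (simp add: q_def[symmetric] dsym[of "s 0"])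
      qed
    qed
    then obtain r where r: "\<And>t. uconv (\<lambda>m. c m t) (r t)" by metis
    have lr: "line r"
      unfolding geodesic_line_def
    proof (intro conjI allI)
      show "range r \<subseteq> S" using r uconv_in by auto
      fix t t' show "d (r t) (r t') = \<bar>t - t'\<bar>"
        by (rule uconv_eq[OF r r]) (rule tendsto_eventually[OF cd])
    qed
    have rfar: "R \<le> d (r t) (s 0)" for t
    proof (rule tendsto_lowerbound[OF uconv_dist[OF r uconv_const[OF s0]] _ ufil(2)])
      show "eventually (\<lambda>m. R \<le> d (c m t) (s 0)) ufil"
        using ev01[of t] by (rule eventually_mono) (simp add: c_def far)
    qed
    have xbot: "filterlim (\<lambda>m. prj s (x m)) at_bot ufil"
    proof (rule filterlim_ufil)
      have "filterlim (\<lambda>m. - prj s (x m)) at_top sequentially"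
        by (rule filterlim_at_top_mono[OF filterlim_real_sequentially]) (use px in \<open>auto simp: le_minus_iff\<close>)
      then show "filterlim (\<lambda>m. prj s (x m)) at_bot sequentially" by (simp add: filterlim_uminus_at_top)
    qed
    have ybot: "filterlim (\<lambda>m. prj (\<lambda>t. s (- t)) (y m)) at_bot ufil"
    proof (rule filterlim_ufil)
      have "filterlim (\<lambda>m. prj s (y m)) at_top sequentially"
        by (rule filterlim_at_top_mono[OF filterlim_real_sequentially]) (use py in auto)
      then show "filterlim (\<lambda>m. prj (\<lambda>t. s (- t)) (y m)) at_bot sequentially"
        using sl y by (simp add: prj_rev filterlim_uminus_at_bot)
    qed
    have dirx: "uconv (\<lambda>m. pt (s 0) (x m) (u / d (s 0) (x m))) (s (- u))" if "0 \<le> u" for u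
      by (rule axis_direction_limit[OF h s nb x xbot that])
    have diry: "uconv (\<lambda>m. pt (s 0) (y m) (u / d (s 0) (y m))) (s u)" if "0 \<le> u" for u
      using axis_direction_limit[OF isom_inv[OF h] axis_rev[OF h s] _ y ybot that] nb half_plane_rev[of s] by simp
    \<comment> \<open>On either side, the segments from \<open>s 0\<close> and from
      \<open>q m\<close> to the same end point stay within \<open>2 * d (s 0) (q m)\<close>, and
      those from \<open>s 0\<close> converge to the axis.\<close>
    have par: "d (s t) (r t) \<le> 2 * (R + 1)" for t
    proof (cases "0 \<le> t")
      case True
      show ?thesis
      proof (rule uconv_le[OF diry[OF True] r tendsto_const])
        show "eventually (\<lambda>m. d (pt (s 0) (y m) (t / d (s 0) (y m))) (c m t) \<le> 2 * (R + 1)) ufil"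
          using ev[of t]
        proof (rule eventually_mono)
          fix m assume *: "0 < L m \<and> 0 < l m \<and> 0 < 1 - l m \<and> \<bar>t\<bar> \<le> l m * L m \<and> \<bar>t\<bar> \<le> (1 - l m) * L m \<and> \<bar>t\<bar> \<le> real m \<and> 0 < real m"
          have q': "q m = pt (y m) (x m) (1 - l m)"
            using pt_sym[of "x m" "y m" "1 - l m"] x y l by (simp add: q_def)
          have Ls: "d (y m) (x m) = L m" by (simp add: L_def dsym)
          have t01: "0 \<le> 1 - (l m + t / L m)" "1 - (l m + t / L m) \<le> 1"
            using * True by (auto simp: field_simps)
          have "c m t = pt (y m) (x m) (1 - l m - t / d (y m) (x m))"
            using pt_sym[of "x m" "y m" "1 - (l m + t / L m)"] x y t01 by (simp add: c_def Ls diff_diff_eq)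
          also have "\<dots> = pt (q m) (y m) (t / d (q m) (y m))"
            unfolding q' by (rule pt_toward_start) (use * True x y in \<open>auto simp: Ls\<close>)
          finally have c: "c m t = pt (q m) (y m) (t / d (q m) (y m))" .
          have "d (pt (s 0) (y m) (t / d (s 0) (y m))) (c m t) \<le> 2 * d (s 0) (q m)"
            unfolding c using * True ys[of m] s0 q y by (intro fan_distance) (auto simp: yq)
          also have "\<dots> \<le> 2 * (R + 1)" using near[of m] by (simp add: q_def dsym)
          finally show "d (pt (s 0) (y m) (t / d (s 0) (y m))) (c m t) \<le> 2 * (R + 1)" .
        qed
      qed
    next
      case False
      define u where "u = - t"
      have u: "0 \<le> u" "t = - u" using False by (auto simp: u_def)
      show ?thesis unfolding u(2)
      proof (rule uconv_le[OF dirx[OF u(1)] r tendsto_const])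
        show "eventually (\<lambda>m. d (pt (s 0) (x m) (u / d (s 0) (x m))) (c m (- u)) \<le> 2 * (R + 1)) ufil"
          using ev[of u]
        proof (rule eventually_mono)
          fix m assume *: "0 < L m \<and> 0 < l m \<and> 0 < 1 - l m \<and> \<bar>u\<bar> \<le> l m * L m \<and> \<bar>u\<bar> \<le> (1 - l m) * L m \<and> \<bar>u\<bar> \<le> real m \<and> 0 < real m"
          have "c m (- u) = pt (x m) (y m) (l m - u / d (x m) (y m))" by (simp add: c_def L_def)
          also have "\<dots> = pt (q m) (x m) (u / d (q m) (x m))"
            unfolding q_def by (rule pt_toward_start) (use * u x y l in \<open>auto simp: L_def\<close>)
          finally have c: "c m (- u) = pt (q m) (x m) (u / d (q m) (x m))" .
          have "d (pt (s 0) (x m) (u / d (s 0) (x m))) (c m (- u)) \<le> 2 * d (s 0) (q m)"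
            unfolding c using * u xs[of m] s0 q x by (intro fan_distance) (auto simp: xq)
          also have "\<dots> \<le> 2 * (R + 1)" using near[of m] by (simp add: q_def dsym)
          finally show "d (pt (s 0) (x m) (u / d (s 0) (x m))) (c m (- u)) \<le> 2 * (R + 1)" .
        qed
      qed
    qed
    obtain a w where w: "0 \<le> w" and D: "\<And>u t. (d (s u) (r t))\<^sup>2 = w\<^sup>2 + (u - t - a)\<^sup>2"
      using parallel_lines[OF sl lr par] by auto
    have "(d (s 0) (r (- a)))\<^sup>2 = w\<^sup>2" using D[of 0 "-a"] by simp
    then have "R \<le> w" using rfar[of "-a"] w by (simp add: power2_eq_iff_nonneg dsym)
    then show "\<exists>r w. line r \<and> real k \<le> w \<and> 0 < w \<and> (\<forall>u t. (d (s u) (r t))\<^sup>2 = w\<^sup>2 + (u - t)\<^sup>2)"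
      using line_shift[OF lr, of "-a"] D by (intro exI[of _ "\<lambda>t. r (t + - a)"] exI[of _ w]) (auto simp: R_def)
  qed
  with nb show False by blast
qed

text \<open>Only the foot of \<open>x\<close> is mentioned; exchanging the end points gives the same
  for the foot of \<open>y\<close>. A single constant serves as threshold and as distance, since it
  may always be enlarged.\<close>

definition contracting where
  "contracting s D \<longleftrightarrow> line s \<and> 0 < D \<and> (\<forall>x\<in>S. \<forall>y\<in>S. D \<le> \<bar>prj s x - prj s y\<bar> \<longrightarrow>
     (\<exists>l\<in>{0..1}. d (pt x y l) (s (prj s x)) \<le> D))"

lemma contracting_line: "contracting s D \<Longrightarrow> line s" and contracting_pos: "contracting s D \<Longrightarrow> 0 < D"
  by (simp_all add: contracting_def)

lemma contractingD:
  "contracting s D \<Longrightarrow> x \<in> S \<Longrightarrow> y \<in> S \<Longrightarrow> D \<le> \<bar>prj s x - prj s y\<bar> \<Longrightarrow>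
     \<exists>l. 0 \<le> l \<and> l \<le> 1 \<and> d (pt x y l) (s (prj s x)) \<le> D"
  unfolding contracting_def by (meson atLeastAtMost_iff)

lemma contracting_rev:
  assumes "contracting s D"
  shows "contracting (\<lambda>t. s (- t)) D"
proof -
  have "D \<le> \<bar>prj s x - prj s y\<bar>" if "D \<le> \<bar>- prj s x + prj s y\<bar>" for x y using that by linarith
  then show ?thesis using assms line_rev[of s] unfolding contracting_def by (auto simp: prj_rev)
qed

text \<open>Translations along the axis carry \<open>axis_near_zero\<close> from \<open>s 0\<close>
  to any \<open>s c\<close>, at the cost of one period \<open>l\<close>. It is used at the parameter
  at distance \<open>T'\<close> from the foot of \<open>x\<close>, on the side of the foot of
  \<open>y\<close>.\<close>

lemma rank_one_axis_contracting:
  assumes h: "isom h" and s: "axis h s l" and nb: "\<not> bounds_flat_half_plane M s"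
  shows "\<exists>D. contracting s D"
proof -
  have sl: "line s" and l: "l > 0" using s by (auto simp: is_axis_def)
  obtain R T where RT: "\<And>x y. x \<in> S \<Longrightarrow> y \<in> S \<Longrightarrow> prj s x \<le> - T \<Longrightarrow> T \<le> prj s y \<Longrightarrow> \<exists>l\<in>{0..1}. d (pt x y l) (s 0) \<le> R"
    using axis_near_zero[OF h s nb] by blast
  have near: "\<exists>k\<in>{0..1}. d (pt x y k) (s c) \<le> R + l"
    if x: "x \<in> S" and y: "y \<in> S" and c: "prj s x \<le> c - (T + l)" "c + (T + l) \<le> prj s y" for x y c
  proof -
    define j where "j = \<lfloor>c / l\<rfloor>"
    have j: "of_int j * l \<le> c" "c \<le> of_int j * l + l"
    proof -
      have "of_int j \<le> c / l" "c / l < of_int j + 1" by (auto simp: j_def)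
      then show "of_int j * l \<le> c" "c \<le> of_int j * l + l" using l by (auto simp: field_simps)
    qed
    obtain f where f: "isom f" "\<And>t. f (s t) = s (t + of_int (- j) * l)" using axis_translate[OF h s] by blast
    have "prj s (f x) = prj s x + of_int (- j) * l" "prj s (f y) = prj s y + of_int (- j) * l"
      using prj_isom_line f sl x y by blast+
    then have p: "prj s (f x) \<le> - T" "T \<le> prj s (f y)" using j c by auto
    obtain k where k: "0 \<le> k" "k \<le> 1" "d (pt (f x) (f y) k) (s 0) \<le> R"
      using RT[OF isom_in[OF f(1) x] isom_in[OF f(1) y] p] by auto
    have "s 0 = f (s (of_int j * l))" by (simp add: f(2))
    then have "d (pt x y k) (s (of_int j * l)) \<le> R"
      using k f(1) x y sl isom_d[OF f(1), of "pt x y k" "s (of_int j * l)"] by (simp add: isom_pt)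
    moreover have "d (pt x y k) (s c) \<le> d (pt x y k) (s (of_int j * l)) + d (s (of_int j * l)) (s c)"
      using k x y sl by (intro tri) auto
    ultimately show ?thesis using k j sl by (intro bexI[of _ k]) (auto simp: line_d)
  qed
  define T' where "T' = \<bar>T\<bar> + l"
  \<comment> \<open>\<open>2 * T'\<close> leaves room \<open>T'\<close> on both sides of the chosen
    parameter, and \<open>T' + \<bar>R\<bar> + l\<close> pays for the way back to the foot of
    \<open>x\<close>.\<close>
  define D where "D = 2 * T' + \<bar>R\<bar> + l"
  have T': "0 < T'" "T + l \<le> T'" using l by (auto simp: T'_def)
  have D: "0 < D" using T' l by (simp add: D_def)
  have "\<exists>k\<in>{0..1}. d (pt x y k) (s (prj s x)) \<le> D" if xy: "x \<in> S" "y \<in> S" and far: "D \<le> \<bar>prj s x - prj s y\<bar>" for x y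
  proof -
    have *: "d z (s (prj s x)) \<le> D" if "z \<in> S" "d z (s c) \<le> R + l" "\<bar>c - prj s x\<bar> = T'" for z c
      using tri[of z "s c" "s (prj s x)"] that sl T' by (simp add: line_d D_def)
    show ?thesis
    proof (cases "prj s x \<le> prj s y")
      case True
      then have "prj s x + 2 * T' \<le> prj s y" using far l by (simp add: D_def)
      then obtain k where "k \<in> {0..1}" "d (pt x y k) (s (prj s x + T')) \<le> R + l"
        using near[OF xy, of "prj s x + T'"] T' by auto
      then show ?thesis using *[of "pt x y k" "prj s x + T'"] xy T' by auto
    next
      case False
      then have "prj s y + 2 * T' \<le> prj s x" using far l by (simp add: D_def)
      then obtain k where k: "k \<in> {0..1}" "d (pt y x k) (s (prj s x - T')) \<le> R + l"
        using near[OF xy(2,1), of "prj s x - T'"] T' by auto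
      moreover have "pt y x k = pt x y (1 - k)" using k xy by (intro pt_sym) auto
      ultimately show ?thesis using *[of "pt x y (1 - k)" "prj s x - T'"] xy T' by (intro bexI[of _ "1 - k"]) auto
    qed
  qed
  then show ?thesis using sl D by (auto simp: contracting_def)
qed

section \<open>Projections of one axis to another\<close>

lemma behrstock:
  assumes a: "line a" and b: "contracting b D" and x: "x \<in> S"
    and far: "\<And>t. D \<le> \<bar>prj b x - prj b (a t)\<bar>"
  shows "\<exists>t. \<bar>prj a x - prj a (b t)\<bar> \<le> D"
proof -
  have bl: "line b" using b by (rule contracting_line)
  \<comment> \<open>The geodesic from \<open>x\<close> to its foot on \<open>a\<close> has to pass
    close to \<open>b\<close>, and all its points have the same foot on \<open>a\<close> as
    \<open>x\<close>.\<close>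
  obtain l where l: "0 \<le> l" "l \<le> 1" "d (pt x (a (prj a x)) l) (b (prj b x)) \<le> D"
    using contractingD[OF b x _ far, of "prj a x"] a by auto
  let ?z = "pt x (a (prj a x)) l"
  have z: "?z \<in> S" using l a x by auto
  have "\<bar>prj a ?z - prj a (b (prj b x))\<bar> \<le> d ?z (b (prj b x))" using a z bl by (intro prj_lip) auto
  then show ?thesis using prj_pt[OF a x l(1,2)] l(3) by (intro exI[of _ "prj b x"]) simp
qed

lemma prj_continuous:
  assumes "line a" "line b"
  shows "continuous_on A (\<lambda>t. prj a (b t))"
proof (rule lipschitz_on_continuous_on[of 1], rule lipschitz_onI)
  fix t t' show "dist (prj a (b t)) (prj a (b t')) \<le> 1 * dist t t'"
    using prj_lip[of a "b t" "b t'"] assms by (simp add: line_d dist_real_def)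
qed simp

lemma asymptotic_endpoint:
  assumes "line a" "line b" "\<And>t. 0 \<le> t \<Longrightarrow> d (a t) (b t) \<le> K"
  shows "ray_endpoint M a = ray_endpoint M b"
proof -
  have "(a, b) \<in> asymptotic_rel M"
    using assms by (auto simp: asymptotic_rel_def geodesic_ray_def line_d)
  then show ?thesis unfolding ray_endpoint_def by (rule equiv_class_eq[OF equiv_asymptotic_rel])
qed

text \<open>Up to \<open>2 * D\<close> the foot moves as far as the point itself, and
  \<open>fwd\<close> fixes the direction; so \<open>p v - v\<close> is bounded.\<close>

lemma ray_near_line_forward:
  assumes a: "line a" and b: "line b" and near: "\<And>v. A \<le> v \<Longrightarrow> d (a v) (b (prj b (a v))) \<le> D"
    and fwd: "\<And>v. A + 2 * D + 1 \<le> v \<Longrightarrow> prj b (a A) < prj b (a v)"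
  shows "ray_endpoint M a = ray_endpoint M b"
proof -
  have D: "0 \<le> D" using near[of A] mdist_nonneg[of M "a A" "b (prj b (a A))"] by linarith
  define p where "p v = prj b (a v)" for v
  define A' where "A' = \<bar>A\<bar> + 2 * D + 1"
  define K where "K = d (a 0) (b 0) + 2 * A' + 3 * D + \<bar>p A - A\<bar>"
  have lip: "\<bar>p v - p w\<bar> \<le> \<bar>v - w\<bar>" for v w
    using prj_lip[OF b, of "a v" "a w"] a by (simp add: p_def line_d)
  show ?thesis
  proof (rule asymptotic_endpoint[OF a b])
    fix v :: real assume v: "0 \<le> v"
    show "d (a v) (b v) \<le> K"
    proof (cases "A' \<le> v")
      case True
      then have Av: "A \<le> v" "A + 2 * D + 1 \<le> v" using D by (auto simp: A'_def)
      have "\<bar>v - A\<bar> \<le> d (a v) (b (p v)) + (d (b (p v)) (b (p A)) + d (b (p A)) (a A))"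
        using tri[of "a v" "b (p v)" "a A"] tri[of "b (p v)" "b (p A)" "a A"] a b by (simp add: line_d)
      also have "\<dots> \<le> D + (\<bar>p v - p A\<bar> + D)"
        using near[of A] near[OF Av(1)] b by (simp add: p_def line_d dsym)
      finally have "v - A - 2 * D \<le> p v - p A" using fwd[OF Av(2)] by (simp add: p_def)
      then have "\<bar>p v - v\<bar> \<le> 2 * D + \<bar>p A - A\<bar>" using lip[of v A] Av by linarith
      moreover have "d (a v) (b v) \<le> d (a v) (b (p v)) + d (b (p v)) (b v)" using a b by (intro tri) auto
      ultimately have "d (a v) (b v) \<le> D + (2 * D + \<bar>p A - A\<bar>)"
        using near[OF Av(1)] b by (simp add: p_def line_d)
      moreover have "0 \<le> A'" using D by (simp add: A'_def)
      ultimately show ?thesis unfolding K_def using mdist_nonneg[of M "a 0" "b 0"] by linarith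
    next
      case False
      have "d (a v) (b v) \<le> d (a v) (a 0) + (d (a 0) (b 0) + d (b 0) (b v))"
        using tri[of "a v" "a 0" "b v"] tri[of "a 0" "b 0" "b v"] a b by simp
      then show ?thesis using False v a b D by (simp add: line_d K_def)
    qed
  qed
qed

text \<open>From \<open>A + 2 * D + 1\<close> on, the foot keeps distance at least one from the foot
  of \<open>a A\<close>. By connectedness it stays on one side, so the ray follows \<open>b\<close>
  or its reversal.\<close>

lemma ray_near_line:
  assumes a: "line a" and b: "line b" and near: "\<And>v. A \<le> v \<Longrightarrow> \<exists>t. d (a v) (b t) \<le> D"
  shows "ray_endpoint M a = ray_endpoint M b \<or> ray_endpoint M a = ray_endpoint M (\<lambda>t. b (- t))"
proof -
  define p where "p v = prj b (a v)" for v
  have near': "d (a v) (b (p v)) \<le> D" if v: "A \<le> v" for v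
  proof -
    obtain t where "d (a v) (b t) \<le> D" using near[OF v] by blast
    moreover have "d (a v) (b (p v)) \<le> d (a v) (b t)" unfolding p_def using a b by (intro prj_min) auto
    ultimately show ?thesis by simp
  qed
  have D: "0 \<le> D" using near'[of A] mdist_nonneg[of M "a A" "b (p A)"] by linarith
  have far: "1 \<le> \<bar>p v - p A\<bar>" if v: "A + 2 * D + 1 \<le> v" for v
  proof -
    have "\<bar>v - A\<bar> \<le> d (a v) (b (p v)) + (d (b (p v)) (b (p A)) + d (b (p A)) (a A))"
      using tri[of "a v" "b (p v)" "a A"] tri[of "b (p v)" "b (p A)" "a A"] a b by (simp add: line_d)
    also have "\<dots> \<le> D + (\<bar>p v - p A\<bar> + D)"
      using near'[of A] near'[of v] b v D by (simp add: line_d dsym)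
    finally show ?thesis using v by linarith
  qed
  show ?thesis
  proof (cases "\<forall>v\<ge>A + 2 * D + 1. p A < p v")
    case True
    then show ?thesis using ray_near_line_forward[OF a b near'[unfolded p_def]] by (auto simp: p_def)
  next
    case False
    then obtain v where v: "A + 2 * D + 1 \<le> v" "p v \<le> p A" by force
    have neg: "p w < p A" if w: "A + 2 * D + 1 \<le> w" for w
    proof (rule ccontr)
      assume "\<not> p w < p A"
      have "connected ((\<lambda>t. p t) ` {A + 2 * D + 1..})"
        unfolding p_def using a b by (intro connected_continuous_image prj_continuous) auto
      then have "p A \<in> p ` {A + 2 * D + 1..}"
        by (rule connectedD_interval[of _ "p v" "p w"]) (use v w \<open>\<not> p w < p A\<close> in auto)
      then show False using far by force
    qed
    have "ray_endpoint M a = ray_endpoint M (\<lambda>t. b (- t))"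
      by (rule ray_near_line_forward[OF a line_rev[OF b], of A D])
        (use near' neg a b in \<open>auto simp: prj_rev p_def\<close>)
    then show ?thesis by simp
  qed
qed

text \<open>By connectedness every large \<open>v\<close> is the foot of some \<open>b u\<close>.
  Contraction for \<open>b u\<close> and \<open>b 0\<close>, whose geodesic is part of
  \<open>b\<close>, brings \<open>b\<close> close to \<open>a v\<close>.\<close>

lemma unbounded_projection_endpoint:
  assumes a: "contracting a D" and b: "line b" and unb: "\<And>B. \<exists>t. B < prj a (b t)"
  shows "ray_endpoint M a = ray_endpoint M b \<or> ray_endpoint M a = ray_endpoint M (\<lambda>t. b (- t))"
proof (rule ray_near_line[OF contracting_line[OF a] b])
  have al: "line a" using a by (rule contracting_line)
  fix v assume v: "prj a (b 0) + D \<le> v"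
  obtain t where t: "v < prj a (b t)" using unb by blast
  have "connected ((\<lambda>t. prj a (b t)) ` UNIV)"
    using al b by (intro connected_continuous_image prj_continuous) auto
  then have "v \<in> (\<lambda>t. prj a (b t)) ` UNIV"
    by (rule connectedD_interval[of _ "prj a (b 0)" "prj a (b t)"]) (use v t contracting_pos[OF a] in auto)
  then obtain u where u: "prj a (b u) = v" by auto
  have "D \<le> \<bar>prj a (b u) - prj a (b 0)\<bar>" using u v by linarith
  then obtain l where l: "0 \<le> l" "l \<le> 1" "d (pt (b u) (b 0) l) (a (prj a (b u))) \<le> D"
    using contractingD[OF a, of "b u" "b 0"] b by auto
  then show "\<exists>t. d (a v) (b t) \<le> D" using b u by (auto simp: line_pt dsym)
qed

text \<open>Independence of the isometries enters here: an unbounded projection, in either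
  direction, would produce a common end point.\<close>

lemma bounded_projection:
  assumes a: "contracting a D" and b: "line b"
    and disj: "{ray_endpoint M a, ray_endpoint M (\<lambda>t. a (- t))} \<inter> {ray_endpoint M b, ray_endpoint M (\<lambda>t. b (- t))} = {}"
  shows "\<exists>B. \<forall>t. \<bar>prj a (b t)\<bar> \<le> B"
proof -
  have "\<exists>B. \<forall>t. prj a (b t) \<le> B"
    using unbounded_projection_endpoint[OF a b] disj by (auto simp: not_le[symmetric])
  then obtain B where B: "\<And>t. prj a (b t) \<le> B" by blast
  have "\<exists>B. \<forall>t. prj (\<lambda>t. a (- t)) (b t) \<le> B"
    using unbounded_projection_endpoint[OF contracting_rev[OF a] b] disj by (auto simp: not_le[symmetric])
  then obtain B' where B': "\<And>t. - prj a (b t) \<le> B'" using contracting_line[OF a] b by (auto simp: prj_rev)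
  show ?thesis
  proof (intro exI allI)
    fix t show "\<bar>prj a (b t)\<bar> \<le> \<bar>B\<bar> + \<bar>B'\<bar>" using B[of t] B'[of t] by linarith
  qed
qed

subsection \<open>Isometries attaining their minimal displacement\<close>

lemma isom_pow: "isom f \<Longrightarrow> isom (f [^]\<^bsub>IG\<^esub> (k::int))"
  by (rule group.int_pow_closed[OF group_isometry_group])

lemma isom_pow_0: "x \<in> S \<Longrightarrow> (f [^]\<^bsub>IG\<^esub> (0::int)) x = x"
  by (simp add: isom_one_app)

lemma isom_pow_1: "isom f \<Longrightarrow> f [^]\<^bsub>IG\<^esub> (1::int) = f"
  by (rule group.int_pow_1[OF group_isometry_group])

lemma isom_pow_add: "isom f \<Longrightarrow> x \<in> S \<Longrightarrow> (f [^]\<^bsub>IG\<^esub> (j + k :: int)) x = (f [^]\<^bsub>IG\<^esub> j) ((f [^]\<^bsub>IG\<^esub> k) x)"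
  by (simp add: group.int_pow_mult[OF group_isometry_group] isom_mult_app isom_pow)

lemma axis_pow:
  assumes f: "isom f" and ax: "axis f s l"
  shows "(f [^]\<^bsub>IG\<^esub> (k::int)) (s t) = s (t + of_int k * l)"
proof -
  have sl: "line s" using ax by (rule axis_line)
  have nn: "(f [^]\<^bsub>IG\<^esub> int n) (s t) = s (t + of_int (int n) * l)" for n t
  proof (induction n)
    case 0 show ?case using isom_pow_0[of "s t" f] sl by simp
  next
    case (Suc n)
    have "int (Suc n) = 1 + int n" by simp
    then have "(f [^]\<^bsub>IG\<^esub> int (Suc n)) (s t) = (f [^]\<^bsub>IG\<^esub> (1 + int n)) (s t)" by (simp only:)
    also have "\<dots> = f ((f [^]\<^bsub>IG\<^esub> int n) (s t))"
      using isom_pow_add[OF f, of "s t" 1 "int n"] sl by (simp only: isom_pow_1[OF f] line_in)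
    also have "\<dots> = s (t + of_int (int (Suc n)) * l)"
      unfolding Suc using ax by (simp add: is_axis_def algebra_simps)
    finally show ?case .
  qed
  show ?thesis
  proof (cases "0 \<le> k")
    case True then show ?thesis using nn[of "nat k" t] by simp
  next
    case False
    then obtain n where k: "k = - int n" by (metis linear nat_0_le neg_0_le_iff_le minus_minus)
    have "(f [^]\<^bsub>IG\<^esub> int n) (s (t + of_int k * l)) = s t" unfolding nn by (simp add: k)
    then have "(f [^]\<^bsub>IG\<^esub> k) (s t) = (f [^]\<^bsub>IG\<^esub> k) ((f [^]\<^bsub>IG\<^esub> int n) (s (t + of_int k * l)))" by simp
    also have "\<dots> = (f [^]\<^bsub>IG\<^esub> (k + int n)) (s (t + of_int k * l))"
      by (rule isom_pow_add[OF f, symmetric]) (simp add: sl)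
    also have "\<dots> = s (t + of_int k * l)" using isom_pow_0[of "s (t + of_int k * l)" f] sl by (simp add: k)
    finally show ?thesis .
  qed
qed

text \<open>The midpoint of \<open>z\<close> and \<open>f z\<close> is mapped to the midpoint of
  \<open>f z\<close> and \<open>f (f z)\<close>, so it is moved by at most half of
  \<open>d z (f (f z))\<close>.\<close>

lemma double_displacement:
  assumes f: "isom f" and c: "\<And>z. z \<in> S \<Longrightarrow> c \<le> d z (f z)" and z: "z \<in> S"
  shows "2 * c \<le> d z (f (f z))"
proof -
  have fz: "f z \<in> S" "f (f z) \<in> S" using f z isom_in by blast+
  let ?m = "pt (f z) z (1/2)"
  have m: "?m = pt z (f z) (1/2)" using pt_sym[of z "f z" "1/2"] fz z by simp
  have "f ?m = pt (f z) (f (f z)) (1/2)" unfolding m using isom_pt[OF f z fz(1), of "1/2"] by simp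
  moreover have "d (pt (f z) z (1/2)) (pt (f z) (f (f z)) (1/2)) \<le> 1/2 * d z (f (f z))"
    using fz z by (intro pt_common_start_dist) auto
  moreover have "c \<le> d ?m (f ?m)" using fz z by (intro c) auto
  ultimately show ?thesis by simp
qed

text \<open>Repeated doubling gives the lower bound for the exponents \<open>2 ^ n\<close>. For
  general \<open>n\<close> the orbit is continued to \<open>2 ^ n\<close>; the triangle inequality
  is sharp there and therefore sharp at \<open>n\<close>.\<close>

lemma orbit_on_geodesic:
  assumes f: "isom f" and y: "y \<in> S" and min: "\<And>z. z \<in> S \<Longrightarrow> d y (f y) \<le> d z (f z)"
  shows "d ((f [^]\<^bsub>IG\<^esub> (j::int)) y) ((f [^]\<^bsub>IG\<^esub> (k::int)) y) = of_int \<bar>j - k\<bar> * d y (f y)"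
proof -
  let ?P = "\<lambda>k::int. f [^]\<^bsub>IG\<^esub> k"
  define l where "l = d y (f y)"
  have P: "isom (?P k)" for k using f by (rule isom_pow)
  have PS: "z \<in> S \<Longrightarrow> ?P k z \<in> S" for k z using P isom_in by blast
  have shift: "d (?P j y) (?P (j + k) y) = d y (?P k y)" for j k
    using isom_d[OF P y PS[OF y]] isom_pow_add[OF f y] by simp
  have pw2: "2 ^ n * l \<le> d z (?P (2 ^ n) z)" if "z \<in> S" for n z using that
  proof (induction n arbitrary: z)
    case 0 then show ?case using min isom_pow_1[OF f] by (simp add: l_def)
  next
    case (Suc n)
    have "2 * (2 ^ n * l) \<le> d z (?P (2 ^ n) (?P (2 ^ n) z))"
      by (rule double_displacement[OF P Suc.IH Suc.prems])
    also have "?P (2 ^ n) (?P (2 ^ n) z) = ?P (2 ^ n + 2 ^ n) z" by (rule isom_pow_add[OF f Suc.prems, symmetric])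
    also have "(2::int) ^ n + 2 ^ n = 2 ^ Suc n" by simp
    finally show ?case by (simp only: power_Suc mult.assoc)
  qed
  have up: "d y (?P (int n) y) \<le> real n * l" for n
  proof (induction n)
    case 0 show ?case using y isom_pow_0[OF y, of f] by simp
  next
    case (Suc n)
    have "d y (?P (int n + 1) y) \<le> d y (?P (int n) y) + d (?P (int n) y) (?P (int n + 1) y)"
      using y PS by (intro tri) auto
    also have "d (?P (int n) y) (?P (int n + 1) y) = l" unfolding shift by (simp add: isom_pow_1[OF f] l_def)
    finally show ?case using Suc by (simp add: algebra_simps)
  qed
  have eq: "d y (?P (int n) y) = real n * l" for n
  proof (rule antisym[OF up])
    obtain m where m: "2 ^ n = n + m" using le_Suc_ex[OF less_imp_le[OF less_exp[of n]]] by auto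
    have "real (2 ^ n) * l \<le> d y (?P (int (2 ^ n)) y)" using pw2[OF y, of n] by simp
    also have "int (2 ^ n) = int n + int m" using m by simp
    also have "d y (?P (int n + int m) y) \<le> d y (?P (int n) y) + d (?P (int n) y) (?P (int n + int m) y)"
      using y PS by (intro tri) auto
    also have "\<dots> \<le> d y (?P (int n) y) + real m * l" unfolding shift using up by simp
    finally show "real n * l \<le> d y (?P (int n) y)" using m by (simp add: algebra_simps)
  qed
  have *: "d (?P j y) (?P k y) = of_int (k - j) * l" if "j \<le> k" for j k
  proof -
    obtain n where "k = j + int n" using \<open>j \<le> k\<close> zle_iff_zadd by blast
    then show ?thesis using shift[of j "int n"] eq[of n] by simp
  qed
  show ?thesis
  proof (cases "j \<le> k")
    case True then show ?thesis using *[of j k] by (simp add: l_def)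
  next
    case False then show ?thesis using *[of k j] dsym[of "?P j y" "?P k y"] by (simp add: l_def)
  qed
qed

text \<open>The axis is the concatenation of the translates of the segment from \<open>y\<close> to
  \<open>f y\<close>. A shortcut between two of its points would shorten the orbit of
  \<open>y\<close>, against \<open>orbit_on_geodesic\<close>.\<close>

lemma min_displacement_axis:
  assumes f: "isom f" and y: "y \<in> S" and min: "\<And>z. z \<in> S \<Longrightarrow> d y (f y) \<le> d z (f z)" and pos: "0 < d y (f y)"
  shows "\<exists>s. axis f s (d y (f y))"
proof -
  let ?P = "\<lambda>k::int. f [^]\<^bsub>IG\<^esub> k"
  define l where "l = d y (f y)"
  have l: "0 < l" using pos by (simp add: l_def)
  have P: "isom (?P k)" for k using f by (rule isom_pow)
  have PS: "z \<in> S \<Longrightarrow> ?P k z \<in> S" for k z using P isom_in by blast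
  have orb: "d (?P j y) (?P k y) = of_int \<bar>j - k\<bar> * l" for j k
    unfolding l_def by (rule orbit_on_geodesic[OF f y min])
  have fy: "f y \<in> S" using f y isom_in by blast
  define k where "k t = \<lfloor>t / l\<rfloor>" for t
  define r where "r t = t / l - of_int (k t)" for t
  have r: "0 \<le> r t" "r t \<le> 1" for t by (auto simp: r_def k_def) linarith
  have t: "t = (of_int (k t) + r t) * l" for t using l by (simp add: r_def)
  define s where "s t = ?P (k t) (pt y (f y) (r t))" for t
  have pS: "pt y (f y) (r t) \<in> S" for t using r y fy by auto
  have sS: "s t \<in> S" for t using PS[OF pS] by (simp add: s_def)
  have Pf: "?P j (f y) = ?P (j + 1) y" for j using isom_pow_add[OF f y, of j 1] by (simp add: isom_pow_1[OF f])
  have left: "d (?P (k t) y) (s t) = r t * l" for t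
    using isom_d[OF P y pS] r y fy by (simp add: s_def d_pt_simps l_def)
  have right: "d (s t) (?P (k t + 1) y) = (1 - r t) * l" for t
    using isom_d[OF P pS fy] r y fy by (simp add: s_def d_pt_simps l_def flip: Pf)
  have main: "d (s u) (s v) = v - u" if uv: "u \<le> v" for u v
  proof (cases "k u = k v")
    case True
    have "d (s u) (s v) = d (pt y (f y) (r u)) (pt y (f y) (r v))"
      using isom_d[OF P pS pS] by (simp add: s_def True)
    also have "\<dots> = \<bar>r u - r v\<bar> * l" using r y fy by (simp add: d_pt_pt l_def)
    also have "r u - r v = (u - v) / l" using True by (simp add: r_def diff_divide_distrib)
    also have "\<bar>(u - v) / l\<bar> * l = v - u" using l uv by (simp add: abs_if divide_simps)
    finally show ?thesis .
  next
    case False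
    have "k u \<le> k v" using uv l by (simp add: k_def floor_mono divide_right_mono)
    then have kk: "k u + 1 \<le> k v" using False by simp
    have vu: "v - u = (of_int (k v) - of_int (k u) + r v - r u) * l"
      using t[of u] t[of v] by (simp add: algebra_simps)
    have "d (s u) (s v) \<le> d (s u) (?P (k u + 1) y) + (d (?P (k u + 1) y) (?P (k v) y) + d (?P (k v) y) (s v))"
      using tri[of "s u" "?P (k u + 1) y" "s v"] tri[of "?P (k u + 1) y" "?P (k v) y" "s v"] sS PS[OF y] by simp
    also have "\<dots> = v - u" unfolding vu left right orb using kk by (simp add: algebra_simps)
    finally have up: "d (s u) (s v) \<le> v - u" .
    have "d (?P (k u) y) (?P (k v + 1) y) \<le> d (?P (k u) y) (s u) + (d (s u) (s v) + d (s v) (?P (k v + 1) y))"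
      using tri[of "?P (k u) y" "s u" "?P (k v + 1) y"] tri[of "s u" "s v" "?P (k v + 1) y"] sS PS[OF y] by simp
    then have "v - u \<le> d (s u) (s v)" unfolding vu left right orb using kk by (simp add: algebra_simps)
    then show ?thesis using up by simp
  qed
  have ls: "line s"
    unfolding geodesic_line_def
  proof (intro conjI allI)
    show "range s \<subseteq> S" using sS by auto
    fix u v show "d (s u) (s v) = \<bar>u - v\<bar>"
    proof (cases "u \<le> v")
      case True then show ?thesis using main[of u v] by simp
    next
      case False then show ?thesis using main[of v u] dsym[of "s u" "s v"] by simp
    qed
  qed
  have "f (s t) = s (t + l)" for t
  proof -
    have k1: "k (t + l) = k t + 1"
    proof -
      have "(t + l) / l = t / l + 1" using l by (simp add: add_divide_distrib)
      then show ?thesis by (simp add: k_def)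
    qed
    have rt: "r (t + l) = r t" using l by (simp add: r_def k1 add_divide_distrib)
    have "s (t + l) = ?P (1 + k t) (pt y (f y) (r t))" unfolding s_def k1 rt by (simp only: add.commute)
    also have "\<dots> = f (s t)" using isom_pow_add[OF f pS, of 1 "k t"] by (simp add: isom_pow_1[OF f] s_def)
    finally show ?thesis by simp
  qed
  then show ?thesis using ls l by (auto simp: is_axis_def l_def)
qed

section \<open>Translates of a contracting line\<close>

lemma isom_line:
  assumes g: "isom g" and b: "line b"
  shows "line (\<lambda>t. g (b t))"
  unfolding geodesic_line_def
proof (intro conjI allI)
  show "range (\<lambda>t. g (b t)) \<subseteq> S" using isom_in[OF g line_in[OF b]] by auto
  fix u v show "d (g (b u)) (g (b v)) = \<bar>u - v\<bar>" using isom_d[OF g] b by (simp add: line_d)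
qed

lemma prj_isom:
  assumes "isom g" "line b" "z \<in> S"
  shows "prj (\<lambda>t. g (b t)) (g z) = prj b z"
proof -
  have "line (\<lambda>t. g (b t))" by (rule isom_line[OF assms(1,2)])
  then show ?thesis
  proof (rule prj_eqI)
    show "g z \<in> S" using assms(1,3) by (rule isom_in)
    fix t show "d (g z) (g (b (prj b z))) \<le> d (g z) (g (b t))"
      using isom_d[OF assms(1,3)] prj_min[OF assms(2,3), of t] assms(2) by simp
  qed
qed

text \<open>If some \<open>g (b t)\<close> projected far out, the geodesic from \<open>g x\<close>
  to it would pass near \<open>b a\<close>. Its preimage follows \<open>b\<close>, so some
  \<open>g (b v)\<close> is near \<open>b a\<close>. Then \<open>v\<close> is close to the foot of
  \<open>g^-1 x\<close>, hence bounded, and \<open>g\<close> moves \<open>x\<close> only boundedly.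
  The constants in \<open>far\<close> add up the errors of this loop.\<close>

lemma projection_of_translate:
  assumes c: "contracting b D" and g: "isom g" and x: "x \<in> S"
    and B: "\<bar>prj b (g x)\<bar> \<le> B" "\<bar>prj b ((inv\<^bsub>IG\<^esub> g) x)\<bar> \<le> B"
    and far: "2 * D + 5 * d x (b 0) + 3 * B < d x (g x)"
  shows "\<bar>prj b (g (b t))\<bar> \<le> B + D"
proof (rule ccontr)
  assume no: "\<not> ?thesis"
  have bl: "line b" using c by (rule contracting_line)
  define E where "E = d x (b 0)"
  have gS: "g x \<in> S" "g (b v) \<in> S" for v using g x bl isom_in by auto
  have iS: "(inv\<^bsub>IG\<^esub> g) x \<in> S" using isom_in[OF isom_inv[OF g] x] .
  define a where "a = prj b (g x)"
  have "D \<le> \<bar>prj b (g x) - prj b (g (b t))\<bar>" using no B by linarith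
  then obtain l where l: "0 \<le> l" "l \<le> 1" "d (pt (g x) (g (b t)) l) (b a) \<le> D"
    using contractingD[OF c gS(1) gS(2)] unfolding a_def by blast
  define v where "v = (1 - l) * 0 + l * t"
  have "d (pt x (b t) l) (pt (b 0) (b t) l) \<le> (1 - l) * d x (b 0) + l * d (b t) (b t)"
    using x bl l by (intro pt_dist_convex) auto
  also have "\<dots> \<le> E" using l bl by (simp add: E_def mult_left_le_one_le)
  finally have 1: "d (pt x (b t) l) (b v) \<le> E" using l bl line_pt[OF bl l(1,2), of 0 t] by (simp add: v_def)
  have pS: "pt x (b t) l \<in> S" using x bl l by auto
  have "d (g (pt x (b t) l)) (g (b v)) \<le> E" using 1 isom_d[OF g pS] bl by simp
  moreover have "d (g (pt x (b t) l)) (b a) \<le> D" using l isom_pt[OF g x _ l(1,2), of "b t"] bl by simp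
  moreover have "d (b a) (g (b v)) \<le> d (b a) (g (pt x (b t) l)) + d (g (pt x (b t) l)) (g (b v))"
    using bl gS isom_in[OF g pS] by (intro tri) auto
  ultimately have 2: "d (b a) (g (b v)) \<le> D + E" by (simp add: dsym)
  have "d x (b a) \<le> E + B" using tri[of x "b 0" "b a"] x bl B by (simp add: E_def line_d a_def)
  then have 3: "d x (g (b v)) \<le> D + 2 * E + B" using 2 tri[of x "b a" "g (b v)"] x bl gS by simp
  have "d ((inv\<^bsub>IG\<^esub> g) x) (b v) = d x (g (b v))"
    using isom_d[OF g iS, of "b v"] bl isom_inv_app(2)[OF g x] by simp
  then have "\<bar>prj b ((inv\<^bsub>IG\<^esub> g) x) - v\<bar> \<le> D + 2 * E + B"
    using prj_lip[OF bl iS, of "b v"] 3 bl by (simp add: prj_line)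
  then have v: "\<bar>v\<bar> \<le> D + 2 * E + 2 * B" using B by linarith
  have "d x (g x) \<le> d x (g (b v)) + d (g (b v)) (g x)" using x gS by (intro tri) auto
  also have "d (g (b v)) (g x) = d (b v) x" using isom_d[OF g _ x] bl by simp
  also have "d (b v) x \<le> \<bar>v\<bar> + E" using tri[of "b v" "b 0" x] x bl by (simp add: line_d E_def dsym)
  finally show False using v 3 far by (simp add: E_def)
qed

end

section \<open>Chains of translates of a contracting line\<close>

text \<open>The isometry \<open>dl\<close> is \<open>g \<otimes> F\<close> where \<open>F\<close> translates the contracting line \<open>b\<close> by \<open>w\<close> and \<open>g\<close> is
  arbitrary. The translates \<open>dl^k b\<close> of the line are arranged along a chain: seen from \<open>dl^k b\<close>, the
  points ahead project near the parameter \<open>0\<close> and those behind near \<open>- w\<close>.\<close>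

locale translate_chain = CN_space +
  fixes b :: "real \<Rightarrow> 'a" and D :: real and F g :: "'a \<Rightarrow> 'a" and w B :: real and x0 :: 'a
  assumes contr: "contracting b D"
    and F: "isom F" and Fb: "\<And>t. F (b t) = b (t + w)"
    and g: "isom g"
    and g_proj: "\<And>t. \<bar>prj b (g (b t))\<bar> \<le> B"
    and gi_proj: "\<And>t. \<bar>prj b ((inv\<^bsub>IG\<^esub> g) (b t))\<bar> \<le> B"
    and x0: "x0 \<in> S" "\<bar>prj b x0\<bar> \<le> B" "\<bar>prj b (g x0)\<bar> \<le> B" "\<bar>prj b ((inv\<^bsub>IG\<^esub> g) x0)\<bar> \<le> B"
    and w: "3 * B + 3 * D + 1 \<le> w"
begin

definition dl where "dl = g \<otimes>\<^bsub>IG\<^esub> F"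
abbreviation pw where "pw \<equiv> \<lambda>k::int. dl [^]\<^bsub>IG\<^esub> k"
definition E where "E = d x0 (b 0)"
definition H where "H = B + D"
text \<open>By equivariance this is the foot of \<open>y\<close> on the line \<open>pw k b\<close>,
  in the parameter of that line.\<close>

definition c where "c k y = prj b (pw (- k) y)"

lemma bl [simp]: "line b" using contr by (rule contracting_line)
lemma D: "0 < D" using contr by (rule contracting_pos)
lemma B0: "0 \<le> B" using x0(2) by linarith
lemma H: "0 < H" "2 * H + D \<le> w" "2 * H < w" using D B0 w by (auto simp: H_def)

lemma dl: "isom dl" unfolding dl_def by (rule isom_mult[OF g F])
lemma dl_app: "y \<in> S \<Longrightarrow> dl y = g (F y)" unfolding dl_def by (rule isom_mult_app[OF g F])
lemma pwi: "isom (pw k)" using dl by (rule isom_pow)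
lemma pwS: "y \<in> S \<Longrightarrow> pw k y \<in> S" using pwi by (rule isom_in)
lemma pw_add: "y \<in> S \<Longrightarrow> pw (j + k) y = pw j (pw k y)" using dl by (rule isom_pow_add)
lemma pw_0: "y \<in> S \<Longrightarrow> pw 0 y = y" by (rule isom_pow_0)
lemma pw_1: "pw 1 = dl" using dl by (rule isom_pow_1)
lemma pw_d: "y \<in> S \<Longrightarrow> z \<in> S \<Longrightarrow> d (pw k y) (pw k z) = d y z" using pwi by (rule isom_d)
lemma pw_inv: "y \<in> S \<Longrightarrow> pw k (pw (- k) y) = y"
  using pw_add[of y k "- k"] pw_0[of y] by simp

lemma pw_m1: "y \<in> S \<Longrightarrow> pw (- 1) y = (inv\<^bsub>IG\<^esub> dl) y"
  using isom_inv_app(1)[OF dl pwS, of y "- 1"] pw_inv[of y 1] by (simp add: pw_1)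

lemma pw_m1_app:
  assumes y: "y \<in> S"
  shows "pw (- 1) y = (inv\<^bsub>IG\<^esub> F) ((inv\<^bsub>IG\<^esub> g) y)"
proof -
  let ?gi = "(inv\<^bsub>IG\<^esub> g) y"
  let ?z = "(inv\<^bsub>IG\<^esub> F) ?gi"
  have gi: "?gi \<in> S" by (rule isom_in[OF isom_inv[OF g] y])
  have z: "?z \<in> S" by (rule isom_in[OF isom_inv[OF F] gi])
  have "dl ?z = y" using dl_app[OF z] isom_inv_app(2)[OF F gi] isom_inv_app(2)[OF g y] by simp
  then have "pw (- 1) y = (inv\<^bsub>IG\<^esub> dl) (dl ?z)" using pw_m1[OF y] by simp
  then show ?thesis using isom_inv_app(1)[OF dl z] by simp
qed

lemma prj_Finv:
  assumes y: "y \<in> S"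
  shows "prj b ((inv\<^bsub>IG\<^esub> F) y) = prj b y - w"
proof -
  have "prj b (F ((inv\<^bsub>IG\<^esub> F) y)) = prj b ((inv\<^bsub>IG\<^esub> F) y) + w"
    by (rule prj_isom_line[OF F bl isom_in[OF isom_inv[OF F] y] Fb])
  then show ?thesis using isom_inv_app(2)[OF F y] by simp
qed

lemma prj_pw_m1:
  assumes y: "y \<in> S"
  shows "prj b (pw (- 1) y) = prj b ((inv\<^bsub>IG\<^esub> g) y) - w"
  unfolding pw_m1_app[OF y] by (rule prj_Finv) (rule isom_in[OF isom_inv[OF g] y])

lemma prj_pw_1_line: "\<bar>prj b (pw 1 (b t))\<bar> \<le> B"
  using g_proj[of "t + w"] dl_app[of "b t"] by (simp add: pw_1 Fb)

lemma prj_pw_m1_line: "\<bar>prj b (pw (- 1) (b t)) + w\<bar> \<le> B"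
  using gi_proj[of t] prj_pw_m1[of "b t"] by simp

lemma c_pw: "y \<in> S \<Longrightarrow> c k (pw j y) = c (k - j) y"
  using pw_add[of y "- k" j] by (simp add: c_def)

text \<open>Behrstock's alternative for the neighbours \<open>b\<close> and \<open>dl b\<close>: the
  second projects to the first near \<open>0\<close>, the first to the second near
  \<open>- w\<close>.\<close>

lemma step_alternative_0:
  assumes z: "z \<in> S"
  shows "\<bar>prj b z\<bar> \<le> H \<or> \<bar>prj b (pw (- 1) z) + w\<bar> \<le> H"
proof (rule disjCI)
  assume no: "\<not> \<bar>prj b (pw (- 1) z) + w\<bar> \<le> H"
  show "\<bar>prj b z\<bar> \<le> H"
  proof (rule ccontr)
    assume far: "\<not> \<bar>prj b z\<bar> \<le> H"
    let ?a = "\<lambda>t. pw 1 (b t)"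
    have la: "line ?a" by (rule isom_line[OF pwi bl])
    have "D \<le> \<bar>prj b z - prj b (?a t)\<bar>" for t
      using far prj_pw_1_line[of t] unfolding H_def by linarith
    then obtain t where t: "\<bar>prj ?a z - prj ?a (b t)\<bar> \<le> D" using behrstock[OF la contr z] by blast
    have *: "prj ?a y = prj b (pw (- 1) y)" if y: "y \<in> S" for y
      using prj_isom[OF pwi bl pwS[OF y], of 1 "- 1"] pw_inv[OF y, of 1] by simp
    show False using t no prj_pw_m1_line[of t] *[OF z] *[of "b t"] unfolding H_def by simp
  qed
qed

lemma step_alternative:
  assumes y: "y \<in> S"
  shows "\<bar>c k y\<bar> \<le> H \<or> \<bar>c (k + 1) y + w\<bar> \<le> H"
proof -
  have "- 1 + - k = - (k + 1)" by simp
  then have "pw (- 1) (pw (- k) y) = pw (- (k + 1)) y" using pw_add[OF y, of "- 1" "- k"] by (simp only:)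
  then show ?thesis using step_alternative_0[OF pwS[OF y], of "- k"] by (simp add: c_def)
qed

text \<open>A value below \<open>- H\<close> on one line excludes the first alternative there. The
  next line then sees \<open>y\<close> near \<open>- w\<close>, which is again below
  \<open>- H\<close> because \<open>2 * H < w\<close>.\<close>

lemma behind:
  assumes y: "y \<in> S" and k: "c k y < - H" and j: "k < j"
  shows "\<bar>c j y + w\<bar> \<le> H"
proof -
  have "k + 1 \<le> j" using j by simp
  then show ?thesis
  proof (induction j rule: int_ge_induct)
    case base show ?case using step_alternative[OF y, of k] k by linarith
  next
    case (step i)
    then have "c i y < - H" using H by linarith
    then show ?case using translate_chain.step_alternative[OF translate_chain_axioms y, of i] by linarith
  qed
qed

lemma ahead:
  assumes y: "y \<in> S" and k: "- w + H < c k y" and j: "j < k"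
  shows "\<bar>c j y\<bar> \<le> H"
proof -
  have "j \<le> k - 1" using j by simp
  then show ?thesis
  proof (induction j rule: int_le_induct)
    case base show ?case using step_alternative[OF y, of "k - 1"] k by fastforce
  next
    case (step i)
    then have "- w + H < c i y" using H by linarith
    then show ?case using translate_chain.step_alternative[OF translate_chain_axioms y, of "i - 1"] by fastforce
  qed
qed

lemma c_x0_ahead:
  assumes "j \<le> 0" shows "\<bar>c j x0\<bar> \<le> H"
proof -
  have 0: "\<bar>c 0 x0\<bar> \<le> B" using x0 pw_0 by (simp add: c_def)
  show ?thesis
  proof (cases "j = 0")
    case True then show ?thesis using 0 D by (simp add: H_def)
  next
    case False
    then show ?thesis using ahead[OF x0(1), of 0 j] 0 assms w D unfolding H_def by auto
  qed
qed

lemma c_x0_behind: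
  assumes "1 \<le> j" shows "\<bar>c j x0 + w\<bar> \<le> H"
proof -
  have 1: "\<bar>c 1 x0 + w\<bar> \<le> B" using x0 prj_pw_m1 by (simp add: c_def)
  show ?thesis
  proof (cases "j = 1")
    case True then show ?thesis using 1 D by (simp add: H_def)
  next
    case False
    then show ?thesis using behind[OF x0(1), of 1 j] 1 assms w D B0 unfolding H_def by auto
  qed
qed

lemma near_point:
  assumes y: "y \<in> S" and z: "z \<in> S" and far: "D \<le> \<bar>c k y - c k z\<bar>"
  shows "\<exists>l. 0 \<le> l \<and> l \<le> 1 \<and> d (pt y z l) (pw k (b (c k y))) \<le> D"
proof -
  obtain l where l: "0 \<le> l" "l \<le> 1" "d (pt (pw (- k) y) (pw (- k) z) l) (b (c k y)) \<le> D"
    using contractingD[OF contr pwS[OF y] pwS[OF z]] far unfolding c_def by blast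
  have p: "pt y z l \<in> S" using y z l by auto
  have "d (pt y z l) (pw k (b (c k y))) = d (pw k (pw (- k) (pt y z l))) (pw k (b (c k y)))"
    using pw_inv[OF p] by simp
  also have "\<dots> = d (pw (- k) (pt y z l)) (b (c k y))" by (rule pw_d[OF pwS[OF p]]) simp
  also have "pw (- k) (pt y z l) = pt (pw (- k) y) (pw (- k) z) l" by (rule isom_pt[OF pwi y z l(1,2)])
  finally show ?thesis using l by auto
qed

lemma near_dist:
  assumes y: "y \<in> S" and z: "z \<in> S" and far: "D \<le> \<bar>c k y - c k z\<bar>"
  shows "d y (pw k (b (c k y))) + d (pw k (b (c k y))) z \<le> d y z + 2 * D"
proof -
  let ?q = "pw k (b (c k y))"
  obtain l where l: "0 \<le> l" "l \<le> 1" "d (pt y z l) ?q \<le> D" using near_point[OF assms] by blast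
  have p: "pt y z l \<in> S" and q: "?q \<in> S" using y z l by (auto intro: pwS)
  have "d y ?q \<le> l * d y z + D" using tri[OF y p q] l d_pt_simps(1)[OF y z l(1,2)] by simp
  moreover have "d ?q z \<le> D + (1 - l) * d y z"
    using tri[OF q p z] l d_pt_simps(2)[OF y z l(1,2)] dsym[of ?q "pt y z l"] by simp
  ultimately show ?thesis by (simp add: algebra_simps)
qed

definition e where "e j = d x0 (pw j (b 0))"

lemma e_le:
  assumes "\<bar>t\<bar> \<le> H" "z \<in> S" shows "e j - H \<le> d x0 z + d z (pw j (b t))"
proof -
  have "d (pw j (b t)) (pw j (b 0)) = \<bar>t\<bar>" using pw_d[of "b t" "b 0" j] by (simp add: line_d)
  then show ?thesis
    using tri[of x0 "pw j (b t)" "pw j (b 0)"] tri[of x0 z "pw j (b t)"] x0(1) assms pwS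
    by (simp add: e_def)
qed

text \<open>The geodesic from \<open>pw (j + 1) (b 0)\<close> to \<open>x0\<close> passes near
  \<open>pw j (b 0)\<close>, and these two points are at least \<open>w - B\<close> apart; the lower
  bound on \<open>w\<close> beats the errors by one.\<close>

lemma e_grows:
  assumes j: "1 \<le> j" shows "e j + 1 \<le> e (j + 1)"
proof -
  let ?z = "pw (j + 1) (b 0)"
  have z: "?z \<in> S" by (rule pwS) simp
  have cz: "c j ?z = prj b (pw 1 (b 0))" using c_pw[of "b 0" j "j + 1"] by (simp add: c_def)
  have cb: "\<bar>c j ?z\<bar> \<le> B" unfolding cz by (rule prj_pw_1_line)
  have "\<bar>c j ?z\<bar> \<le> H" using cb D by (simp add: H_def)
  then have "D \<le> \<bar>c j ?z - c j x0\<bar>" using c_x0_behind[OF j] H by linarith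
  then have 1: "d ?z (pw j (b (c j ?z))) + d (pw j (b (c j ?z))) x0 \<le> d ?z x0 + 2 * D"
    by (rule near_dist[OF z x0(1)])
  have q: "pw j (b (c j ?z)) \<in> S" "pw j (b 0) \<in> S" by (auto intro: pwS)
  have 2: "d (pw j (b (c j ?z))) (pw j (b 0)) \<le> B"
    using pw_d[of "b (c j ?z)" "b 0" j] cb by (simp add: line_d)
  have "pw 1 (b 0) \<in> S" "pw (-1) (b 0) \<in> S" by (auto intro: pwS)
  have "d ?z (pw j (b 0)) = d (pw 1 (b 0)) (b 0)"
    using pw_d[of "pw 1 (b 0)" "b 0" j] pw_add[of "b 0" j 1] \<open>pw 1 (b 0) \<in> S\<close> by simp
  also have "\<dots> = d (b 0) (pw (- 1) (b 0))"
    using pw_d[of "b 0" "pw (- 1) (b 0)" 1] pw_inv[of "b 0" 1] \<open>pw (-1) (b 0) \<in> S\<close> by simp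
  also have "\<dots> \<ge> w - B"
    using prj_lip[OF bl, of "b 0" "pw (- 1) (b 0)"] prj_pw_m1_line[of 0] \<open>pw (-1) (b 0) \<in> S\<close> by (simp add: prj_line)
  finally have 3: "w - B \<le> d ?z (pw j (b 0))" .
  have "d ?z (pw j (b 0)) \<le> d ?z (pw j (b (c j ?z))) + d (pw j (b (c j ?z))) (pw j (b 0))"
    "d (pw j (b 0)) x0 \<le> d (pw j (b 0)) (pw j (b (c j ?z))) + d (pw j (b (c j ?z))) x0"
    using z q x0(1) by (auto intro: tri)
  then show ?thesis using 1 2 3 w D B0 by (simp add: e_def dsym)
qed

lemma e_ge: "1 \<le> j \<Longrightarrow> of_int j - 1 \<le> e j"
proof (induction j rule: int_ge_induct)
  case base show ?case by (simp add: e_def)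
next
  case (step i) then show ?case using e_grows[of i] by simp
qed

lemma E0: "0 \<le> E" by (simp add: E_def)

lemma e_neg: "e j - 2 * E \<le> e (- j)"
proof -
  have "e (- j) = d (pw j x0) (b 0)"
    using pw_d[of x0 "pw (- j) (b 0)" j] pw_inv[of "b 0" j] x0(1) pwS[of "b 0" "- j"] by (simp add: e_def)
  moreover have "d x0 (pw j (b 0)) \<le> d x0 (b 0) + (d (b 0) (pw j x0) + d (pw j x0) (pw j (b 0)))"
    using tri[of x0 "b 0" "pw j (b 0)"] tri[of "b 0" "pw j x0" "pw j (b 0)"] x0(1) pwS by simp
  ultimately show ?thesis using pw_d[of x0 "b 0" j] x0(1) by (simp add: e_def E_def dsym)
qed

text \<open>If \<open>y\<close> were not behind the line with index \<open>k - 1\<close>, the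
  geodesic from \<open>y\<close> to \<open>x0\<close> would come close to the line with index
  \<open>k - 2\<close>, which by \<open>e_ge\<close> is too far from \<open>x0\<close>. The other
  direction is symmetric, with \<open>e_neg\<close>.\<close>

lemma transition:
  "\<exists>K\<ge>1. \<forall>y\<in>S. d x0 y \<le> r \<longrightarrow> (\<forall>k\<ge>K. \<bar>c k y + w\<bar> \<le> H \<and> \<bar>c (- k) y\<bar> \<le> H)"
proof -
  define K where "K = \<lceil>\<bar>r\<bar> + 2 * D + H + 2 * E\<rceil> + 5"
  have K: "\<bar>r\<bar> + 2 * D + H + 2 * E + 5 \<le> of_int K" by (simp add: K_def)
  have "0 \<le> \<lceil>\<bar>r\<bar> + 2 * D + H + 2 * E\<rceil>" using D H E0 by simp
  then have K5: "5 \<le> K" by (simp add: K_def)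
  show ?thesis
  proof (intro exI[of _ K] conjI ballI impI allI)
    show "1 \<le> K" using K5 by simp
    fix y k assume y: "y \<in> S" and r: "d x0 y \<le> r" and k: "K \<le> k"
    have "real_of_int K \<le> of_int k" using k by simp
    then have kr: "\<bar>r\<bar> + 2 * D + H + 2 * E + 5 \<le> of_int k" using K by linarith
    have k5: "5 \<le> k" using k K5 by simp
    have "c (k - 1) y < - H"
    proof (rule ccontr)
      assume "\<not> c (k - 1) y < - H"
      then have "- w + H < c (k - 1) y" using H by linarith
      then have a: "\<bar>c (k - 2) y\<bar> \<le> H" using ahead[OF y, of "k - 1" "k - 2"] by simp
      have "\<bar>c (k - 2) x0 + w\<bar> \<le> H" using k5 by (intro c_x0_behind) simp
      then have "D \<le> \<bar>c (k - 2) y - c (k - 2) x0\<bar>" using a H by linarith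
      from near_dist[OF y x0(1) this]
      have "d (pw (k - 2) (b (c (k - 2) y))) x0 \<le> r + 2 * D"
        using r mdist_nonneg[of M y "pw (k - 2) (b (c (k - 2) y))"] dsym[of y x0] by linarith
      then have "e (k - 2) - H \<le> r + 2 * D" using e_le[OF a x0(1), of "k - 2"] x0(1) by (simp add: dsym)
      then show False using e_ge[of "k - 2"] k5 kr E0 by simp
    qed
    then show "\<bar>c k y + w\<bar> \<le> H" using behind[OF y, of "k - 1" k] by simp
    have "- H \<le> c (- k + 1) y"
    proof (rule ccontr)
      assume "\<not> - H \<le> c (- k + 1) y"
      then have a: "\<bar>c (- k + 2) y + w\<bar> \<le> H" using behind[OF y, of "- k + 1" "- k + 2"] by simp
      have x: "\<bar>c (- k + 2) x0\<bar> \<le> H" using k5 by (intro c_x0_ahead) simp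
      then have "D \<le> \<bar>c (- k + 2) x0 - c (- k + 2) y\<bar>" using a H by linarith
      from near_dist[OF x0(1) y this]
      have "d x0 (pw (- k + 2) (b (c (- k + 2) x0))) \<le> r + 2 * D"
        using r mdist_nonneg[of M "pw (- k + 2) (b (c (- k + 2) x0))" y] by linarith
      then have "e (- k + 2) - H \<le> r + 2 * D" using e_le[OF x x0(1), of "- k + 2"] x0(1) by simp
      then show False using e_neg[of "k - 2"] e_ge[of "k - 2"] k5 kr by simp
    qed
    then show "\<bar>c (- k) y\<bar> \<le> H" using ahead[OF y, of "- k + 1" "- k"] H by simp
  qed
qed

text \<open>Discrete intermediate value argument between \<open>c (- K) y\<close>, near
  \<open>0\<close>, and \<open>c K y\<close>, near \<open>- w\<close>. Applying
  \<open>pw (- k)\<close> then moves the crossing to index \<open>0\<close>.\<close>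

lemma normalize:
  assumes y: "y \<in> S" shows "\<exists>k. - H \<le> c k y \<and> c (k + 1) y < - H"
proof (rule ccontr)
  assume no: "\<not> ?thesis"
  obtain K where K: "1 \<le> K" "\<And>k. K \<le> k \<Longrightarrow> \<bar>c k y + w\<bar> \<le> H \<and> \<bar>c (- k) y\<bar> \<le> H"
    using transition[of "d x0 y"] y by blast
  have 0: "- H \<le> c (- K) y" using K(2)[of K] by linarith
  have "- K \<le> K" using K by simp
  then have "- H \<le> c K y"
  proof (induction K rule: int_ge_induct)
    case base show ?case by (rule 0)
  next
    case (step i) then show ?case using no by force
  qed
  then show False using K(2)[of K] H by linarith
qed

text \<open>\<open>y\<close> is behind the line with index \<open>2\<close> and
  \<open>pw 3 y\<close> is ahead of it, so the segment between them, of length at most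
  \<open>3 * r\<close>, comes close to a fixed part of that line.\<close>

lemma normalized_bounded:
  assumes y: "y \<in> S" and n: "- H \<le> c 0 y" "c 1 y < - H" and disp: "d y (dl y) \<le> r"
  shows "d x0 y \<le> d x0 (pw 2 (b (- w))) + H + 3 * r + 2 * D"
proof -
  have dS: "pw k y \<in> S" for k by (rule pwS[OF y])
  have s1: "d (pw k y) (pw (k + 1) y) = d y (dl y)" for k
    using pw_d[OF y dS[of 1], of k] pw_add[OF y, of k 1] by (simp add: pw_1)
  have "d y (pw 3 y) \<le> d (pw 0 y) (pw 1 y) + (d (pw 1 y) (pw 2 y) + d (pw 2 y) (pw 3 y))"
    using tri[OF y dS[of 1] dS[of 3]] tri[OF dS[of 1] dS[of 2] dS[of 3]] pw_0[OF y] by simp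
  also have "\<dots> \<le> 3 * r" using s1[of 0] s1[of 1] s1[of 2] disp by simp
  finally have 3: "d y (pw 3 y) \<le> 3 * r" .
  have a: "\<bar>c (- 1) y\<bar> \<le> H" using ahead[OF y, of 0 "- 1"] n H by simp
  have 2: "\<bar>c 2 y + w\<bar> \<le> H" using behind[OF y n(2), of 2] by simp
  have c3: "c 2 (pw 3 y) = c (- 1) y" using c_pw[OF y, of 2 3] by simp
  have "D \<le> \<bar>c 2 y - c 2 (pw 3 y)\<bar>" unfolding c3 using a 2 H by linarith
  from near_dist[OF y dS this] have q: "d y (pw 2 (b (c 2 y))) \<le> 3 * r + 2 * D"
    using 3 mdist_nonneg[of M "pw 2 (b (c 2 y))" "pw 3 y"] by linarith
  have "d (pw 2 (b (c 2 y))) (pw 2 (b (- w))) \<le> H" using pw_d[of "b (c 2 y)" "b (- w)" 2] 2 by (simp add: line_d)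
  then show ?thesis
    using q tri[of x0 "pw 2 (b (- w))" y] tri[of "pw 2 (b (- w))" "pw 2 (b (c 2 y))" y] x0(1) y pwS
    by (simp add: dsym)
qed

text \<open>Powers of \<open>dl\<close> commute with \<open>dl\<close>, so a minimizing sequence may
  be normalized and is then bounded. The minimum is positive because a fixed point has the same foot
  parameter on all lines, against \<open>transition\<close>.\<close>

lemma min_displacement_attained: "\<exists>y\<in>S. 0 < d y (dl y) \<and> (\<forall>z\<in>S. d y (dl y) \<le> d z (dl z))"
proof -
  have dlS: "z \<in> S \<Longrightarrow> dl z \<in> S" for z using isom_in[OF dl] .
  define I where "I = (INF z\<in>S. d z (dl z))"
  have bd: "bdd_below ((\<lambda>z. d z (dl z)) ` S)" by (rule bdd_belowI[of _ 0]) auto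
  have ne: "S \<noteq> {}" using x0 by auto
  have I: "I \<le> d z (dl z)" if "z \<in> S" for z unfolding I_def by (rule cINF_lower[OF bd that])
  have "\<exists>y\<in>S. - H \<le> c 0 y \<and> c 1 y < - H \<and> d y (dl y) < I + inverse (real (Suc n))" for n
  proof -
    have "\<exists>z\<in>S. d z (dl z) < I + inverse (real (Suc n))"
      using cINF_less_iff[OF ne bd, of "I + inverse (real (Suc n))"] by (simp add: I_def)
    then obtain z where z: "z \<in> S" "d z (dl z) < I + inverse (real (Suc n))" by blast
    obtain k where k: "- H \<le> c k z" "c (k + 1) z < - H" using normalize[OF z(1)] by blast
    have "dl (pw (- k) z) = pw (- k) (dl z)"
      using pw_add[OF z(1), of 1 "- k"] pw_add[OF z(1), of "- k" 1] by (simp add: pw_1 add.commute)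
    then have "d (pw (- k) z) (dl (pw (- k) z)) = d z (dl z)" using pw_d[OF z(1) dlS[OF z(1)]] by simp
    then show ?thesis using z k c_pw[OF z(1), of 0 "- k"] c_pw[OF z(1), of 1 "- k"] pwS[OF z(1)]
      by (intro bexI[of _ "pw (- k) z"]) (auto simp: add.commute)
  qed
  then obtain y where y: "\<And>n. y n \<in> S" and n: "\<And>n. - H \<le> c 0 (y n)" "\<And>n. c 1 (y n) < - H"
    and lt: "\<And>n. d (y n) (dl (y n)) < I + inverse (real (Suc n))" by metis
  have le: "d (y n) (dl (y n)) \<le> I + 1" for n
  proof -
    have "inverse (real (Suc n)) \<le> 1" by (simp add: inverse_le_1_iff)
    then show ?thesis using lt[of n] by linarith
  qed
  have "\<exists>z. uconv y z"
    by (rule uconv_bounded[OF x0(1), of y "d x0 (pw 2 (b (- w))) + H + 3 * (I + 1) + 2 * D"])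
      (use y normalized_bounded[OF y n le] in simp)
  then obtain z where z: "uconv y z" by blast
  have zS: "z \<in> S" using z by (rule uconv_in)
  have dz: "uconv (\<lambda>n. dl (y n)) (dl z)"
    using z y dlS isom_d[OF dl y zS] by (simp add: uconv_def)
  have "d z (dl z) \<le> I"
  proof (rule uconv_le[OF z dz])
    have "((\<lambda>n. I + inverse (real (Suc n))) \<longlongrightarrow> I + 0) ufil"
      by (intro tendsto_add tendsto_const tendsto_ufil[OF LIMSEQ_inverse_real_of_nat])
    then show "((\<lambda>n. I + inverse (real (Suc n))) \<longlongrightarrow> I) ufil" by simp
    show "eventually (\<lambda>n. d (y n) (dl (y n)) \<le> I + inverse (real (Suc n))) ufil"
      using lt less_imp_le by (intro always_eventually) blast
  qed
  then have min: "d z (dl z) \<le> d v (dl v)" if "v \<in> S" for v using I[OF that] by linarith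
  have "d z (dl z) \<noteq> 0"
  proof
    assume "d z (dl z) = 0"
    then have fxd: "dl z = z" using zS dlS by simp
    have pz: "pw (int m) z = z" for m
    proof (induction m)
      case 0 then show ?case using pw_0[OF zS] by simp
    next
      case (Suc m)
      then show ?case using pw_add[OF zS, of 1 "int m"] fxd by (simp add: pw_1)
    qed
    obtain K where K: "1 \<le> K" "\<bar>c K z + w\<bar> \<le> H \<and> \<bar>c (- K) z\<bar> \<le> H"
      using transition[of "d x0 z"] zS by blast
    have K1: "pw K z = z" using pz[of "nat K"] K by simp
    then have "pw (- K) z = z" using pw_add[OF zS, of "- K" K] pw_0[OF zS] by simp
    then have "c K z = c (- K) z" using K1 by (simp add: c_def)
    then show False using K H by linarith
  qed
  then have "0 < d z (dl z)" using mdist_nonneg[of M z "dl z"] by linarith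
  then show ?thesis using zS min by blast
qed

lemma chain_rank_one:
  shows "rank_one M dl"
    and "d x0 (dl x0) - 2 * (D + H + E) \<le> translation_length M dl"
    and "translation_length M dl \<le> d x0 (dl x0)"
proof -
  define C where "C = D + H + E"
  obtain y where y: "y \<in> S" "0 < d y (dl y)" and min: "\<And>z. z \<in> S \<Longrightarrow> d y (dl y) \<le> d z (dl z)"
    using min_displacement_attained by blast
  define l where "l = d y (dl y)"
  obtain s where s: "axis dl s l" using min_displacement_axis[OF dl y(1) min y(2)] by (auto simp: l_def)
  have sl: "line s" and l: "0 < l" using s by (auto simp: is_axis_def)
  have tl: "translation_length M dl = l" by (rule translation_length_eq[OF dl s])
  show "translation_length M dl \<le> d x0 (dl x0)" unfolding tl l_def by (rule min[OF x0(1)])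
  have ps: "pw k (s t) = s (t + of_int k * l)" for k t by (rule axis_pow[OF dl s])
  have bx: "d (b t) x0 \<le> H + E" if "\<bar>t\<bar> \<le> H" for t
    using tri[of "b t" "b 0" x0] that x0(1) by (simp add: line_d E_def dsym)
  \<comment> \<open>A geodesic from a point seen near \<open>0\<close> to one seen near
    \<open>- w\<close> is forced past \<open>x0\<close> by the contraction of
    \<open>b\<close>.\<close>
  have pass: "\<exists>t. 0 \<le> t \<and> t \<le> 1 \<and> d (pt u v t) x0 \<le> C"
    if uv: "u \<in> S" "v \<in> S" and c0: "\<bar>c 0 u\<bar> \<le> H" "\<bar>c 0 v + w\<bar> \<le> H" for u v
  proof -
    have "D \<le> \<bar>c 0 u - c 0 v\<bar>" using c0 H by linarith
    then obtain t where t: "0 \<le> t" "t \<le> 1" "d (pt u v t) (pw 0 (b (c 0 u))) \<le> D" using near_point[OF uv] by blast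
    have "pt u v t \<in> S" using uv t by auto
    then have "d (pt u v t) x0 \<le> C"
      using tri[of "pt u v t" "b (c 0 u)" x0] t bx[OF c0(1)] x0(1) pw_0[of "b (c 0 u)"] by (simp add: C_def)
    then show ?thesis using t by blast
  qed
  \<comment> \<open>Applied to distant iterates on the axis, \<open>pass\<close> brings the axis
    within \<open>C\<close> of \<open>x0\<close>; hence \<open>x0\<close> is moved by at most
    \<open>2 * C\<close> more than the minimum.\<close>
  obtain v where v: "d (s v) x0 \<le> C"
  proof -
    obtain K where K: "\<bar>c K (s 0) + w\<bar> \<le> H" "\<bar>c (- K) (s 0)\<bar> \<le> H"
      using transition[of "d x0 (s 0)"] line_in[OF sl, of 0] by blast
    have "\<bar>c 0 (pw K (s 0))\<bar> \<le> H" "\<bar>c 0 (pw (- K) (s 0)) + w\<bar> \<le> H"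
      using K c_pw[of "s 0" 0 K] c_pw[of "s 0" 0 "- K"] sl by simp_all
    then obtain t where "0 \<le> t" "t \<le> 1" "d (pt (pw K (s 0)) (pw (- K) (s 0)) t) x0 \<le> C"
      using pass[of "pw K (s 0)" "pw (- K) (s 0)"] sl pwS by auto
    then show ?thesis using that sl unfolding ps by (auto simp: line_pt)
  qed
  have "d x0 (dl x0) \<le> d x0 (s v) + (d (s v) (s (v + l)) + d (s (v + l)) (dl x0))"
    using tri[of x0 "s v" "dl x0"] tri[of "s v" "s (v + l)" "dl x0"] sl x0(1) isom_in[OF dl x0(1)] by simp
  also have "d (s (v + l)) (dl x0) = d (s v) x0"
    using isom_d[OF dl _ x0(1), of "s v"] sl s by (simp add: is_axis_def)
  finally show "d x0 (dl x0) - 2 * (D + H + E) \<le> translation_length M dl"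
    using v sl l unfolding tl by (simp add: line_d dsym C_def)
  have "\<not> bounds_flat_half_plane M s"
  proof
    assume "bounds_flat_half_plane M s"
    then obtain f :: "real \<times> real \<Rightarrow> 'a" where fD: "\<And>p q. p \<in> {0..} \<times> UNIV \<Longrightarrow> q \<in> {0..} \<times> UNIV \<Longrightarrow> d (f p) (f q) = dist p q"
      and f0: "f ` ({0} \<times> UNIV) = range s" and fF: "geodesically_convex M (f ` ({0..} \<times> UNIV))"
      and cl: "closedin (mtopology_of M) (f ` ({0..} \<times> UNIV))"
      unfolding bounds_flat_half_plane_def by blast
    have fS: "f p \<in> S" if "p \<in> {0..} \<times> UNIV" for p
      using closedin_subset[OF cl] that by (auto simp: topspace_mtopology_of)
    \<comment> \<open>Points of the half plane at height \<open>h\<close> above distant iterates are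
      joined at constant height \<open>h\<close>. By \<open>pass\<close> the joining geodesic also
      comes within \<open>C\<close> of \<open>x0\<close>, hence within \<open>2 * C\<close> of the
      axis.\<close>
    define h where "h = 2 * C + 1"
    have C0: "0 \<le> C" using D H E0 by (simp add: C_def)
    have "\<exists>t. s u = f (0, t)" for u
    proof -
      have "s u \<in> f ` ({0} \<times> UNIV)" unfolding f0 by simp
      then show ?thesis by auto
    qed
    then obtain th where th: "\<And>u. s u = f (0, th u)" by metis
    define z where "z k = f (h, th (of_int k * l))" for k :: int
    have h: "0 \<le> h" using C0 by (simp add: h_def)
    have zS: "z k \<in> S" for k unfolding z_def using h by (intro fS) auto
    have zd: "d (z k) (pw k (s 0)) = h" for k
    proof -
      have "pw k (s 0) = f (0, th (of_int k * l))" unfolding ps th[symmetric] by simp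
      then show ?thesis
        using fD[of "(h, th (of_int k * l))" "(0, th (of_int k * l))"] h
        by (simp add: z_def dist_prod_def dist_real_def)
    qed
    have wd: "d x0 (pw (- k) (z k)) \<le> d x0 (s 0) + h" for k
    proof -
      have "d (pw (- k) (z k)) (s 0) = d (z k) (pw k (s 0))"
        using pw_d[OF zS pwS, of "s 0" "- k" k k] pw_inv[of "s 0" "- k"] sl by simp
      then show ?thesis using tri[of x0 "s 0" "pw (- k) (z k)"] x0(1) sl pwS[OF zS] zd[of k] by (simp add: dsym)
    qed
    obtain K where K: "\<And>y. y \<in> S \<Longrightarrow> d x0 y \<le> d x0 (s 0) + h \<Longrightarrow> \<bar>c K y + w\<bar> \<le> H \<and> \<bar>c (- K) y\<bar> \<le> H"
      using transition[of "d x0 (s 0) + h"] by blast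
    have "c 0 (z k) = c (- k) (pw (- k) (z k))" for k using c_pw[OF zS, of "- k" "- k" k] by simp
    then have "\<bar>c 0 (z K)\<bar> \<le> H" "\<bar>c 0 (z (- K)) + w\<bar> \<le> H"
      using K[OF pwS[OF zS] wd, of K] K[OF pwS[OF zS] wd, of "- K"] by simp_all
    then obtain t where t: "0 \<le> t" "t \<le> 1" "d (pt (z K) (z (- K)) t) x0 \<le> C"
      using pass[OF zS zS] by blast
    define p q where "p = th (of_int K * l)" and "q = th (of_int (- K) * l)"
    define m where "m = (1 - t) * p + t * q"
    have zK: "z K = f (h, p)" "z (- K) = f (h, q)" by (simp_all add: z_def p_def q_def)
    have pm: "p - m = t * (p - q)" "m - q = (1 - t) * (p - q)" by (simp_all add: m_def algebra_simps)
    have "f (h, m) = pt (z K) (z (- K)) t"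
    proof (rule pt_unique[OF zS zS t(1,2)])
      show "f (h, m) \<in> S" using h by (intro fS) auto
      show "d (z K) (f (h, m)) = t * d (z K) (z (- K))" "d (f (h, m)) (z (- K)) = (1 - t) * d (z K) (z (- K))"
        unfolding zK using h t by (simp_all add: fD dist_prod_def dist_real_def pm abs_mult)
    qed
    then have 1: "d (f (h, m)) x0 \<le> C" using t by simp
    have "h \<le> d (f (h, m)) (s v)"
      unfolding th using h fD[of "(h, m)" "(0, th v)"] real_sqrt_sum_squares_ge1[of h "m - th v"]
      by (simp add: dist_prod_def dist_real_def)
    moreover have "f (h, m) \<in> S" using h by (intro fS) auto
    then have "d (f (h, m)) (s v) \<le> d (f (h, m)) x0 + d x0 (s v)" using sl x0(1) by (intro tri) auto
    ultimately show False using 1 v by (simp add: h_def dsym)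
  qed
  then show "rank_one M dl" using s dl by (auto simp: rank_one_def axial_def)
qed

end

section \<open>Locally compact Hadamard spaces and their products\<close>

lemma norm_vector2: "(norm (x :: real^2))\<^sup>2 = (x $ 1)\<^sup>2 + (x $ 2)\<^sup>2"
  by (simp add: norm_vec_def L2_set_def sum_2)

lemma comparison_triangle:
  fixes a b c :: real
  assumes "0 \<le> a" "0 \<le> b" "0 \<le> c" "a \<le> b + c" "b \<le> a + c" "c \<le> a + b"
  shows "\<exists>(p::real^2) q r. dist p q = a \<and> dist p r = b \<and> dist q r = c"
proof (cases "a = 0")
  case True
  then have "b = c" using assms by simp
  let ?r = "vector [b, 0] :: real^2"
  have "(norm ?r)\<^sup>2 = b\<^sup>2" by (simp add: norm_vector2)
  then have "norm ?r = b" using assms by (simp add: power2_eq_iff_nonneg)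
  then show ?thesis using True \<open>b = c\<close>
    by (intro exI[of _ 0] exI[of _ ?r]) (simp add: dist_norm)
next
  case False
  then have a: "0 < a" using assms by simp
  \<comment> \<open>First coordinate of the third vertex by the law of cosines; the triangle
    inequalities give \<open>u^2 \<le> b^2\<close>.\<close>
  define u where "u = (a\<^sup>2 + b\<^sup>2 - c\<^sup>2) / (2 * a)"
  have u: "2 * a * u = a\<^sup>2 + b\<^sup>2 - c\<^sup>2" using a by (simp add: u_def)
  have "u\<^sup>2 \<le> b\<^sup>2"
  proof -
    have "\<bar>a - c\<bar> \<le> b" using assms by linarith
    then have "(a - c)\<^sup>2 \<le> b\<^sup>2" using assms by (metis abs_le_square_iff abs_of_nonneg)
    then have 1: "- (2 * a * b) \<le> 2 * a * u \<longleftrightarrow> c\<^sup>2 \<le> (a + b)\<^sup>2" unfolding u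
      by (simp add: power2_eq_square algebra_simps)
    have "c\<^sup>2 \<le> (a + b)\<^sup>2" using assms by (intro power_mono) auto
    then have "- (2 * a * b) \<le> 2 * a * u" using 1 by simp
    then have "a * (- b) \<le> a * u" by simp
    then have lo: "- b \<le> u" using a by (simp only: mult_le_cancel_left_pos)
    have "\<bar>a - b\<bar> \<le> c" using assms by linarith
    then have "(a - b)\<^sup>2 \<le> c\<^sup>2" using assms by (metis abs_le_square_iff abs_of_nonneg)
    then have "2 * a * u \<le> 2 * a * b" unfolding u by (simp add: power2_eq_square algebra_simps)
    then have "u \<le> b" using a by simp
    then have "\<bar>u\<bar> \<le> \<bar>b\<bar>" using lo by linarith
    then show ?thesis by (simp add: abs_le_square_iff)
  qed
  define v where "v = sqrt (b\<^sup>2 - u\<^sup>2)"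
  have v: "v\<^sup>2 = b\<^sup>2 - u\<^sup>2" using \<open>u\<^sup>2 \<le> b\<^sup>2\<close> by (simp add: v_def)
  let ?q = "vector [a, 0] :: real^2" and ?r = "vector [u, v] :: real^2"
  have "(norm ?q)\<^sup>2 = a\<^sup>2" by (simp add: norm_vector2)
  moreover have "(norm ?r)\<^sup>2 = b\<^sup>2" by (simp add: norm_vector2 v)
  moreover have "(norm (?q - ?r))\<^sup>2 = c\<^sup>2"
    using u by (simp add: norm_vector2 v power2_diff)
  ultimately have "norm ?q = a" "norm ?r = b" "norm (?q - ?r) = c"
    using assms by (simp_all add: power2_eq_iff_nonneg)
  then show ?thesis by (intro exI[of _ 0] exI[of _ ?q] exI[of _ ?r]) (simp add: dist_norm)
qed

lemma stewart:
  fixes p q r :: "real^2"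
  shows "(dist (p + l *\<^sub>R (q - p)) r)\<^sup>2 = (1 - l) * (dist p r)\<^sup>2 + l * (dist q r)\<^sup>2 - l * (1 - l) * (dist p q)\<^sup>2"
proof -
  define a b where "a = p - r" and "b = q - r"
  have "p + l *\<^sub>R (q - p) - r = (1 - l) *\<^sub>R a + l *\<^sub>R b" "p - q = a - b"
    by (simp_all add: a_def b_def algebra_simps)
  then show ?thesis
    by (simp add: dist_norm a_def[symmetric] b_def[symmetric] power2_norm_eq_inner inner_simps inner_commute[of b a])
      (simp add: algebra_simps power2_eq_square)
qed

text \<open>The point \<open>w\<close> enters as the end of the side from \<open>x\<close> to
  \<open>w\<close>, so the comparison distance is that from a point of one side to the opposite
  vertex, computed by \<open>stewart\<close>.\<close>

lemma CAT0_CN: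
  assumes M: "CAT0 M" and x: "x \<in> mspace M" and y: "y \<in> mspace M" and l: "0 \<le> l" "l \<le> 1"
  shows "\<exists>z\<in>mspace M. \<forall>w\<in>mspace M. (mdist M z w)\<^sup>2 \<le>
        (1 - l) * (mdist M x w)\<^sup>2 + l * (mdist M y w)\<^sup>2 - l * (1 - l) * (mdist M x y)\<^sup>2"
proof -
  let ?d = "mdist M"
  have geo: "\<exists>c. geodesic_segment M u v c" if "u \<in> mspace M" "v \<in> mspace M" for u v
    using M that by (auto simp: CAT0_def geodesic_space_def)
  have cat: "?d (c s) (c' t) \<le> dist x' y'"
    if "p \<in> mspace M" "q \<in> mspace M" "r \<in> mspace M" "geodesic_segment M p q c" "geodesic_segment M p r c'"
      "dist p' q' = ?d p q" "dist p' r' = ?d p r" "dist q' r' = ?d q r"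
      "s \<in> {0..?d p q}" "t \<in> {0..?d p r}" "x' \<in> closed_segment p' q'" "y' \<in> closed_segment p' r'"
      "dist p' x' = s" "dist p' y' = t" for p q r c c' s t and p' q' r' x' y' :: "real^2"
    using M that unfolding CAT0_def by blast
  obtain c where c: "geodesic_segment M x y c" using geo x y by blast
  define s where "s = l * ?d x y"
  have s: "s \<in> {0..?d x y}" using l by (simp add: s_def mult_left_le_one_le)
  show ?thesis
  proof (intro bexI[of _ "c s"] ballI)
    show "c s \<in> mspace M" using c s by (auto simp: geodesic_segment_def)
    fix w assume w: "w \<in> mspace M"
    obtain c' where c': "geodesic_segment M x w c'" using geo x w by blast
    obtain p q r :: "real^2" where t: "dist p q = ?d x y" "dist p r = ?d x w" "dist q r = ?d y w"
      using comparison_triangle[of "?d x y" "?d x w" "?d y w"] mdist_triangle[OF x w y] mdist_triangle[OF x y w]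
        mdist_triangle[OF y x w] by (auto simp: mdist_commute)
    have cw: "c' (?d x w) = w" using c' by (simp add: geodesic_segment_def)
    have x': "p + l *\<^sub>R (q - p) \<in> closed_segment p q"
      using l by (auto simp: in_segment algebra_simps intro!: exI[of _ l])
    have "dist p (p + l *\<^sub>R (q - p)) = s" using l t(1) by (simp add: dist_norm s_def norm_minus_commute)
    then have "?d (c s) (c' (?d x w)) \<le> dist (p + l *\<^sub>R (q - p)) r"
      using t s by (intro cat[OF x y w c c' _ _ _ _ _ x']) auto
    then have "(?d (c s) w)\<^sup>2 \<le> (dist (p + l *\<^sub>R (q - p)) r)\<^sup>2" unfolding cw by (intro power_mono) auto
    then show "(?d (c s) w)\<^sup>2 \<le> (1 - l) * (?d x w)\<^sup>2 + l * (?d y w)\<^sup>2 - l * (1 - l) * (?d x y)\<^sup>2"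
      unfolding stewart t .
  qed
qed

section \<open>Properness of complete locally compact geodesic spaces\<close>

lemma eventually_inverse_Suc_less:
  assumes "(0::real) < e" shows "eventually (\<lambda>k. inverse (real (Suc k)) < e) sequentially"
  using LIMSEQ_inverse_real_of_nat assms by (rule order_tendstoD(2))

text \<open>Hopf--Rinow. The supremum of the radii for which bounded sequences converge along the
  ultrafilter is attained by completeness and can be increased by local compactness.\<close>

lemma proper_bounded_limit:
  fixes M :: "'a metric"
  assumes comp: "mcomplete_of M" and lc: "locally_compact_space (mtopology_of M)" and geo: "geodesic_space M"
    and x: "range x \<subseteq> mspace M" and p: "p \<in> mspace M" and r: "\<And>n. mdist M p (x n) \<le> r"
  shows "\<exists>z\<in>mspace M. ((\<lambda>n. mdist M (x n) z) \<longlongrightarrow> 0) ufil"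
proof -
  interpret Metric_space "mspace M" "mdist M" by simp
  let ?S = "mspace M" and ?d = "mdist M"
  define lim where "lim x z \<longleftrightarrow> (\<forall>e>0. eventually (\<lambda>n. ?d (x n) z < e) ufil)" for x z
  define good where "good \<rho> \<longleftrightarrow> (\<forall>x. (\<forall>n. x n \<in> ?S \<and> ?d p (x n) \<le> \<rho>) \<longrightarrow> (\<exists>z\<in>?S. lim x z))" for \<rho>
  have good_mono: "good \<rho>'" if "good \<rho>" "\<rho>' \<le> \<rho>" for \<rho> \<rho>'
    using that unfolding good_def by (meson order_trans)
  \<comment> \<open>Geodesics pull a point of a larger ball into a slightly smaller one at
    controlled cost.\<close>
  have shrink: "\<exists>y\<in>?S. ?d p y \<le> max 0 (\<rho> - e) \<and> ?d y x \<le> e + (\<rho>' - \<rho>)"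
    if x: "x \<in> ?S" "?d p x \<le> \<rho>'" and e: "0 \<le> e" "\<rho> \<le> \<rho>'" "0 \<le> \<rho>" for x \<rho> \<rho>' e
  proof (cases "?d p x \<le> max 0 (\<rho> - e)")
    case True then show ?thesis using x e by (intro bexI[of _ x]) auto
  next
    case False
    obtain c where c: "geodesic_segment M p x c" using geo p x by (auto simp: geodesic_space_def)
    define t where "t = max 0 (\<rho> - e)"
    have t: "t \<in> {0..?d p x}" "?d p x \<in> {0..?d p x}" "0 \<in> {0..?d p x}" using False by (auto simp: t_def)
    have D: "?d (c u) (c v) = \<bar>u - v\<bar>" if "u \<in> {0..?d p x}" "v \<in> {0..?d p x}" for u v
      using c that unfolding geodesic_segment_def by blast
    have "?d (c 0) (c t) = t" "?d (c t) (c (?d p x)) = ?d p x - t"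
      using D[OF t(3,1)] D[OF t(1,2)] t(1) by simp_all
    then have "?d p (c t) = t" "?d (c t) x = ?d p x - t" using c by (simp_all add: geodesic_segment_def)
    moreover have "c t \<in> ?S" using c t by (auto simp: geodesic_segment_def)
    ultimately show ?thesis using x e by (intro bexI[of _ "c t"]) (auto simp: t_def)
  qed
  have good0: "good 0"
    unfolding good_def
  proof (intro allI impI bexI[of _ p])
    fix x :: "nat \<Rightarrow> 'a" assume x: "\<forall>n. x n \<in> ?S \<and> ?d p (x n) \<le> 0"
    have "x n = p" for n
    proof -
      have "?d p (x n) = 0" using x mdist_nonneg[of M p "x n"] by (intro order_antisym) auto
      then show ?thesis using x p by simp
    qed
    then show "lim x p" using p by (simp add: lim_def)
  qed (use p in auto)
  \<comment> \<open>Completeness: the approximating sequences in smaller balls have limits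
    \<open>z k\<close>, which form a Cauchy sequence.\<close>
  have approx: "good \<rho>" if \<rho>: "0 \<le> \<rho>" and lt: "\<And>e. 0 < e \<Longrightarrow> good (max 0 (\<rho> - e))" for \<rho>
    unfolding good_def
  proof (intro allI impI)
    fix x :: "nat \<Rightarrow> 'a" assume x: "\<forall>n. x n \<in> ?S \<and> ?d p (x n) \<le> \<rho>"
    define \<epsilon> where "\<epsilon> k = inverse (real (Suc k))" for k
    have \<epsilon>: "0 < \<epsilon> k" for k by (simp add: \<epsilon>_def)
    have "\<exists>y\<in>?S. ?d p y \<le> max 0 (\<rho> - \<epsilon> k) \<and> ?d y (x n) \<le> \<epsilon> k" for k n
      using shrink[of "x n" \<rho> "\<epsilon> k" \<rho>] x \<rho> \<epsilon>[of k] by simp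
    then obtain y where y: "\<And>k n. y k n \<in> ?S" "\<And>k n. ?d p (y k n) \<le> max 0 (\<rho> - \<epsilon> k)" "\<And>k n. ?d (y k n) (x n) \<le> \<epsilon> k"
      by metis
    have "\<exists>z\<in>?S. lim (y k) z" for k using lt[OF \<epsilon>[of k]] y unfolding good_def by blast
    then obtain z where z: "\<And>k. z k \<in> ?S" "\<And>k. lim (y k) (z k)" by metis
    have zx: "eventually (\<lambda>n. ?d (x n) (z k) < 2 * \<epsilon> k) ufil" for k
    proof -
      have "eventually (\<lambda>n. ?d (y k n) (z k) < \<epsilon> k) ufil" using z(2) \<epsilon> by (simp add: lim_def)
      then show ?thesis
      proof (rule eventually_mono)
        fix n assume "?d (y k n) (z k) < \<epsilon> k"
        moreover have "?d (x n) (z k) \<le> ?d (x n) (y k n) + ?d (y k n) (z k)" using x y z by (intro triangle) auto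
        ultimately show "?d (x n) (z k) < 2 * \<epsilon> k" using y(3)[of k n] by (simp add: mdist_commute)
      qed
    qed
    have zz: "?d (z k) (z m) \<le> 2 * \<epsilon> k + 2 * \<epsilon> m" for k m
    proof -
      have "eventually (\<lambda>n. ?d (x n) (z k) < 2 * \<epsilon> k \<and> ?d (x n) (z m) < 2 * \<epsilon> m) ufil"
        using zx zx by (rule eventually_conj)
      then obtain n where "?d (x n) (z k) < 2 * \<epsilon> k" "?d (x n) (z m) < 2 * \<epsilon> m"
        using eventually_happens'[OF ufil(2)] by blast
      moreover have "?d (z k) (z m) \<le> ?d (z k) (x n) + ?d (x n) (z m)" using x z by (intro triangle) auto
      ultimately show ?thesis by (simp add: mdist_commute)
    qed
    have "MCauchy z"
      unfolding MCauchy_def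
    proof (intro conjI allI impI)
      show "range z \<subseteq> ?S" using z by auto
      fix e :: real assume "0 < e"
      then obtain N where N: "\<And>k. N \<le> k \<Longrightarrow> \<epsilon> k < e / 4"
        using eventually_inverse_Suc_less[of "e/4"] unfolding eventually_sequentially \<epsilon>_def by auto
      show "\<exists>N. \<forall>n n'. N \<le> n \<longrightarrow> N \<le> n' \<longrightarrow> ?d (z n) (z n') < e"
      proof (intro exI[of _ N] allI impI)
        fix n n' assume "N \<le> n" "N \<le> n'"
        then show "?d (z n) (z n') < e" using zz[of n n'] N[of n] N[of n'] by linarith
      qed
    qed
    then obtain v where v: "limitin mtopology z v sequentially"
      using comp by (auto simp: mcomplete_of_def mcomplete_def)
    then have vS: "v \<in> ?S" and vl: "\<And>e. 0 < e \<Longrightarrow> eventually (\<lambda>k. z k \<in> ?S \<and> ?d (z k) v < e) sequentially"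
      unfolding limitin_metric by blast+
    have "lim x v"
      unfolding lim_def
    proof (intro allI impI)
      fix e :: real assume e: "0 < e"
      have "eventually (\<lambda>k. (z k \<in> ?S \<and> ?d (z k) v < e / 2) \<and> \<epsilon> k < e / 4) sequentially"
        unfolding \<epsilon>_def by (rule eventually_conj[OF vl eventually_inverse_Suc_less]) (use e in auto)
      then obtain k where k: "?d (z k) v < e / 2" "\<epsilon> k < e / 4" using eventually_happens'[OF sequentially_bot] by blast
      show "eventually (\<lambda>n. ?d (x n) v < e) ufil"
        using zx[of k]
      proof (rule eventually_mono)
        fix n assume "?d (x n) (z k) < 2 * \<epsilon> k"
        moreover have "?d (x n) v \<le> ?d (x n) (z k) + ?d (z k) v" using x z vS by (intro triangle) auto
        ultimately show "?d (x n) v < e" using k by linarith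
      qed
    qed
    then show "\<exists>z\<in>?S. lim x z" using vS by blast
  qed
  \<comment> \<open>One radius \<open>e\<close> works around all points of the ball: otherwise
    centres with failing radii tending to \<open>0\<close> would converge to a point
    \<open>v\<close>, whose compact neighbourhood contradicts the failure.\<close>
  have extend: "\<exists>e>0. good (\<rho> + e)" if \<rho>: "0 \<le> \<rho>" and g: "good \<rho>" for \<rho>
  proof -
    define cpt where "cpt z e \<longleftrightarrow> (\<forall>x. (\<forall>n. x n \<in> ?S \<and> ?d z (x n) \<le> e) \<longrightarrow> (\<exists>v\<in>?S. lim x v))" for z e
    have "\<exists>e>0. \<forall>z\<in>?S. ?d p z \<le> \<rho> \<longrightarrow> cpt z e"
    proof (rule ccontr)
      assume no: "\<not> ?thesis"
      have "\<exists>z\<in>?S. ?d p z \<le> \<rho> \<and> \<not> cpt z (inverse (real (Suc k)))" for k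
      proof -
        have "0 < inverse (real (Suc k))" by simp
        then show ?thesis using no by blast
      qed
      then obtain z where z: "\<And>k. z k \<in> ?S \<and> ?d p (z k) \<le> \<rho>" "\<And>k. \<not> cpt (z k) (inverse (real (Suc k)))" by metis
      obtain v where v: "v \<in> ?S" "lim z v" using g z(1) unfolding good_def by blast
      have vt: "v \<in> topspace (mtopology_of M)" using v(1) by simp
      obtain W K where W: "openin (mtopology_of M) W" "compactin (mtopology_of M) K" "v \<in> W" "W \<subseteq> K"
        using lc[unfolded locally_compact_space_def, rule_format, OF vt] by (elim exE conjE) (rule that)
      have "openin mtopology W" using W(1) by (simp add: mtopology_of_def)
      then obtain e where e: "0 < e" "mball v e \<subseteq> W" using W(3) unfolding openin_mtopology by blast
      have "eventually (\<lambda>k. ?d (z k) v < e / 2 \<and> inverse (real (Suc k)) < e / 2) ufil"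
      proof (rule eventually_conj)
        show "eventually (\<lambda>k. ?d (z k) v < e / 2) ufil" using v(2) half_gt_zero[OF e(1)] unfolding lim_def by blast
        show "eventually (\<lambda>k. inverse (real (Suc k)) < e / 2) ufil"
          by (rule eventually_ufil[OF eventually_inverse_Suc_less[OF half_gt_zero[OF e(1)]]])
      qed
      then obtain k where k: "?d (z k) v < e / 2" "inverse (real (Suc k)) < e / 2"
        using eventually_happens'[OF ufil(2)] by blast
      have "cpt (z k) (inverse (real (Suc k)))"
        unfolding cpt_def
      proof (intro allI impI)
        fix x :: "nat \<Rightarrow> 'a" assume x: "\<forall>n. x n \<in> ?S \<and> ?d (z k) (x n) \<le> inverse (real (Suc k))"
        have "x n \<in> K" for n
        proof -
          have "?d v (x n) \<le> ?d v (z k) + ?d (z k) (x n)" using v x z(1) by (intro triangle) auto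
          then have "?d v (x n) < e" using k x[rule_format, of n] by (simp add: mdist_commute)
          then have "x n \<in> mball v e" using v x by simp
          then show ?thesis using e W by blast
        qed
        then have "eventually (\<lambda>n. x n \<in> K) ufil" by simp
        from compactin_ufil_limit[OF W(2) this] obtain u where u: "u \<in> K"
          "\<And>V. openin (mtopology_of M) V \<Longrightarrow> u \<in> V \<Longrightarrow> eventually (\<lambda>n. x n \<in> V) ufil" by blast
        have uS: "u \<in> ?S" using u(1) compactin_subset_topspace[OF W(2)] by auto
        have "lim x u"
          unfolding lim_def
        proof (intro allI impI)
          fix e :: real assume "0 < e"
          then have "eventually (\<lambda>n. x n \<in> mball u e) ufil"
            using u(2)[of "mball u e"] uS by (simp add: mtopology_of_def)
          then show "eventually (\<lambda>n. ?d (x n) u < e) ufil"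
            by (rule eventually_mono) (simp add: mdist_commute)
        qed
        then show "\<exists>v\<in>?S. lim x v" using uS by blast
      qed
      then show False using z(2) by blast
    qed
    then obtain e where e: "0 < e" "\<And>z. z \<in> ?S \<Longrightarrow> ?d p z \<le> \<rho> \<Longrightarrow> cpt z e" by blast
    have "good (\<rho> + e / 2)"
      unfolding good_def
    proof (intro allI impI)
      fix x :: "nat \<Rightarrow> 'a" assume x: "\<forall>n. x n \<in> ?S \<and> ?d p (x n) \<le> \<rho> + e / 2"
      have "\<exists>y\<in>?S. ?d p y \<le> \<rho> \<and> ?d y (x n) \<le> e / 2" for n
        using shrink[of "x n" "\<rho> + e / 2" 0 \<rho>] x \<rho> e by auto
      then obtain y where y: "\<And>n. y n \<in> ?S \<and> ?d p (y n) \<le> \<rho>" "\<And>n. ?d (y n) (x n) \<le> e / 2" by metis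
      obtain v where v: "v \<in> ?S" "lim y v" using g y(1) unfolding good_def by blast
      have vp: "?d p v \<le> \<rho>"
      proof (rule field_le_epsilon)
        fix a :: real assume "0 < a"
        then have "eventually (\<lambda>n. ?d (y n) v < a) ufil" using v by (simp add: lim_def)
        then obtain n where "?d (y n) v < a" using eventually_happens'[OF ufil(2)] by blast
        then show "?d p v \<le> \<rho> + a" using triangle[of p "y n" v] y(1)[of n] v p by simp
      qed
      have yv: "eventually (\<lambda>n. ?d (y n) v < e / 2) ufil" using v(2) half_gt_zero[OF e(1)] unfolding lim_def by blast
      define x' where "x' n = (if ?d v (x n) \<le> e then x n else v)" for n
      have "\<exists>u\<in>?S. lim x' u"
        using e(2)[OF v(1) vp] x v e(1) unfolding cpt_def x'_def by auto
      then obtain u where u: "u \<in> ?S" "lim x' u" by blast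
      have ex: "eventually (\<lambda>n. x' n = x n) ufil"
        using yv
      proof (rule eventually_mono)
        fix n assume "?d (y n) v < e / 2"
        moreover have "?d v (x n) \<le> ?d v (y n) + ?d (y n) (x n)" using v x y by (intro triangle) auto
        ultimately have "?d v (x n) \<le> e" using y(2)[of n] by (simp add: mdist_commute)
        then show "x' n = x n" by (simp add: x'_def)
      qed
      have "lim x u"
        unfolding lim_def
      proof (intro allI impI)
        fix a :: real assume "0 < a"
        then have "eventually (\<lambda>n. ?d (x' n) u < a) ufil" using u by (simp add: lim_def)
        then show "eventually (\<lambda>n. ?d (x n) u < a) ufil" using ex by eventually_elim simp
      qed
      then show "\<exists>z\<in>?S. lim x z" using u by blast
    qed
    then show ?thesis using e by (intro exI[of _ "e/2"]) auto
  qed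
  have "good \<rho>" for \<rho>
  proof (rule ccontr)
    assume bad: "\<not> good \<rho>"
    define G where "G = {t. 0 \<le> t \<and> good t}"
    have ub: "t \<le> \<rho>" if t: "t \<in> G" for t
    proof (rule ccontr)
      assume "\<not> t \<le> \<rho>"
      then have "\<rho> \<le> t" by simp
      moreover have "good t" using t by (simp add: G_def)
      ultimately show False using bad good_mono by blast
    qed
    then have bdd: "bdd_above G" by (rule bdd_aboveI)
    have 0: "0 \<in> G" using good0 by (simp add: G_def)
    define m where "m = Sup G"
    have m0: "0 \<le> m" unfolding m_def by (rule cSup_upper[OF 0 bdd])
    have "good m"
    proof (rule approx[OF m0])
      fix e :: real assume "0 < e"
      show "good (max 0 (m - e))"
      proof (cases "m - e \<le> 0")
        case True then show ?thesis using good0 by simp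
      next
        case False
        have "G \<noteq> {}" using 0 by blast
        then have "\<exists>t\<in>G. m - e < t" using less_cSup_iff[of G "m - e"] bdd \<open>0 < e\<close> by (simp add: m_def)
        then obtain t where t: "t \<in> G" "m - e < t" by blast
        have "good t" using t(1) by (simp add: G_def)
        moreover have "max 0 (m - e) \<le> t" using t False by simp
        ultimately show ?thesis by (rule good_mono)
      qed
    qed
    then obtain e where "0 < e" "good (m + e)" using extend m0 by blast
    then have "m + e \<in> G" using m0 by (simp add: G_def)
    then have "m + e \<le> m" unfolding m_def by (rule cSup_upper[OF _ bdd])
    then show False using \<open>0 < e\<close> by simp
  qed
  then obtain z where "z \<in> ?S" "lim x z" using x r unfolding good_def by blast
  then have "((\<lambda>n. ?d (x n) z) \<longlongrightarrow> 0) ufil"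
    unfolding lim_def by (auto simp: tendsto_iff dist_real_def)
  then show ?thesis using \<open>z \<in> ?S\<close> by blast
qed

section \<open>Transfer to Hadamard spaces and to products\<close>

lemma Hadamard_CN_space:
  assumes "Hadamard_space M" "locally_compact_space (mtopology_of M)"
  shows "CN_space M"
proof
  have M: "CAT0 M" "mcomplete_of M" "geodesic_space M"
    using assms by (auto simp: Hadamard_space_def CAT0_def)
  show "\<exists>z\<in>mspace M. \<forall>w\<in>mspace M. (mdist M z w)\<^sup>2 \<le>
        (1 - l) * (mdist M x w)\<^sup>2 + l * (mdist M y w)\<^sup>2 - l * (1 - l) * (mdist M x y)\<^sup>2"
    if "x \<in> mspace M" "y \<in> mspace M" "0 \<le> l" "l \<le> 1" for x y l
    using CAT0_CN[OF M(1) that] .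
  show "\<exists>z\<in>mspace M. ((\<lambda>n. mdist M (x n) z) \<longlongrightarrow> 0) ufil"
    if "range x \<subseteq> mspace M" "p \<in> mspace M" "\<And>n. mdist M p (x n) \<le> r" for x p r
    using proper_bounded_limit[OF M(2) assms(2) M(3) that] .
qed

lemma L2_metric_sq: "(mdist (L2_metric X) x y)\<^sup>2 = (\<Sum>i\<in>UNIV. (mdist (X i) (x i) (y i))\<^sup>2)"
  by (simp add: mdist_L2_metric L2_set_def sum_nonneg)

lemma L2_metric_coord: "mdist (X i) (x i) (y i) \<le> mdist (L2_metric X) x y"
  unfolding mdist_L2_metric by (rule member_le_L2_set) auto

lemma L2_metric_le_sum: "mdist (L2_metric X) x y \<le> (\<Sum>i\<in>UNIV. mdist (X i) (x i) (y i))"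
  unfolding mdist_L2_metric by (rule L2_set_le_sum) auto

text \<open>\<open>CN\<close> is linear in the squared distances, so the inequalities of the factors
  simply add up.\<close>

lemma L2_CN_space:
  fixes X :: "'n::finite \<Rightarrow> 'a metric"
  assumes X: "\<And>i. CN_space (X i)"
  shows "CN_space (L2_metric X)"
proof
  let ?d = "mdist (L2_metric X)"
  fix x y :: "'n \<Rightarrow> 'a" and l :: real
  assume xy: "x \<in> mspace (L2_metric X)" "y \<in> mspace (L2_metric X)" and l: "0 \<le> l" "l \<le> 1"
  define z where "z i = CN_space.pt (X i) (x i) (y i) l" for i
  have zS: "z i \<in> mspace (X i)" for i unfolding z_def using xy l by (intro CN_space.pt_in[OF X]) auto
  show "\<exists>z\<in>mspace (L2_metric X). \<forall>w\<in>mspace (L2_metric X). (?d z w)\<^sup>2 \<le>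
        (1 - l) * (?d x w)\<^sup>2 + l * (?d y w)\<^sup>2 - l * (1 - l) * (?d x y)\<^sup>2"
  proof (intro bexI[of _ z] ballI)
    fix w assume w: "w \<in> mspace (L2_metric X)"
    have "(\<Sum>i\<in>UNIV. (mdist (X i) (z i) (w i))\<^sup>2) \<le> (\<Sum>i\<in>UNIV. (1 - l) * (mdist (X i) (x i) (w i))\<^sup>2
        + l * (mdist (X i) (y i) (w i))\<^sup>2 - l * (1 - l) * (mdist (X i) (x i) (y i))\<^sup>2)"
      unfolding z_def using xy w l by (intro sum_mono CN_space.pt_CN[OF X]) auto
    then show "(?d z w)\<^sup>2 \<le> (1 - l) * (?d x w)\<^sup>2 + l * (?d y w)\<^sup>2 - l * (1 - l) * (?d x y)\<^sup>2"
      by (simp add: L2_metric_sq sum.distrib sum_subtractf sum_distrib_left)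
  qed (use zS in auto)
next
  let ?d = "mdist (L2_metric X)"
  fix x :: "nat \<Rightarrow> 'n \<Rightarrow> 'a" and p r
  assume x: "range x \<subseteq> mspace (L2_metric X)" and p: "p \<in> mspace (L2_metric X)" and r: "\<And>n. ?d p (x n) \<le> r"
  have "\<exists>z\<in>mspace (X i). ((\<lambda>n. mdist (X i) (x n i) z) \<longlongrightarrow> 0) ufil" for i
  proof (rule CN_space.bounded_limit[OF X])
    show "range (\<lambda>n. x n i) \<subseteq> mspace (X i)" "p i \<in> mspace (X i)" using x p by auto
    show "mdist (X i) (p i) (x n i) \<le> r" for n using L2_metric_coord[of X i p "x n"] r[of n] by simp
  qed
  then obtain z where z: "\<And>i. z i \<in> mspace (X i)" "\<And>i. ((\<lambda>n. mdist (X i) (x n i) (z i)) \<longlongrightarrow> 0) ufil" by metis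
  have "((\<lambda>n. \<Sum>i\<in>UNIV. mdist (X i) (x n i) (z i)) \<longlongrightarrow> (\<Sum>i\<in>(UNIV::'n set). 0)) ufil"
    by (intro tendsto_sum z)
  then have s: "((\<lambda>n. \<Sum>i\<in>UNIV. mdist (X i) (x n i) (z i)) \<longlongrightarrow> 0) ufil" by simp
  have "((\<lambda>n. ?d (x n) z) \<longlongrightarrow> 0) ufil"
    by (rule Lim_null_comparison[OF _ s]) (simp add: L2_metric_le_sum)
  then show "\<exists>z\<in>mspace (L2_metric X). ((\<lambda>n. ?d (x n) z) \<longlongrightarrow> 0) ufil"
    using z by (intro bexI[of _ z]) auto
qed

context CN_space
begin

section \<open>Geometry in a single factor, prepared for the product\<close>

lemma contracting_mono:
  assumes "contracting b D" "D \<le> D'"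
  shows "contracting b D'"
  unfolding contracting_def
proof (intro conjI ballI impI)
  show "line b" "0 < D'" using contracting_line[OF assms(1)] contracting_pos[OF assms(1)] assms(2) by auto
  fix x y assume xy: "x \<in> S" "y \<in> S" "D' \<le> \<bar>prj b x - prj b y\<bar>"
  then obtain l where "0 \<le> l" "l \<le> 1" "d (pt x y l) (b (prj b x)) \<le> D"
    using contractingD[OF assms(1) xy(1,2)] assms(2) by auto
  then show "\<exists>l\<in>{0..1}. d (pt x y l) (b (prj b x)) \<le> D'" using assms(2) by (intro bexI[of _ l]) auto
qed

lemma contracting_isom:
  assumes c: "contracting b D" and g: "isom g"
  shows "contracting (\<lambda>t. g (b t)) D"
  unfolding contracting_def
proof (intro conjI ballI impI)
  have bl: "line b" using c by (rule contracting_line)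
  show "line (\<lambda>t. g (b t))" by (rule isom_line[OF g bl])
  show "0 < D" using c by (rule contracting_pos)
  fix x y assume x: "x \<in> S" and y: "y \<in> S" and far: "D \<le> \<bar>prj (\<lambda>t. g (b t)) x - prj (\<lambda>t. g (b t)) y\<bar>"
  define u v where "u = (inv\<^bsub>IG\<^esub> g) x" and "v = (inv\<^bsub>IG\<^esub> g) y"
  have u: "u \<in> S" "g u = x" and v: "v \<in> S" "g v = y"
    using isom_in[OF isom_inv[OF g]] isom_inv_app(2)[OF g] x y by (auto simp: u_def v_def)
  have pu: "prj (\<lambda>t. g (b t)) x = prj b u" and pv: "prj (\<lambda>t. g (b t)) y = prj b v"
    using prj_isom[OF g bl] u v by (metis)+
  obtain l where l: "0 \<le> l" "l \<le> 1" "d (pt u v l) (b (prj b u)) \<le> D"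
    using contractingD[OF c u(1) v(1)] far pu pv by auto
  have "pt u v l \<in> S" using u v l by auto
  then have "d (g (pt u v l)) (g (b (prj b u))) \<le> D" using l bl isom_d[OF g] by simp
  then show "\<exists>l\<in>{0..1}. d (pt x y l) (g (b (prj (\<lambda>t. g (b t)) x))) \<le> D"
    using l isom_pt[OF g u(1) v(1) l(1,2)] u v pu by (intro bexI[of _ l]) auto
qed

lemma independent_axes:
  assumes "independent_rank_one M g h"
  shows "\<exists>a la b lb D B. axis g a la \<and> axis h b lb \<and> contracting b D \<and>
     (\<forall>t. \<bar>prj a (b t)\<bar> \<le> B) \<and> (\<forall>t. \<bar>prj b (a t)\<bar> \<le> B)"
proof -
  have g: "isom g" and h: "isom h" using assms by (auto simp: independent_rank_one_def rank_one_def axial_def)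
  obtain a la where a: "axis g a la" "\<not> bounds_flat_half_plane M a"
    using assms by (auto simp: independent_rank_one_def rank_one_def)
  obtain b lb where b: "axis h b lb" "\<not> bounds_flat_half_plane M b"
    using assms by (auto simp: independent_rank_one_def rank_one_def)
  obtain Da Db where D: "contracting a Da" "contracting b Db"
    using rank_one_axis_contracting[OF g a] rank_one_axis_contracting[OF h b] by blast
  have disj: "{ray_endpoint M a, ray_endpoint M (\<lambda>t. a (- t))} \<inter> {ray_endpoint M b, ray_endpoint M (\<lambda>t. b (- t))} = {}"
    using assms unfolding independent_rank_one_def attracting_point_eq[OF g a(1)] attracting_point_eq[OF h b(1)]
      repelling_point_eq[OF g a(1)] repelling_point_eq[OF h b(1)] by blast
  obtain B1 where B1: "\<And>t. \<bar>prj a (b t)\<bar> \<le> B1"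
    using bounded_projection[OF D(1) contracting_line[OF D(2)] disj] by blast
  obtain B2 where B2: "\<And>t. \<bar>prj b (a t)\<bar> \<le> B2"
    using bounded_projection[OF D(2) contracting_line[OF D(1)]] disj by blast
  have "\<forall>t. \<bar>prj a (b t)\<bar> \<le> max B1 B2" "\<forall>t. \<bar>prj b (a t)\<bar> \<le> max B1 B2" using B1 B2 by (auto simp: le_max_iff_disj)
  then show ?thesis using a b D by blast
qed

text \<open>Behrstock's inequality: a point projecting far out on the translate of \<open>b\<close> by the \<open>k\<close>-th power of
  \<open>g\<close> projects to the axis \<open>a\<close> near the parameter \<open>k * la\<close>.\<close>

lemma at_most_one_far:
  assumes g: "isom g" and a: "axis g a la" and b: "contracting b D"
    and ab: "\<And>t. \<bar>prj a (b t)\<bar> \<le> B" and ba: "\<And>t. \<bar>prj b (a t)\<bar> \<le> B"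
    and M: "2 * (B + D) < of_int m * la" and z: "z \<in> S"
    and j: "B + D < \<bar>prj (\<lambda>t. (g [^]\<^bsub>IG\<^esub> (j * m :: int)) (b t)) z\<bar>"
    and k: "B + D < \<bar>prj (\<lambda>t. (g [^]\<^bsub>IG\<^esub> (k * m :: int)) (b t)) z\<bar>"
  shows "j = k"
proof -
  have al: "line a" and la: "0 < la" using a by (auto simp: is_axis_def)
  have bl: "line b" using b by (rule contracting_line)
  have *: "\<bar>prj a z - of_int j * (of_int m * la)\<bar> \<le> B + D"
    if far: "B + D < \<bar>prj (\<lambda>t. (g [^]\<^bsub>IG\<^esub> (j * m :: int)) (b t)) z\<bar>" for j
  proof -
    let ?f = "g [^]\<^bsub>IG\<^esub> (j * m)" and ?f' = "g [^]\<^bsub>IG\<^esub> (- (j * m))"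
    have f: "isom ?f" "isom ?f'" using isom_pow[OF g] by auto
    define y where "y = ?f' z"
    have y: "y \<in> S" unfolding y_def by (rule isom_in[OF f(2) z])
    have fy: "?f y = z" unfolding y_def using isom_pow_add[OF g z, of "j * m" "- (j * m)"] isom_pow_0[OF z, of g] by simp
    have "prj (\<lambda>t. ?f (b t)) z = prj b y" using prj_isom[OF f(1) bl y] fy by simp
    then have "D \<le> \<bar>prj b y - prj b (a t)\<bar>" for t using far ba[of t] by linarith
    then obtain t where "\<bar>prj a y - prj a (b t)\<bar> \<le> D" using behrstock[OF al b y] by blast
    then have "\<bar>prj a y\<bar> \<le> B + D" using ab[of t] by linarith
    moreover have "prj a (?f y) = prj a y + of_int (j * m) * la"
      by (rule prj_isom_line[OF f(1) al y]) (rule axis_pow[OF g a])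
    ultimately show ?thesis unfolding fy by simp
  qed
  show ?thesis
  proof (rule ccontr)
    assume "j \<noteq> k"
    then have "1 \<le> \<bar>of_int j - of_int k :: real\<bar>" by (simp flip: of_int_diff of_int_abs)
    moreover have "0 \<le> B" using ab[of 0] by linarith
    then have pos: "0 < 2 * (B + D)" using contracting_pos[OF b] by simp
    have p: "0 \<le> of_int m * la" by (rule less_imp_le[OF less_trans[OF pos M]])
    ultimately have "1 * (of_int m * la) \<le> \<bar>of_int j - of_int k\<bar> * (of_int m * la)" by (intro mult_right_mono)
    also have "\<dots> = \<bar>of_int j * (of_int m * la) - of_int k * (of_int m * la)\<bar>"
    proof -
      have "\<bar>of_int j - of_int k\<bar> * P = \<bar>of_int j * P - of_int k * P\<bar>" if "0 \<le> P" for P :: real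
        using that by (simp add: abs_mult flip: left_diff_distrib)
      then show ?thesis using p by blast
    qed
    also have "\<dots> \<le> 2 * (B + D)"
    proof -
      have "\<bar>u - v\<bar> \<le> 2 * c" if "\<bar>p - u\<bar> \<le> c" "\<bar>p - v\<bar> \<le> c" for u v p c :: real
        using that by linarith
      then show ?thesis using *[OF j] *[OF k] by blast
    qed
    finally show False using M by simp
  qed
qed

text \<open>\<open>F\<close> shifts the foot of \<open>v\<close> by \<open>w\<close>, so the feet of
  \<open>z\<close> and \<open>F v\<close> are at least \<open>Q\<close> apart and the geodesic
  between these points passes near \<open>b 0\<close>, hence near \<open>x\<close>. The detours cost
  six times \<open>Q\<close> and once \<open>w\<close>.\<close>

lemma dist_across_line:
  assumes b: "contracting b Q" and F: "isom F" and Fb: "\<And>t. F (b t) = b (t + w)"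
    and z: "z \<in> S" and v: "v \<in> S" and x: "x \<in> S"
    and pz: "\<bar>prj b z\<bar> \<le> Q" and pv: "\<bar>prj b v\<bar> \<le> Q" and E: "d x (b 0) \<le> Q" and w: "3 * Q \<le> w"
  shows "d z x + d x v - (6 * Q + w) \<le> d z (F v)"
proof -
  have bl: "line b" using b by (rule contracting_line)
  have Fv: "F v \<in> S" by (rule isom_in[OF F v])
  have pF: "prj b (F v) = prj b v + w" by (rule prj_isom_line[OF F bl v Fb])
  have "Q \<le> \<bar>prj b z - prj b (F v)\<bar>" unfolding pF using pz pv w by linarith
  then obtain l where l: "0 \<le> l" "l \<le> 1" "d (pt z (F v) l) (b (prj b z)) \<le> Q"
    using contractingD[OF b z Fv] by blast
  let ?q = "pt z (F v) l"
  have q: "?q \<in> S" using z Fv l by auto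
  have "d z ?q + d ?q (F v) = d z (F v)"
    using d_pt_simps[OF z Fv l(1,2)] by (simp add: algebra_simps)
  moreover have "d z x \<le> d z ?q + (d ?q (b (prj b z)) + (d (b (prj b z)) (b 0) + d (b 0) x))"
    using tri[of z ?q x] tri[of ?q "b (prj b z)" x] tri[of "b (prj b z)" "b 0" x] z x q bl by simp
  moreover have "d (b w) (F v) \<le> d (b w) (b (prj b z)) + (d (b (prj b z)) ?q + d ?q (F v))"
    using tri[of "b w" "b (prj b z)" "F v"] tri[of "b (prj b z)" ?q "F v"] q bl Fv by simp
  moreover have "d (b w) (F v) = d (b 0) v" using isom_d[OF F _ v, of "b 0"] Fb[of 0] bl by simp
  moreover have "d x v \<le> d x (b 0) + d (b 0) v" using x v bl by (intro tri) auto
  moreover have "d (b (prj b z)) (b 0) \<le> Q" "d (b w) (b (prj b z)) \<le> w + Q"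
    using pz w bl by (simp_all add: line_d)
  ultimately show ?thesis using l(3) E dsym[of "b (prj b z)" ?q] dsym[of "b 0" x] by linarith
qed

text \<open>The chain is used with \<open>B = 2 * Q\<close>, the bound of
  \<open>projection_of_translate\<close>; this explains \<open>9 * Q + 1\<close> and
  \<open>10 * Q\<close>. In the final bound \<open>10 * Q\<close> comes from the chain and
  \<open>2 * Q + w\<close> from the displacement of \<open>x\<close> under \<open>F\<close>.\<close>

lemma translate_rank_one:
  assumes b: "contracting b Q" and F: "isom F" and Fb: "\<And>t. F (b t) = b (t + w)"
    and g: "isom g" and x: "x \<in> S"
    and pg: "\<bar>prj b (g x)\<bar> \<le> Q" and pgi: "\<bar>prj b ((inv\<^bsub>IG\<^esub> g) x)\<bar> \<le> Q" and E: "d x (b 0) \<le> Q"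
    and w: "9 * Q + 1 \<le> w" and far: "10 * Q < d x (g x)"
  shows "rank_one M (g \<otimes>\<^bsub>IG\<^esub> F)" "\<bar>translation_length M (g \<otimes>\<^bsub>IG\<^esub> F) - d x (g x)\<bar> \<le> 12 * Q + w"
proof -
  have bl: "line b" using b by (rule contracting_line)
  have Q: "0 < Q" using b by (rule contracting_pos)
  have gi: "isom (inv\<^bsub>IG\<^esub> g)" by (rule isom_inv[OF g])
  have ii: "inv\<^bsub>IG\<^esub> (inv\<^bsub>IG\<^esub> g) = g" by (rule group.inv_inv[OF group_isometry_group g])
  have gix: "d x ((inv\<^bsub>IG\<^esub> g) x) = d x (g x)"
    using isom_d[OF g x isom_in[OF gi x]] isom_inv_app(2)[OF g x] by (simp add: dsym)
  interpret C: translate_chain M b Q F g w "2 * Q" x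
  proof
    show "contracting b Q" "isom F" "isom g" "x \<in> S" by fact+
    show "F (b t) = b (t + w)" for t by (rule Fb)
    show "\<bar>prj b (g (b t))\<bar> \<le> 2 * Q" for t
      using projection_of_translate[OF b g x pg pgi] far E by simp
    show "\<bar>prj b ((inv\<^bsub>IG\<^esub> g) (b t))\<bar> \<le> 2 * Q" for t
      using projection_of_translate[OF b gi x pgi, of t] far E pg by (simp add: ii gix)
    have "\<bar>prj b x\<bar> \<le> d x (b 0)" using prj_lip[OF bl x, of "b 0"] bl by (simp add: prj_line)
    then show "\<bar>prj b x\<bar> \<le> 2 * Q" using E Q by linarith
    show "\<bar>prj b (g x)\<bar> \<le> 2 * Q" "\<bar>prj b ((inv\<^bsub>IG\<^esub> g) x)\<bar> \<le> 2 * Q" using pg pgi Q by linarith+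
    show "3 * (2 * Q) + 3 * Q + 1 \<le> w" using w by simp
  qed
  have dl: "C.dl = g \<otimes>\<^bsub>IG\<^esub> F" by (simp add: C.dl_def)
  show "rank_one M (g \<otimes>\<^bsub>IG\<^esub> F)" using C.chain_rank_one(1) by (simp add: dl)
  have Fx: "F x \<in> S" by (rule isom_in[OF F x])
  have "d x (F x) \<le> d x (b 0) + (d (b 0) (b w) + d (b w) (F x))"
    using tri[of x "b 0" "F x"] tri[of "b 0" "b w" "F x"] x bl Fx by simp
  moreover have "d (b w) (F x) = d (b 0) x" using isom_d[OF F _ x, of "b 0"] Fb[of 0] bl by simp
  ultimately have dF: "d x (F x) \<le> 2 * Q + w" using E w Q bl by (simp add: line_d dsym)
  have gx: "g x \<in> S" "g (F x) \<in> S" by (rule isom_in[OF g x], rule isom_in[OF g Fx])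
  have "d (g x) (g (F x)) = d x (F x)" by (rule isom_d[OF g x Fx])
  then have "\<bar>d x (g (F x)) - d x (g x)\<bar> \<le> 2 * Q + w"
    using tri'[of "g (F x)" "g x" x] gx x dF by (simp add: dsym)
  moreover have "C.dl x = g (F x)" using C.dl_app[OF x] .
  moreover have "2 * (Q + C.H + C.E) \<le> 10 * Q" using E by (simp add: C.H_def C.E_def)
  ultimately show "\<bar>translation_length M (g \<otimes>\<^bsub>IG\<^esub> F) - d x (g x)\<bar> \<le> 12 * Q + w"
    using C.chain_rank_one(2,3) Q w by (simp add: dl)
qed

end

section \<open>Displacement vectors of a group acting on a product\<close>

locale product_space_action =
  fixes X :: "'n::finite \<Rightarrow> 'a metric" and \<Gamma> :: "('n \<Rightarrow> 'a \<Rightarrow> 'a) set" and x :: "'n \<Rightarrow> 'a"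
  assumes CN_factor: "\<And>i. CN_space (X i)"
    and sub: "subgroup \<Gamma> (product_isometry_group X)"
    and xS: "\<And>i. x i \<in> mspace (X i)"
begin

abbreviation G where "G i \<equiv> isometry_group (X i)"
abbreviation dd where "dd i \<equiv> mdist (X i)"

definition disp :: "('n \<Rightarrow> 'a \<Rightarrow> 'a) \<Rightarrow> real ^ 'n" where
  "disp \<gamma> = (\<chi> i. dd i (x i) (\<gamma> i (x i)))"

lemma disp_nth: "disp \<gamma> $ i = dd i (x i) (\<gamma> i (x i))"
  by (simp add: disp_def)

lemma disp_nonneg: "0 \<le> disp \<gamma> $ i"
  by (simp add: disp_nth)

lemma comp_isom: "\<gamma> \<in> \<Gamma> \<Longrightarrow> \<gamma> i \<in> carrier (G i)"
  using subgroup.subset[OF sub] by (auto simp: product_isometry_group_def)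

lemma mult_ex:
  assumes "\<gamma> \<in> \<Gamma>" "\<delta> \<in> \<Gamma>"
  shows "\<exists>\<epsilon>\<in>\<Gamma>. \<forall>i. \<epsilon> i = \<gamma> i \<otimes>\<^bsub>G i\<^esub> \<delta> i"
  using subgroup.m_closed[OF sub assms] by (intro bexI) (auto simp: product_isometry_group_def)

lemma inv_ex:
  assumes "\<gamma> \<in> \<Gamma>"
  shows "\<exists>\<epsilon>\<in>\<Gamma>. \<forall>i. \<epsilon> i = inv\<^bsub>G i\<^esub> (\<gamma> i)"
proof (intro bexI allI)
  show "inv\<^bsub>product_isometry_group X\<^esub> \<gamma> \<in> \<Gamma>" by (rule subgroup.m_inv_closed[OF sub assms])
  fix i
  have "\<gamma> \<in> carrier (product_isometry_group X)" using subgroup.subset[OF sub] assms by blast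
  then have "inv\<^bsub>product_isometry_group X\<^esub> \<gamma> = (\<lambda>i\<in>UNIV. inv\<^bsub>G i\<^esub> \<gamma> i)"
    unfolding product_isometry_group_def by (intro inv_product_group) (auto simp: group_isometry_group)
  then show "(inv\<^bsub>product_isometry_group X\<^esub> \<gamma>) i = inv\<^bsub>G i\<^esub> (\<gamma> i)" by simp
qed

lemma one_ex: "\<exists>\<epsilon>\<in>\<Gamma>. \<forall>i. \<epsilon> i = \<one>\<^bsub>G i\<^esub>"
  using subgroup.one_closed[OF sub] by (intro bexI) (auto simp: product_isometry_group_def)

lemma pow_ex:
  assumes "\<gamma> \<in> \<Gamma>"
  shows "\<exists>\<epsilon>\<in>\<Gamma>. \<forall>i. \<epsilon> i = \<gamma> i [^]\<^bsub>G i\<^esub> (k::int)"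
proof -
  have nn: "\<exists>\<epsilon>\<in>\<Gamma>. \<forall>i. \<epsilon> i = \<gamma> i [^]\<^bsub>G i\<^esub> int n" for n
  proof (induction n)
    case 0 then show ?case using one_ex by simp
  next
    case (Suc n)
    then obtain \<epsilon> where \<epsilon>: "\<epsilon> \<in> \<Gamma>" "\<And>i. \<epsilon> i = \<gamma> i [^]\<^bsub>G i\<^esub> int n" by blast
    have "\<gamma> i [^]\<^bsub>G i\<^esub> int (Suc n) = \<epsilon> i \<otimes>\<^bsub>G i\<^esub> \<gamma> i" for i
    proof -
      have "int (Suc n) = int n + 1" by simp
      then have "\<gamma> i [^]\<^bsub>G i\<^esub> int (Suc n) = \<gamma> i [^]\<^bsub>G i\<^esub> int n \<otimes>\<^bsub>G i\<^esub> \<gamma> i [^]\<^bsub>G i\<^esub> (1::int)"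
        using group.int_pow_mult[OF group_isometry_group comp_isom[OF assms], of i "int n" 1] by (simp only:)
      then show ?thesis by (simp only: \<epsilon>(2) group.int_pow_1[OF group_isometry_group comp_isom[OF assms]])
    qed
    then show ?case using mult_ex[OF \<epsilon>(1) assms] by simp
  qed
  show ?thesis
  proof (cases "0 \<le> k")
    case True then show ?thesis using nn[of "nat k"] by simp
  next
    case False
    then obtain \<epsilon> where \<epsilon>: "\<epsilon> \<in> \<Gamma>" "\<And>i. \<epsilon> i = \<gamma> i [^]\<^bsub>G i\<^esub> (- k)" using nn[of "nat (- k)"] by auto
    obtain \<delta> where \<delta>: "\<delta> \<in> \<Gamma>" "\<And>i. \<delta> i = inv\<^bsub>G i\<^esub> (\<epsilon> i)" using inv_ex[OF \<epsilon>(1)] by blast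
    have "\<delta> i = \<gamma> i [^]\<^bsub>G i\<^esub> k" for i
      using group.int_pow_neg[OF group_isometry_group comp_isom[OF assms], of i "- k"] by (simp add: \<delta> \<epsilon>)
    then show ?thesis using \<delta>(1) by blast
  qed
qed

definition J :: "int set" where "J = {0..2 * int CARD('n)}"

text \<open>A family of \<open>2 r + 1\<close> lines, translated by elements of \<open>\<Gamma>\<close>, such that in each factor every point
  projects far out on at most one of them. Hence for two given points of the product there is a line
  on which both project centrally in all factors simultaneously.\<close>

definition good_family where
  "good_family b Q l F \<longleftrightarrow> 0 < Q \<and> (\<forall>i. 0 < l i) \<and>
     (\<forall>j\<in>J. \<forall>i. CN_space.contracting (X i) (b j i) Q \<and> dd i (x i) (b j i 0) \<le> Q) \<and>
     (\<forall>j. \<forall>N. F j N \<in> \<Gamma> \<and> (\<forall>i t. F j N i (b j i t) = b j i (t + real N * l i))) \<and>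
     (\<forall>i. \<forall>z\<in>mspace (X i). \<forall>j k. Q < \<bar>CN_space.prj (X i) (b j i) z\<bar> \<longrightarrow> Q < \<bar>CN_space.prj (X i) (b k i) z\<bar> \<longrightarrow> j = k)"

text \<open>The lines are translates of an axis of \<open>h\<close> by powers of \<open>g\<close>
  with exponents \<open>j * M\<close>, where \<open>M\<close> is large enough for
  \<open>at_most_one_far\<close> in every factor. Conjugated powers of \<open>h\<close> translate
  along them.\<close>

lemma good_family_ex:
  assumes g: "g \<in> \<Gamma>" and h: "h \<in> \<Gamma>" and ind: "independent_regular_axial X g h"
  shows "\<exists>b Q l F. good_family b Q l F"
proof -
  have "\<exists>a la b lb D B. is_axis (X i) (g i) a la \<and> is_axis (X i) (h i) b lb \<and> CN_space.contracting (X i) b D \<and>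
     (\<forall>t. \<bar>CN_space.prj (X i) a (b t)\<bar> \<le> B) \<and> (\<forall>t. \<bar>CN_space.prj (X i) b (a t)\<bar> \<le> B)" for i
    using CN_space.independent_axes[OF CN_factor] ind by (simp add: independent_regular_axial_def)
  then obtain a la b lb D B where a: "\<And>i. is_axis (X i) (g i) (a i) (la i)" and b: "\<And>i. is_axis (X i) (h i) (b i) (lb i)"
    and D: "\<And>i. CN_space.contracting (X i) (b i) (D i)"
    and ab: "\<And>i t. \<bar>CN_space.prj (X i) (a i) (b i t)\<bar> \<le> B i" and ba: "\<And>i t. \<bar>CN_space.prj (X i) (b i) (a i t)\<bar> \<le> B i"
    by metis
  have la: "0 < la i" "0 < lb i" for i using a b by (auto simp: is_axis_def)
  have B0: "0 \<le> B i" for i using ab[of i 0] by linarith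
  have D0: "0 < D i" for i by (rule CN_space.contracting_pos[OF CN_factor D])
  have "\<exists>m::nat. 2 * (B i + D i) < real m * la i" for i using ex_less_of_nat_mult[OF la(1)] by blast
  then obtain m where m: "\<And>i. 2 * (B i + D i) < real (m i) * la i" by metis
  define M where "M = (\<Sum>i\<in>UNIV. m i)"
  have M: "2 * (B i + D i) < of_int (int M) * la i" for i
  proof -
    have "m i \<le> M" unfolding M_def by (rule member_le_sum) auto
    then have "real (m i) * la i \<le> real M * la i" using la by (intro mult_right_mono) (auto simp: less_imp_le)
    then show ?thesis using m[of i] by simp
  qed
  define p where "p j i = g i [^]\<^bsub>G i\<^esub> (j * int M)" for j i
  have p: "p j i \<in> carrier (G i)" for j i unfolding p_def by (rule CN_space.isom_pow[OF CN_factor comp_isom[OF g]])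
  define b' where "b' j i t = p j i (b i t)" for j i t
  have bS: "b i t \<in> mspace (X i)" for i t
    by (rule CN_space.line_in[OF CN_factor CN_space.axis_line[OF CN_factor b]])
  have "\<exists>F\<in>\<Gamma>. \<forall>i t. F i (b' j i t) = b' j i (t + real N * lb i)" for j N
  proof -
    obtain u where u: "u \<in> \<Gamma>" "\<And>i. u i = p j i" using pow_ex[OF g, of "j * int M"] by (auto simp: p_def)
    obtain u' where u': "u' \<in> \<Gamma>" "\<And>i. u' i = inv\<^bsub>G i\<^esub> (u i)" using inv_ex[OF u(1)] by blast
    obtain v where v: "v \<in> \<Gamma>" "\<And>i. v i = h i [^]\<^bsub>G i\<^esub> int N" using pow_ex[OF h] by blast
    obtain q where q: "q \<in> \<Gamma>" "\<And>i. q i = v i \<otimes>\<^bsub>G i\<^esub> u' i" using mult_ex[OF v(1) u'(1)] by blast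
    obtain F where F: "F \<in> \<Gamma>" "\<And>i. F i = u i \<otimes>\<^bsub>G i\<^esub> q i" using mult_ex[OF u(1) q(1)] by blast
    have "F i (b' j i t) = b' j i (t + real N * lb i)" for i t
    proof -
      have b'S: "b' j i t \<in> mspace (X i)" unfolding b'_def by (rule CN_space.isom_in[OF CN_factor p bS])
      have 1: "u' i (b' j i t) = b i t"
        unfolding u'(2) u(2) b'_def by (rule CN_space.isom_inv_app(1)[OF CN_factor p bS])
      have "q i (b' j i t) = v i (u' i (b' j i t))"
        unfolding q(2) by (rule CN_space.isom_mult_app[OF CN_factor comp_isom[OF v(1)] comp_isom[OF u'(1)] b'S])
      also have "\<dots> = b i (t + of_int (int N) * lb i)"
        unfolding 1 v(2) by (rule CN_space.axis_pow[OF CN_factor comp_isom[OF h] b])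
      finally have 2: "q i (b' j i t) = b i (t + real N * lb i)" by simp
      have "F i (b' j i t) = u i (q i (b' j i t))"
        unfolding F(2) by (rule CN_space.isom_mult_app[OF CN_factor comp_isom[OF u(1)] comp_isom[OF q(1)] b'S])
      also have "\<dots> = p j i (b i (t + real N * lb i))" by (simp only: 2 u(2))
      finally show ?thesis by (simp only: b'_def)
    qed
    then show ?thesis using F(1) by blast
  qed
  then obtain F where F: "\<And>j N. F j N \<in> \<Gamma>" "\<And>j N i t. F j N i (b' j i t) = b' j i (t + real N * lb i)" by metis
  \<comment> \<open>One constant for all factors; the distances of the lines to the base point are
    bounded only over the finite set \<open>J\<close>.\<close>
  define Q where "Q = (\<Sum>i\<in>UNIV. B i + D i) + (\<Sum>j\<in>J. \<Sum>i\<in>UNIV. dd i (x i) (b' j i 0))"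
  have fin: "finite J" by (simp add: J_def)
  have nn1: "0 \<le> (\<Sum>j\<in>J. \<Sum>i\<in>UNIV. dd i (x i) (b' j i 0))" by (intro sum_nonneg) auto
  have BD: "B i + D i \<le> (\<Sum>i\<in>UNIV. B i + D i)" for i
    by (rule member_le_sum) (use B0 D0 in \<open>auto simp: add_nonneg_nonneg less_imp_le\<close>)
  have Q1: "B i + D i \<le> Q" for i using BD[of i] nn1 by (simp add: Q_def)
  have Q2: "dd i (x i) (b' j i 0) \<le> Q" if "j \<in> J" for i j
  proof -
    have "dd i (x i) (b' j i 0) \<le> (\<Sum>i\<in>UNIV. dd i (x i) (b' j i 0))" by (rule member_le_sum) auto
    also have "\<dots> \<le> (\<Sum>j\<in>J. \<Sum>i\<in>UNIV. dd i (x i) (b' j i 0))"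
      using that fin by (intro member_le_sum) (auto intro: sum_nonneg)
    also have "\<dots> \<le> Q" using BD[of i] B0[of i] D0[of i] by (simp add: Q_def)
    finally show ?thesis .
  qed
  have "good_family b' Q lb F"
    unfolding good_family_def
  proof (intro conjI allI ballI impI)
    show "0 < Q" using Q1[of undefined] B0[of undefined] D0[of undefined] by linarith
    show "CN_space.contracting (X i) (b' j i) Q" for i j
    proof -
      have "CN_space.contracting (X i) (\<lambda>t. p j i (b i t)) (D i)" by (rule CN_space.contracting_isom[OF CN_factor D p])
      moreover have "D i \<le> Q" using Q1[of i] B0[of i] by linarith
      ultimately have "CN_space.contracting (X i) (\<lambda>t. p j i (b i t)) Q" by (rule CN_space.contracting_mono[OF CN_factor])
      then show ?thesis by (simp add: b'_def[abs_def])
    qed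
    fix i z j k assume z: "z \<in> mspace (X i)"
      and jk: "Q < \<bar>CN_space.prj (X i) (b' j i) z\<bar>" "Q < \<bar>CN_space.prj (X i) (b' k i) z\<bar>"
    have "B i + D i < \<bar>CN_space.prj (X i) (b' j i) z\<bar>" "B i + D i < \<bar>CN_space.prj (X i) (b' k i) z\<bar>"
      using jk Q1[of i] by linarith+
    then show "j = k"
      using CN_space.at_most_one_far[OF CN_factor comp_isom[OF g] a D ab ba M z, of j k]
      unfolding b'_def[abs_def] p_def by blast
  qed (use la F Q2 in auto)
  then show ?thesis by blast
qed

text \<open>Each of the two points excludes at most one index per factor, so at most
  \<open>2 * CARD('n)\<close> elements of \<open>J\<close> are lost.\<close>

lemma good_index:
  assumes fam: "good_family b Q l F" and z: "\<And>i. z i \<in> mspace (X i)" and v: "\<And>i. v i \<in> mspace (X i)"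
  shows "\<exists>j\<in>J. \<forall>i. \<bar>CN_space.prj (X i) (b j i) (z i)\<bar> \<le> Q \<and> \<bar>CN_space.prj (X i) (b j i) (v i)\<bar> \<le> Q"
proof -
  define A where "A y i = {j \<in> J. Q < \<bar>CN_space.prj (X i) (b j i) (y i)\<bar>}" for y i
  have fJ: "finite J" by (simp add: J_def)
  have fA: "finite (A y i)" for y i by (rule finite_subset[OF _ fJ]) (auto simp: A_def)
  note fin = fJ fA
  have one: "card (A y i) \<le> 1" if "\<And>i. y i \<in> mspace (X i)" for y i
  proof -
    have "j = k" if "j \<in> A y i" "k \<in> A y i" for j k
      using that fam \<open>y i \<in> mspace (X i)\<close> unfolding good_family_def A_def by blast
    then show ?thesis using card_le_Suc0_iff_eq[OF fin(2)] by auto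
  qed
  have "card (\<Union>i\<in>UNIV. A z i \<union> A v i) \<le> (\<Sum>i\<in>(UNIV :: 'n set). card (A z i \<union> A v i))"
    by (rule card_UN_le) simp
  also have "\<dots> \<le> (\<Sum>i\<in>(UNIV :: 'n set). 2)"
  proof (rule sum_mono)
    fix i show "card (A z i \<union> A v i) \<le> 2" using card_Un_le[of "A z i" "A v i"] one[OF z, of i] one[OF v, of i] by linarith
  qed
  also have "\<dots> < card J" by (simp add: J_def)
  finally have "\<not> J \<subseteq> (\<Union>i\<in>UNIV. A z i \<union> A v i)"
    using card_mono[of "\<Union>i\<in>UNIV. A z i \<union> A v i" J] fin by auto
  then obtain j where "j \<in> J" "\<And>i. j \<notin> A z i" "\<And>i. j \<notin> A v i" by blast
  then show ?thesis by (intro bexI[of _ j]) (auto simp: A_def not_less)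
qed

lemma uniform_multiple:
  fixes l :: "'n \<Rightarrow> real"
  assumes "\<And>i. 0 < l i" shows "\<exists>N::nat. \<forall>i::'n. (c::real) \<le> real N * l i"
proof -
  have "\<exists>m::nat. c < real m * l i" for i using ex_less_of_nat_mult[OF assms] by blast
  then obtain m where m: "\<And>i. c < real (m i) * l i" by metis
  have "c \<le> real (\<Sum>i\<in>UNIV. m i) * l i" for i
  proof -
    have "m i \<le> (\<Sum>i\<in>UNIV. m i)" by (rule member_le_sum) auto
    then have "real (m i) * l i \<le> real (\<Sum>i\<in>UNIV. m i) * l i"
      using assms by (intro mult_right_mono) (auto simp: less_imp_le simp del: of_nat_sum)
    then show ?thesis using m[of i] by linarith
  qed
  then show ?thesis by blast
qed

lemma translate_displacement:
  assumes fam: "good_family b Q l F" and j: "j \<in> J"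
  shows "\<bar>dd i (x i) (F j N i (x i)) - real N * l i\<bar> \<le> 2 * Q"
proof -
  have "CN_space.contracting (X i) (b j i) Q" using fam j by (simp add: good_family_def)
  then have line: "geodesic_line (X i) (b j i)" by (rule CN_space.contracting_line[OF CN_factor])
  have E: "dd i (x i) (b j i 0) \<le> Q" and l: "0 < l i"
    and F: "F j N \<in> \<Gamma>" and Fb: "F j N i (b j i 0) = b j i (0 + real N * l i)"
    using fam j by (auto simp: good_family_def)
  note Fi = comp_isom[OF F, of i]
  have S: "b j i t \<in> mspace (X i)" for t using line by (auto simp: geodesic_line_def)
  have Fx: "F j N i (x i) \<in> mspace (X i)" by (rule CN_space.isom_in[OF CN_factor Fi xS])
  have "dd i (F j N i (b j i 0)) (F j N i (x i)) = dd i (b j i 0) (x i)" by (rule CN_space.isom_d[OF CN_factor Fi S xS])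
  then have 1: "dd i (b j i (real N * l i)) (F j N i (x i)) \<le> Q" using E Fb by (simp add: mdist_commute)
  have 2: "dd i (b j i 0) (b j i (real N * l i)) = real N * l i" using line l by (simp add: geodesic_line_def)
  have "dd i (x i) (F j N i (x i)) \<le> dd i (x i) (b j i 0) + (dd i (b j i 0) (b j i (real N * l i)) + dd i (b j i (real N * l i)) (F j N i (x i)))"
    using mdist_triangle[OF xS S Fx, of 0] mdist_triangle[OF S S Fx, of 0 "real N * l i"] by simp
  moreover have "dd i (b j i 0) (b j i (real N * l i)) \<le> dd i (b j i 0) (x i) + (dd i (x i) (F j N i (x i)) + dd i (F j N i (x i)) (b j i (real N * l i)))"
    using mdist_triangle[OF S xS S, of 0 "real N * l i"] mdist_triangle[OF xS Fx S, of "real N * l i"] by simp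
  ultimately show ?thesis using 1 2 E by (simp add: mdist_commute abs_le_iff)
qed

text \<open>In each factor the displacement of \<open>\<gamma> F \<gamma>'\<close> is the distance
  from \<open>\<gamma>^-1 x\<close> to \<open>F \<gamma>' x\<close>. A line on which
  \<open>\<gamma>^-1 x\<close> and \<open>\<gamma>' x\<close> project centrally in all factors makes
  \<open>dist_across_line\<close> applicable.\<close>

lemma displacement_additive:
  assumes g: "g \<in> \<Gamma>" and h: "h \<in> \<Gamma>" and ind: "independent_regular_axial X g h"
  shows "\<exists>C. \<forall>\<gamma>\<in>\<Gamma>. \<forall>\<gamma>'\<in>\<Gamma>. \<exists>\<delta>\<in>\<Gamma>. \<forall>i. \<bar>disp \<delta> $ i - (disp \<gamma> $ i + disp \<gamma>' $ i)\<bar> \<le> C"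
proof -
  obtain b Q l F where fam: "good_family b Q l F" using good_family_ex[OF assms] by blast
  have Q: "0 < Q" and l: "\<And>i. 0 < l i" using fam by (auto simp: good_family_def)
  obtain N where N: "\<And>i. 3 * Q \<le> real N * l i" using uniform_multiple[of l "3 * Q"] l by blast
  define W where "W = (\<Sum>i\<in>UNIV. real N * l i)"
  have W: "real N * l i \<le> W" for i unfolding W_def using l by (intro member_le_sum) (auto simp: less_imp_le)
  show ?thesis
  proof (intro exI[of _ "6 * Q + W"] ballI)
    fix \<gamma> \<gamma>' assume \<gamma>: "\<gamma> \<in> \<Gamma>" and \<gamma>': "\<gamma>' \<in> \<Gamma>"
    define z where "z i = (inv\<^bsub>G i\<^esub> (\<gamma> i)) (x i)" for i
    define v where "v i = \<gamma>' i (x i)" for i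
    have z: "z i \<in> mspace (X i)" for i
      unfolding z_def by (rule CN_space.isom_in[OF CN_factor CN_space.isom_inv[OF CN_factor comp_isom[OF \<gamma>]] xS])
    have v: "v i \<in> mspace (X i)" for i unfolding v_def by (rule CN_space.isom_in[OF CN_factor comp_isom[OF \<gamma>'] xS])
    obtain j where j: "j \<in> J" and pz: "\<And>i. \<bar>CN_space.prj (X i) (b j i) (z i)\<bar> \<le> Q"
      and pv: "\<And>i. \<bar>CN_space.prj (X i) (b j i) (v i)\<bar> \<le> Q" using good_index[OF fam z v] by blast
    let ?F = "F j N"
    have F: "?F \<in> \<Gamma>" and Fb: "\<And>i t. ?F i (b j i t) = b j i (t + real N * l i)" using fam by (auto simp: good_family_def)
    have c: "CN_space.contracting (X i) (b j i) Q" and E: "dd i (x i) (b j i 0) \<le> Q" for i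
      using fam j by (auto simp: good_family_def)
    obtain q where q: "q \<in> \<Gamma>" "\<And>i. q i = ?F i \<otimes>\<^bsub>G i\<^esub> \<gamma>' i" using mult_ex[OF F \<gamma>'] by blast
    obtain \<delta> where \<delta>: "\<delta> \<in> \<Gamma>" "\<And>i. \<delta> i = \<gamma> i \<otimes>\<^bsub>G i\<^esub> q i" using mult_ex[OF \<gamma> q(1)] by blast
    have "\<bar>disp \<delta> $ i - (disp \<gamma> $ i + disp \<gamma>' $ i)\<bar> \<le> 6 * Q + W" for i
    proof -
      note ci = comp_isom[OF \<gamma>, of i] and Fi = comp_isom[OF F, of i]
      have Fv: "?F i (v i) \<in> mspace (X i)" by (rule CN_space.isom_in[OF CN_factor Fi v])
      have Fx: "?F i (x i) \<in> mspace (X i)" by (rule CN_space.isom_in[OF CN_factor Fi xS])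
      have "q i (x i) = ?F i (v i)"
        unfolding q(2) v_def by (rule CN_space.isom_mult_app[OF CN_factor Fi comp_isom[OF \<gamma>'] xS])
      then have "\<delta> i (x i) = \<gamma> i (?F i (v i))"
        using CN_space.isom_mult_app[OF CN_factor ci comp_isom[OF q(1)] xS] by (simp add: \<delta>(2))
      moreover have gz: "\<gamma> i (z i) = x i" unfolding z_def by (rule CN_space.isom_inv_app(2)[OF CN_factor ci xS])
      ultimately have d1: "disp \<delta> $ i = dd i (z i) (?F i (v i))"
        using CN_space.isom_d[OF CN_factor ci z Fv] by (simp add: disp_nth)
      have d2: "disp \<gamma> $ i = dd i (z i) (x i)" using CN_space.isom_d[OF CN_factor ci z xS] gz by (simp add: disp_nth)
      have d3: "disp \<gamma>' $ i = dd i (x i) (v i)" by (simp add: disp_nth v_def)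
      have lo: "dd i (z i) (x i) + dd i (x i) (v i) - (6 * Q + real N * l i) \<le> dd i (z i) (?F i (v i))"
        by (rule CN_space.dist_across_line[OF CN_factor c Fi Fb z v xS pz pv E N])
      have "dd i (?F i (x i)) (?F i (v i)) = dd i (x i) (v i)" by (rule CN_space.isom_d[OF CN_factor Fi xS v])
      then have "dd i (z i) (?F i (v i)) \<le> dd i (z i) (x i) + (dd i (x i) (?F i (x i)) + dd i (x i) (v i))"
        using mdist_triangle[OF z xS Fv] mdist_triangle[OF xS Fx Fv] by simp
      moreover have "dd i (x i) (?F i (x i)) \<le> 2 * Q + real N * l i"
        using translate_displacement[OF fam j, of i N] by linarith
      ultimately show ?thesis using lo W[of i] Q unfolding d1 d2 d3 by (simp add: abs_le_iff)
    qed
    then show "\<exists>\<delta>\<in>\<Gamma>. \<forall>i. \<bar>disp \<delta> $ i - (disp \<gamma> $ i + disp \<gamma>' $ i)\<bar> \<le> 6 * Q + W" using \<delta>(1) by blast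
  qed
qed

text \<open>\<open>translate_rank_one\<close> needs a large displacement in every factor, which an
  arbitrary element lacks. So it is combined, by \<open>displacement_additive\<close>, with a fixed
  long translation \<open>\<psi>\<close>, at bounded cost.\<close>

lemma near_regular_axial:
  assumes g: "g \<in> \<Gamma>" and h: "h \<in> \<Gamma>" and ind: "independent_regular_axial X g h"
  shows "\<exists>C. \<forall>\<gamma>\<in>\<Gamma>. \<exists>\<delta>\<in>\<Gamma>. regular_axial X \<delta> \<and> (\<forall>i. \<bar>translation_vector X \<delta> $ i - disp \<gamma> $ i\<bar> \<le> C)"
proof -
  obtain b Q l F where fam: "good_family b Q l F" using good_family_ex[OF assms] by blast
  have Q: "0 < Q" and l: "\<And>i. 0 < l i" using fam by (auto simp: good_family_def)
  obtain N where N: "\<And>i. 9 * Q + 1 \<le> real N * l i" using uniform_multiple[of l "9 * Q + 1"] l by blast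
  define W where "W = (\<Sum>i\<in>UNIV. real N * l i)"
  have W: "real N * l i \<le> W" for i unfolding W_def using l by (intro member_le_sum) (auto simp: less_imp_le)
  obtain C where C: "\<And>\<gamma> \<gamma>'. \<gamma> \<in> \<Gamma> \<Longrightarrow> \<gamma>' \<in> \<Gamma> \<Longrightarrow> \<exists>\<delta>\<in>\<Gamma>. \<forall>i. \<bar>disp \<delta> $ i - (disp \<gamma> $ i + disp \<gamma>' $ i)\<bar> \<le> C"
    using displacement_additive[OF assms] by blast
  \<comment> \<open>\<open>translate_displacement\<close> loses \<open>2 * Q\<close> and additivity
    loses \<open>C\<close>; what remains is \<open>11 * Q\<close>, more than the required
    \<open>10 * Q\<close>.\<close>
  obtain K where K: "\<And>i. C + 13 * Q \<le> real K * l i" using uniform_multiple[of l "C + 13 * Q"] l by blast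
  have 0: "0 \<in> J" by (simp add: J_def)
  define \<psi> where "\<psi> = F 0 K"
  have \<psi>: "\<psi> \<in> \<Gamma>" using fam by (auto simp: good_family_def \<psi>_def)
  have \<psi>C: "C + 11 * Q \<le> disp \<psi> $ i" for i
    using translate_displacement[OF fam 0, of i K] K[of i] by (simp add: disp_nth \<psi>_def)
  define V where "V = (\<Sum>i\<in>UNIV. disp \<psi> $ i)"
  have V: "disp \<psi> $ i \<le> V" for i unfolding V_def by (intro member_le_sum) (auto simp: disp_nonneg)
  show ?thesis
  proof (intro exI[of _ "12 * Q + W + V + C"] ballI)
    fix \<gamma>0 assume "\<gamma>0 \<in> \<Gamma>"
    then obtain \<gamma> where \<gamma>: "\<gamma> \<in> \<Gamma>" and \<gamma>0: "\<And>i. \<bar>disp \<gamma> $ i - (disp \<gamma>0 $ i + disp \<psi> $ i)\<bar> \<le> C"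
      using C[OF _ \<psi>] by blast
    have far: "10 * Q < disp \<gamma> $ i" for i
      using \<gamma>0[of i] \<psi>C[of i] disp_nonneg[of \<gamma>0 i] Q by linarith
    define z where "z i = (inv\<^bsub>G i\<^esub> (\<gamma> i)) (x i)" for i
    define v where "v i = \<gamma> i (x i)" for i
    have z: "z i \<in> mspace (X i)" for i
      unfolding z_def by (rule CN_space.isom_in[OF CN_factor CN_space.isom_inv[OF CN_factor comp_isom[OF \<gamma>]] xS])
    have v: "v i \<in> mspace (X i)" for i unfolding v_def by (rule CN_space.isom_in[OF CN_factor comp_isom[OF \<gamma>] xS])
    obtain j where j: "j \<in> J" and pz: "\<And>i. \<bar>CN_space.prj (X i) (b j i) (z i)\<bar> \<le> Q"
      and pv: "\<And>i. \<bar>CN_space.prj (X i) (b j i) (v i)\<bar> \<le> Q" using good_index[OF fam z v] by blast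
    have F: "F j N \<in> \<Gamma>" and Fb: "\<And>i t. F j N i (b j i t) = b j i (t + real N * l i)" using fam by (auto simp: good_family_def)
    have c: "CN_space.contracting (X i) (b j i) Q" and E: "dd i (x i) (b j i 0) \<le> Q" for i
      using fam j by (auto simp: good_family_def)
    obtain \<delta> where \<delta>: "\<delta> \<in> \<Gamma>" "\<And>i. \<delta> i = \<gamma> i \<otimes>\<^bsub>G i\<^esub> F j N i" using mult_ex[OF \<gamma> F] by blast
    note r = CN_space.translate_rank_one[OF CN_factor c comp_isom[OF F] Fb comp_isom[OF \<gamma>] xS
        pv[unfolded v_def] pz[unfolded z_def] E N far[unfolded disp_nth]]
    have "regular_axial X \<delta>" using r(1) by (simp add: regular_axial_def \<delta>(2))
    moreover have "\<bar>translation_vector X \<delta> $ i - disp \<gamma>0 $ i\<bar> \<le> 12 * Q + W + V + C" for i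
    proof -
      have "\<bar>translation_vector X \<delta> $ i - disp \<gamma> $ i\<bar> \<le> 12 * Q + real N * l i"
        using r(2)[of i] by (simp add: translation_vector_def \<delta>(2) disp_nth)
      then show ?thesis using \<gamma>0[of i] V[of i] W[of i] disp_nonneg[of \<psi> i] by linarith
    qed
    ultimately show "\<exists>\<delta>\<in>\<Gamma>. regular_axial X \<delta> \<and> (\<forall>i. \<bar>translation_vector X \<delta> $ i - disp \<gamma>0 $ i\<bar> \<le> 12 * Q + W + V + C)"
      using \<delta>(1) by blast
  qed
qed

end

section \<open>Slopes of limit points\<close>

context CN_space
begin

lemma ray_limit:
  assumes p: "p \<in> S" and y: "\<And>n. y n \<in> S" and inf: "filterlim (\<lambda>n. d p (y n)) at_top ufil"
  shows "\<exists>s. geodesic_ray M s \<and> s 0 = p \<and> (\<forall>t\<ge>0. uconv (\<lambda>n. pt p (y n) (t / d p (y n))) (s t))"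
proof -
  define c where "c n t = pt p (y n) (t / d p (y n))" for n t
  have ev: "eventually (\<lambda>n. 0 < d p (y n) \<and> 0 \<le> t / d p (y n) \<and> t / d p (y n) \<le> 1) ufil" if "0 \<le> t" for t
  proof -
    have "eventually (\<lambda>n. t + 1 \<le> d p (y n)) ufil" using inf by (simp add: filterlim_at_top)
    then show ?thesis
    proof (rule eventually_mono)
      fix n assume "t + 1 \<le> d p (y n)"
      then have "0 < d p (y n)" "t \<le> d p (y n)" using that by linarith+
      then show "0 < d p (y n) \<and> 0 \<le> t / d p (y n) \<and> t / d p (y n) \<le> 1"
        using that by (simp only: divide_le_eq_1_pos) simp
    qed
  qed
  have "\<exists>z. uconv (\<lambda>n. c n t) z" if t: "0 \<le> t" for t
  proof (rule uconv_bounded[OF p, of _ t])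
    show "eventually (\<lambda>n. c n t \<in> S \<and> d p (c n t) \<le> t) ufil"
      using ev[OF t]
    proof (rule eventually_mono)
      fix n assume "0 < d p (y n) \<and> 0 \<le> t / d p (y n) \<and> t / d p (y n) \<le> 1"
      then have *: "0 < d p (y n)" "0 \<le> t / d p (y n)" "t / d p (y n) \<le> 1" by auto
      have "c n t \<in> S" unfolding c_def by (rule pt_in[OF p y *(2,3)])
      moreover have "d p (c n t) = t / d p (y n) * d p (y n)" unfolding c_def by (rule d_pt_simps(1)[OF p y *(2,3)])
      ultimately show "c n t \<in> S \<and> d p (c n t) \<le> t" using *(1) by simp
    qed
  qed
  then obtain s where s: "\<And>t. 0 \<le> t \<Longrightarrow> uconv (\<lambda>n. c n t) (s t)" by metis
  have "d (s t) (s u) = \<bar>t - u\<bar>" if t: "0 \<le> t" and u: "0 \<le> u" for t u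
  proof (rule uconv_eq[OF s[OF t] s[OF u]], rule tendsto_eventually)
    show "eventually (\<lambda>n. d (c n t) (c n u) = \<bar>t - u\<bar>) ufil"
      using ev[OF t] ev[OF u]
    proof eventually_elim
      case (elim n)
      then have "d (c n t) (c n u) = \<bar>t / d p (y n) - u / d p (y n)\<bar> * d p (y n)"
        unfolding c_def using p y by (intro d_pt_pt) auto
      also have "t / d p (y n) - u / d p (y n) = (t - u) / d p (y n)" by (simp add: diff_divide_distrib)
      also have "\<bar>(t - u) / d p (y n)\<bar> * d p (y n) = \<bar>t - u\<bar>"
      proof -
        have "\<bar>a / P\<bar> * P = \<bar>a\<bar>" if "0 < P" for a P :: real using that by simp
        then show ?thesis using elim by blast
      qed
      finally show ?case .
    qed
  qed
  moreover have "s ` {0..} \<subseteq> S" using uconv_in[OF s] by auto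
  ultimately have "geodesic_ray M s" by (auto simp: geodesic_ray_def)
  moreover have "s 0 = p"
  proof (rule uconv_unique[OF s])
    show "uconv (\<lambda>n. c n 0) p" unfolding c_def using p y by (simp add: uconv_const)
  qed simp
  ultimately show ?thesis using s by (auto simp: c_def)
qed

lemma ray_pt:
  assumes s: "geodesic_ray M s" and t: "0 \<le> t" "t \<le> T" "0 < T"
  shows "s t = pt (s 0) (s T) (t / T)"
proof (rule pt_unique)
  have D: "d (s u) (s v) = \<bar>u - v\<bar>" if "0 \<le> u" "0 \<le> v" for u v using s that by (auto simp: geodesic_ray_def)
  show "s 0 \<in> S" "s T \<in> S" "s t \<in> S" using s t by (auto simp: geodesic_ray_def)
  show "0 \<le> t / T" "t / T \<le> 1" using t by auto
  show "d (s 0) (s t) = t / T * d (s 0) (s T)" "d (s t) (s T) = (1 - t / T) * d (s 0) (s T)"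
    using t by (simp_all add: D left_diff_distrib)
qed

text \<open>By convexity the distance at \<open>t\<close> is at most the fraction
  \<open>t / T\<close> of the distance at \<open>T\<close>, which stays bounded.\<close>

lemma asymptotic_rays_eq:
  assumes s: "geodesic_ray M s" and r: "geodesic_ray M r" and 0: "s 0 = r 0"
    and K: "\<And>t. 0 \<le> t \<Longrightarrow> d (s t) (r t) \<le> K" and t: "0 \<le> t"
  shows "s t = r t"
proof -
  have S: "u \<ge> 0 \<Longrightarrow> s u \<in> S" "u \<ge> 0 \<Longrightarrow> r u \<in> S" for u using s r by (auto simp: geodesic_ray_def)
  have "d (s t) (r t) \<le> 0"
  proof (rule real_le_if_le_add_scaled)
    fix e :: real assume e: "0 < e" "e \<le> 1"
    \<comment> \<open>\<open>t + 1\<close> instead of \<open>t\<close> keeps \<open>T\<close>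
      positive for \<open>t = 0\<close>.\<close>
    define T where "T = (t + 1) / e"
    have T: "0 < T" "t \<le> T" "t / T \<le> e"
    proof -
      show "0 < T" using t e by (simp add: T_def)
      show "t \<le> T" unfolding T_def using t e by (simp add: pos_le_divide_eq mult_left_le add.commute add_increasing)
      have "t / T = e * (t / (t + 1))" by (simp add: T_def)
      also have "\<dots> \<le> e * 1" using t e by (intro mult_left_mono) auto
      finally show "t / T \<le> e" by simp
    qed
    have "d (s t) (r t) = d (pt (s 0) (s T) (t / T)) (pt (s 0) (r T) (t / T))"
      using ray_pt[OF s t T(2,1)] ray_pt[OF r t T(2,1)] 0 by simp
    also have "\<dots> \<le> t / T * d (s T) (r T)" using S T t by (intro pt_common_start_dist) auto
    also have "\<dots> \<le> e * d (s T) (r T)" using T by (intro mult_right_mono) auto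
    also have "\<dots> \<le> e * K" using e K[of T] T by (intro mult_left_mono) auto
    finally show "d (s t) (r t) \<le> 0 + e * K" by simp
  qed
  then show ?thesis using S[OF t] mdist_nonneg[of M "s t" "r t"] by simp
qed

text \<open>Convergence in the cone topology does not depend on the base point: the limit of the segments from
  another base point is the asymptotic ray.\<close>

lemma eventually_cone_nbhd:
  assumes p: "p \<in> S" and y: "\<And>n. y n \<in> S" and inf: "filterlim (\<lambda>n. d p (y n)) at_top ufil"
    and s: "geodesic_ray M s" and lim: "\<And>t. 0 \<le> t \<Longrightarrow> uconv (\<lambda>n. pt p (y n) (t / d p (y n))) (s t)"
    and c: "geodesic_ray M c" and R: "0 < R" and \<xi>: "Inr (ray_endpoint M s) \<in> cone_nbhd M c R e"
  shows "eventually (\<lambda>n. Inl (y n) \<in> cone_nbhd M c R e) ufil"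
proof -
  obtain g where g: "g \<in> ray_endpoint M s" "g 0 = c 0" "d (g R) (c R) < e" using \<xi> by (auto simp: cone_nbhd_def)
  obtain K where gr: "geodesic_ray M g" and K: "\<And>t. 0 \<le> t \<Longrightarrow> d (s t) (g t) \<le> K"
    using g(1) by (auto simp: ray_endpoint_def asymptotic_rel_def)
  define q where "q = c 0"
  have q: "q \<in> S" using c by (auto simp: q_def geodesic_ray_def)
  have sS: "0 \<le> t \<Longrightarrow> s t \<in> S" and gS: "0 \<le> t \<Longrightarrow> g t \<in> S" and cS: "0 \<le> t \<Longrightarrow> c t \<in> S" for t
    using s gr c by (auto simp: geodesic_ray_def)
  have infq: "filterlim (\<lambda>n. d q (y n)) at_top ufil"
  proof (rule filterlim_at_top_mono)
    show "filterlim (\<lambda>n. (- d p q) + d p (y n)) at_top ufil"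
      by (rule filterlim_tendsto_add_at_top[OF tendsto_const inf])
    have "- d p q + d p (y n) \<le> d q (y n)" for n using tri[OF p q y, of n] by simp
    then show "eventually (\<lambda>n. - d p q + d p (y n) \<le> d q (y n)) ufil" by simp
  qed
  obtain g' where g': "geodesic_ray M g'" "g' 0 = q"
    and lim': "\<And>t. 0 \<le> t \<Longrightarrow> uconv (\<lambda>n. pt q (y n) (t / d q (y n))) (g' t)"
    using ray_limit[OF q y infq] by blast
  have g'S: "0 \<le> t \<Longrightarrow> g' t \<in> S" for t using g'(1) by (auto simp: geodesic_ray_def)
  have "d (g' t) (s t) \<le> 2 * d q p" if t: "0 \<le> t" for t
  proof (rule uconv_le[OF lim'[OF t] lim[OF t] tendsto_const])
    have "eventually (\<lambda>n. t + 1 \<le> d p (y n)) ufil" "eventually (\<lambda>n. t + 1 \<le> d q (y n)) ufil"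
      using inf infq by (simp_all add: filterlim_at_top)
    then show "eventually (\<lambda>n. d (pt q (y n) (t / d q (y n))) (pt p (y n) (t / d p (y n))) \<le> 2 * d q p) ufil"
    proof eventually_elim
      case (elim n)
      then show ?case using t p q y by (intro fan_distance) auto
    qed
  qed
  then have bd: "d (g' t) (g t) \<le> 2 * d q p + K" if t: "0 \<le> t" for t
    using tri[OF g'S[OF t] sS[OF t] gS[OF t]] K[OF t] t by force
  have "g' R = g R"
    by (rule asymptotic_rays_eq[OF g'(1) gr _ bd]) (use g'(2) g(2) R in \<open>simp_all add: q_def\<close>)
  then have lr: "uconv (\<lambda>n. pt q (y n) (R / d q (y n))) (g R)" using lim'[of R] R by simp
  then have "((\<lambda>n. d (pt q (y n) (R / d q (y n))) (g R)) \<longlongrightarrow> 0) ufil" by (simp add: uconv_def)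
  then have "eventually (\<lambda>n. d (pt q (y n) (R / d q (y n))) (g R) < e - d (g R) (c R)) ufil"
    by (rule order_tendstoD) (use g in simp)
  moreover have "eventually (\<lambda>n. R + 1 \<le> d q (y n)) ufil" using infq by (simp add: filterlim_at_top)
  moreover have "eventually (\<lambda>n. pt q (y n) (R / d q (y n)) \<in> S) ufil" using lr by (simp add: uconv_def)
  ultimately show ?thesis
  proof eventually_elim
    case (elim n)
    have "d (pt q (y n) (R / d q (y n))) (c R) < e"
      using tri[OF elim(3) gS[of R] cS[of R]] R elim(1) by simp
    moreover have "geodesic_segment M q (y n) (\<lambda>s. pt q (y n) (s / d q (y n)))" by (rule pt_seg[OF q y])
    moreover have "R < d q (y n)" using elim(2) by simp
    ultimately show ?case using y unfolding cone_nbhd_def q_def by blast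
  qed
qed

text \<open>Neighbourhoods are treated by induction over the generated topology: containing the
  sequence along the ultrafilter survives finite intersections and unions, balls contain no boundary
  point, and \<open>eventually_cone_nbhd\<close> handles the remaining generators.\<close>

lemma limit_in_closure:
  assumes p: "p \<in> S" and y: "\<And>n. y n \<in> S" and inf: "filterlim (\<lambda>n. d p (y n)) at_top ufil"
    and s: "geodesic_ray M s" and lim: "\<And>t. 0 \<le> t \<Longrightarrow> uconv (\<lambda>n. pt p (y n) (t / d p (y n))) (s t)"
    and A: "\<And>n. y n \<in> A"
  shows "Inr (ray_endpoint M s) \<in> cone_topology M closure_of (Inl ` A)"
proof -
  let ?\<xi> = "ray_endpoint M s"
  have ss: "s \<in> ?\<xi>"
    using equiv_class_self[OF equiv_asymptotic_rel] s by (simp add: ray_endpoint_def)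
  have gb: "?\<xi> \<in> geometric_boundary M"
    using s by (auto simp: geometric_boundary_def ray_endpoint_def quotient_def)
  have sS: "s 1 \<in> S" using s by (auto simp: geodesic_ray_def)
  have in1: "Inr ?\<xi> \<in> cone_nbhd M s 1 1"
    using ss gb sS by (auto simp: cone_nbhd_def intro!: bexI[of _ s])
  have top: "Inr ?\<xi> \<in> topspace (cone_topology M)"
    unfolding cone_topology_def topology_generated_by_topspace using in1 s by (blast intro: zero_less_one)
  have ev: "eventually (\<lambda>n. Inl (y n) \<in> T) ufil"
    if "generate_topology_on ({Inl ` {y \<in> S. d x y < e} |x e. x \<in> S} \<union>
      {cone_nbhd M c R e |c R e. geodesic_ray M c \<and> R > 0 \<and> e > 0}) T" "Inr ?\<xi> \<in> T" for T
    using that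
  proof (induction rule: generate_topology_on.induct)
    case (Int a b)
    then show ?case by (auto intro: eventually_elim2)
  next
    case (UN K)
    then obtain k where k: "k \<in> K" "Inr ?\<xi> \<in> k" by blast
    then have "eventually (\<lambda>n. Inl (y n) \<in> k) ufil" using UN by blast
    then show ?case by (rule eventually_mono) (use k in blast)
  next
    case (Basis b)
    then consider x e where "b = Inl ` {y \<in> S. d x y < e}"
      | c R e where "b = cone_nbhd M c R e" "geodesic_ray M c" "R > 0" "e > 0" by blast
    then show ?case
    proof cases
      case 1 then show ?thesis using Basis by auto
    next
      case 2
      then show ?thesis using eventually_cone_nbhd[OF p y inf s lim 2(2,3)] Basis by blast
    qed
  qed simp
  show ?thesis
    unfolding in_closure_of
  proof (intro conjI top allI impI)
    fix T assume T: "Inr ?\<xi> \<in> T \<and> openin (cone_topology M) T"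
    then have "eventually (\<lambda>n. Inl (y n) \<in> T) ufil"
      unfolding cone_topology_def openin_topology_generated_by_iff using ev by blast
    then obtain n where "Inl (y n) \<in> T" using eventually_happens'[OF ufil(2)] by blast
    then show "\<exists>z. z \<in> Inl ` A \<and> z \<in> T" using A by blast
  qed
qed

end

section \<open>Distance vectors and their directions\<close>

lemma norm_sgn_diff_le:
  fixes a b :: "'v::real_normed_vector"
  assumes a: "a \<noteq> 0" and b: "b \<noteq> 0"
  shows "norm (sgn a - sgn b) \<le> 2 * norm (a - b) / norm b"
proof -
  have "sgn a - sgn b = (a - b) /\<^sub>R norm b + (inverse (norm a) - inverse (norm b)) *\<^sub>R a"
    by (simp add: sgn_div_norm algebra_simps)
  then have "norm (sgn a - sgn b) \<le> norm ((a - b) /\<^sub>R norm b) + norm ((inverse (norm a) - inverse (norm b)) *\<^sub>R a)"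
    using norm_triangle_ineq by metis
  also have "norm ((a - b) /\<^sub>R norm b) = norm (a - b) / norm b" by (simp add: divide_inverse)
  also have "norm ((inverse (norm a) - inverse (norm b)) *\<^sub>R a) = \<bar>norm b - norm a\<bar> / norm b"
  proof -
    have *: "\<bar>inverse u - inverse v\<bar> * u = \<bar>v - u\<bar> / v" if "0 < u" "0 < v" for u v :: real
    proof -
      have "inverse u - inverse v = (v - u) / (u * v)" using that by (simp add: divide_simps)
      then show ?thesis using that by (simp add: abs_mult)
    qed
    show ?thesis using *[of "norm a" "norm b"] a b by simp
  qed
  also have "\<bar>norm b - norm a\<bar> / norm b \<le> norm (a - b) / norm b"
    using norm_triangle_ineq3[of b a] by (intro divide_right_mono) (auto simp: norm_minus_commute)
  finally show ?thesis by simp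
qed

lemma norm_le_coord:
  fixes v :: "real ^ 'n::finite"
  assumes "\<And>i. \<bar>v $ i\<bar> \<le> C"
  shows "norm v \<le> real CARD('n) * C"
proof -
  have "norm v \<le> (\<Sum>i\<in>UNIV. \<bar>v $ i\<bar>)" by (rule norm_le_l1_cart)
  also have "\<dots> \<le> (\<Sum>i\<in>(UNIV::'n set). C)" by (intro sum_mono assms)
  finally show ?thesis by simp
qed

definition dist_vec :: "('n::finite \<Rightarrow> 'a metric) \<Rightarrow> ('n \<Rightarrow> 'a) \<Rightarrow> ('n \<Rightarrow> 'a) \<Rightarrow> real ^ 'n" where
  "dist_vec X p q = (\<chi> i. mdist (X i) (p i) (q i))"

lemma dist_vec_nth [simp]: "dist_vec X p q $ i = mdist (X i) (p i) (q i)"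
  by (simp add: dist_vec_def)

lemma norm_dist_vec: "norm (dist_vec X p q) = mdist (L2_metric X) p q"
  by (simp add: norm_vec_def mdist_L2_metric)

text \<open>Equality in Minkowski's inequality forces the distances in the factors to grow proportionally
  along a geodesic of the product.\<close>

lemma dist_vec_geodesic:
  fixes X :: "'n::finite \<Rightarrow> 'a metric"
  assumes S: "p \<in> mspace (L2_metric X)" "m \<in> mspace (L2_metric X)" "q \<in> mspace (L2_metric X)"
    and add: "mdist (L2_metric X) p m + mdist (L2_metric X) m q = mdist (L2_metric X) p q"
  shows "mdist (L2_metric X) p q *\<^sub>R dist_vec X p m = mdist (L2_metric X) p m *\<^sub>R dist_vec X p q"
    and "mdist (L2_metric X) p q *\<^sub>R dist_vec X m q = mdist (L2_metric X) m q *\<^sub>R dist_vec X p q"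
proof -
  let ?u = "dist_vec X p m" and ?v = "dist_vec X m q" and ?w = "dist_vec X p q"
  have le: "?w $ i \<le> (?u + ?v) $ i" for i using S by (simp add: mdist_triangle)
  have nn: "0 \<le> ?w $ i" for i by simp
  have add': "norm ?u + norm ?v = norm ?w" using add by (simp add: norm_dist_vec)
  have "norm ?w \<le> norm (?u + ?v)" by (rule norm_le_componentwise_cart) (use le nn in \<open>auto simp: abs_of_nonneg\<close>)
  then have eq: "norm (?u + ?v) = norm ?u + norm ?v" and eqw: "norm (?u + ?v) = norm ?w"
    using norm_triangle_ineq[of ?u ?v] add' by linarith+
  have "(\<Sum>i\<in>UNIV. ((?u + ?v) $ i)\<^sup>2 - (?w $ i)\<^sup>2) = (norm (?u + ?v))\<^sup>2 - (norm ?w)\<^sup>2"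
    by (simp add: sum_subtractf norm_vec_def L2_set_def sum_nonneg)
  then have z: "(\<Sum>i\<in>UNIV. ((?u + ?v) $ i)\<^sup>2 - (?w $ i)\<^sup>2) = 0" using eqw by simp
  have "\<forall>i\<in>UNIV. ((?u + ?v) $ i)\<^sup>2 - (?w $ i)\<^sup>2 = 0"
    using z le nn by (subst (asm) sum_nonneg_eq_0_iff) (auto intro: power_mono)
  then have "((?u + ?v) $ i)\<^sup>2 = (?w $ i)\<^sup>2" for i by simp
  then have "(?u + ?v) $ i = ?w $ i" for i
    using nn[of i] le[of i] by (metis order_trans power2_eq_imp_eq)
  then have w: "?w = ?u + ?v" by (simp add: vec_eq_iff)
  have par: "norm ?u *\<^sub>R ?v = norm ?v *\<^sub>R ?u" using eq by (simp add: norm_triangle_eq)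
  have nw: "norm ?w = norm ?u + norm ?v" using add' by simp
  have "norm ?w *\<^sub>R ?u = norm ?u *\<^sub>R ?w" unfolding nw unfolding w by (simp add: scaleR_add_left scaleR_add_right par)
  then show "mdist (L2_metric X) p q *\<^sub>R ?u = mdist (L2_metric X) p m *\<^sub>R ?w" by (simp add: norm_dist_vec)
  have "norm ?w *\<^sub>R ?v = norm ?v *\<^sub>R ?w" unfolding nw unfolding w by (simp add: scaleR_add_left scaleR_add_right par)
  then show "mdist (L2_metric X) p q *\<^sub>R ?v = mdist (L2_metric X) m q *\<^sub>R ?w" by (simp add: norm_dist_vec)
qed

context product_space_action
begin

abbreviation P where "P \<equiv> L2_metric X"

lemma CN_P: "CN_space P" by (rule L2_CN_space[OF CN_factor])
lemma xP: "x \<in> mspace P" using xS by simp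
lemma act_P: "\<gamma> \<in> \<Gamma> \<Longrightarrow> product_action \<gamma> x \<in> mspace P"
  using CN_space.isom_in[OF CN_factor comp_isom xS] by (simp add: product_action_def)
lemma disp_dist_vec: "disp \<gamma> = dist_vec X x (product_action \<gamma> x)"
  by (simp add: vec_eq_iff disp_nth product_action_def)
lemma norm_disp: "norm (disp \<gamma>) = mdist P x (product_action \<gamma> x)"
  by (simp add: disp_dist_vec norm_dist_vec)

text \<open>The middle term of the comparison: related to slopes of limit points by the geometry of
  the product, and to the limit cone by the group.\<close>

definition asymptotic_directions :: "(real ^ 'n) set" where
  "asymptotic_directions = {\<theta> \<in> slope_sphere. \<forall>N. \<forall>e>0. \<exists>\<gamma>\<in>\<Gamma>. N < norm (disp \<gamma>) \<and> norm (sgn (disp \<gamma>) - \<theta>) < e}"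

text \<open>An orbit point \<open>y\<close> in a cone neighbourhood of the ray \<open>s\<close> is
  reached by a segment passing within \<open>1\<close> of \<open>s R\<close>. Distances in the
  factors grow proportionally along the segment, so its direction differs from
  \<open>\<theta>\<close> by an error of order \<open>1 / R\<close>.\<close>

lemma limit_slopes_subset: "limit_slopes X \<Gamma> x \<subseteq> asymptotic_directions"
proof
  fix \<theta> assume "\<theta> \<in> limit_slopes X \<Gamma> x"
  then obtain \<xi> s where \<xi>: "\<xi> \<in> limit_set X \<Gamma> x" and s: "s \<in> \<xi>" and slope: "has_slope X s \<theta>"
    by (auto simp: limit_slopes_def)
  have \<theta>: "\<theta> \<in> slope_sphere" "norm \<theta> = 1" and ray: "geodesic_ray P s" using slope by (auto simp: has_slope_def slope_sphere_def)
  obtain \<rho> where \<rho>: "\<And>i. geodesic_ray (X i) (\<rho> i)" "\<And>t i. 0 \<le> t \<Longrightarrow> s t i = \<rho> i (\<theta> $ i * t)"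
    using slope by (auto simp: has_slope_def)
  have sP: "0 \<le> t \<Longrightarrow> s t \<in> mspace P" for t using ray by (auto simp: geodesic_ray_def)
  have cl: "Inr \<xi> \<in> cone_topology P closure_of (Inl ` ((\<lambda>\<gamma>. product_action \<gamma> x) ` \<Gamma>))" and gb: "\<xi> \<in> geometric_boundary P"
    using \<xi> by (auto simp: limit_set_def)
  define a where "a = mdist P x (s 0)"
  have a0: "0 \<le> a" by (simp add: a_def)
  show "\<theta> \<in> asymptotic_directions"
    unfolding asymptotic_directions_def
  proof (intro CollectI conjI \<theta>(1) allI impI)
    fix N e :: real assume e: "0 < e"
    define r where "r = real CARD('n)"
    have r: "0 < r" by (simp add: r_def)
    \<comment> \<open>\<open>N\<close> and \<open>a\<close> force the displacement above
      \<open>N\<close>; the quotient makes the final error \<open>2 * (r * (a + 1)) / R\<close>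
      smaller than \<open>e\<close>.\<close>
    define R where "R = \<bar>N\<bar> + a + 1 + 2 * (r * (a + 1)) / e + 1"
    have q0: "0 \<le> 2 * (r * (a + 1)) / e" using r a0 e by simp
    have R: "0 < R" "\<bar>N\<bar> + a < R" "2 * (r * (a + 1)) / e < R" "1 \<le> R" using a0 q0 by (auto simp: R_def)
    have "mdist P (s R) (s R) < 1"
      using CN_space.d0[OF CN_P sP[of R]] R(1) by simp
    then have "\<exists>g\<in>\<xi>. g 0 = s 0 \<and> mdist P (g R) (s R) < 1" using s by blast
    then have "Inr \<xi> \<in> cone_nbhd P s R 1" using gb unfolding cone_nbhd_def by blast
    moreover have "cone_nbhd P s R 1 \<in> {cone_nbhd P c R \<epsilon> |c R \<epsilon>. geodesic_ray P c \<and> R > 0 \<and> \<epsilon> > 0}"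
      using ray R(1) zero_less_one by blast
    then have "openin (cone_topology P) (cone_nbhd P s R 1)"
      unfolding cone_topology_def by (intro topology_generated_by_Basis UnI2)
    ultimately obtain z where "z \<in> Inl ` ((\<lambda>\<gamma>. product_action \<gamma> x) ` \<Gamma>)" "z \<in> cone_nbhd P s R 1"
      using cl unfolding in_closure_of by blast
    then obtain \<gamma> where \<gamma>: "\<gamma> \<in> \<Gamma>" and cn: "Inl (product_action \<gamma> x) \<in> cone_nbhd P s R 1" by blast
    define y where "y = product_action \<gamma> x"
    have yP: "y \<in> mspace P" unfolding y_def by (rule act_P[OF \<gamma>])
    define T where "T = mdist P (s 0) y"
    obtain g where T: "R < T" and g: "geodesic_segment P (s 0) y g" and gR: "mdist P (g R) (s R) < 1"
      using cn by (auto simp: cone_nbhd_def y_def T_def)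
    have "g ` {0..T} \<subseteq> mspace P" using g unfolding geodesic_segment_def T_def by blast
    moreover have "R \<in> {0..T}" using T R by simp
    ultimately have gP: "g R \<in> mspace P" by blast
    have gd: "mdist P (s 0) (g R) = R" "mdist P (g R) y = T - R"
    proof -
      have D: "mdist P (g u) (g v) = \<bar>u - v\<bar>" if "u \<in> {0..T}" "v \<in> {0..T}" for u v
        using g that unfolding geodesic_segment_def T_def by blast
      have "g 0 = s 0" "g T = y" using g unfolding geodesic_segment_def T_def by blast+
      then show "mdist P (s 0) (g R) = R" "mdist P (g R) y = T - R" using D[of 0 R] D[of R T] T R by auto
    qed
    have prp: "T *\<^sub>R dist_vec X (s 0) (g R) = R *\<^sub>R dist_vec X (s 0) y"
      using dist_vec_geodesic(1)[OF sP[of 0] gP yP] gd by (simp add: T_def)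
    have comp: "\<bar>(disp \<gamma> - T *\<^sub>R \<theta>) $ i\<bar> \<le> a + T / R" for i
    proof -
      have Si: "x i \<in> mspace (X i)" "s 0 i \<in> mspace (X i)" "y i \<in> mspace (X i)" "g R i \<in> mspace (X i)" "s R i \<in> mspace (X i)"
        using xS sP[of 0] sP[of R] yP gP R by auto
      have "dd i (x i) (s 0 i) \<le> a" unfolding a_def by (rule L2_metric_coord)
      then have 1: "\<bar>dd i (x i) (y i) - dd i (s 0 i) (y i)\<bar> \<le> a"
        using CN_space.tri'[OF CN_factor Si(1,2,3)] by linarith
      have "0 \<le> \<theta> $ i" using \<theta> by (simp add: slope_sphere_def)
      then have "dd i (s 0 i) (s R i) = \<theta> $ i * R" using \<rho>(1)[of i] R by (simp add: \<rho>(2) geodesic_ray_def)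
      moreover have "dd i (g R i) (s R i) \<le> 1" using L2_metric_coord[of X i "g R" "s R"] gR by simp
      ultimately have 2: "\<bar>dd i (s 0 i) (g R i) - \<theta> $ i * R\<bar> \<le> 1"
        using CN_space.tri'[OF CN_factor Si(4,5,2)] by (simp add: mdist_commute)
      have "T * dd i (s 0 i) (g R i) = R * dd i (s 0 i) (y i)" using arg_cong[OF prp, of "\<lambda>v. v $ i"] by simp
      then have "dd i (s 0 i) (y i) - T * \<theta> $ i = T / R * (dd i (s 0 i) (g R i) - \<theta> $ i * R)"
        using R(1) by (simp add: field_simps)
      also have "\<bar>\<dots>\<bar> \<le> T / R * 1" unfolding abs_mult using 2 R T by (intro mult_mono) auto
      finally have "\<bar>dd i (s 0 i) (y i) - T * \<theta> $ i\<bar> \<le> T / R" by simp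
      moreover have "(disp \<gamma> - T *\<^sub>R \<theta>) $ i = dd i (x i) (y i) - T * \<theta> $ i"
        by (simp add: disp_nth y_def product_action_def)
      ultimately show ?thesis using 1 by linarith
    qed
    have n: "norm (disp \<gamma> - T *\<^sub>R \<theta>) \<le> r * (a + T / R)" unfolding r_def by (rule norm_le_coord) (rule comp)
    have "T \<le> a + norm (disp \<gamma>)"
      using mdist_triangle[OF sP[of 0] xP yP] by (simp add: T_def norm_disp y_def a_def mdist_commute)
    then have big: "N < norm (disp \<gamma>)" using R T by linarith
    have T0: "0 < T" using T R by simp
    have "disp \<gamma> \<noteq> 0" using \<open>T \<le> a + norm (disp \<gamma>)\<close> R T by auto
    moreover have "T *\<^sub>R \<theta> \<noteq> 0" using T0 \<theta>(2) by auto
    moreover have "sgn (T *\<^sub>R \<theta>) = \<theta>" using T0 \<theta>(2) by (simp add: sgn_div_norm)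
    moreover have "norm (T *\<^sub>R \<theta>) = T" using T0 \<theta>(2) by simp
    ultimately have "norm (sgn (disp \<gamma>) - \<theta>) \<le> 2 * norm (disp \<gamma> - T *\<^sub>R \<theta>) / T"
      using norm_sgn_diff_le[of "disp \<gamma>" "T *\<^sub>R \<theta>"] by simp
    also have "\<dots> \<le> 2 * (r * (a + T / R)) / T" using n T0 by (intro divide_right_mono) auto
    also have "\<dots> = 2 * (r * (a / T + 1 / R))" using T0 by (simp add: field_simps)
    also have "\<dots> \<le> 2 * (r * (a / R + 1 / R))"
      using r a0 T R by (intro mult_left_mono add_right_mono divide_left_mono) auto
    also have "\<dots> = 2 * (r * (a + 1)) / R" by (simp flip: add_divide_distrib)
    also have "\<dots> < e" using R(1,3) e by (simp add: divide_less_eq mult.commute)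
    finally show "\<exists>\<gamma>\<in>\<Gamma>. N < norm (disp \<gamma>) \<and> norm (sgn (disp \<gamma>) - \<theta>) < e" using \<gamma> big by blast
  qed
qed

text \<open>The segments from \<open>x\<close> to suitable orbit points converge to a ray. By
  \<open>dist_vec_geodesic\<close> their distances in the factors are proportional to the
  displacement vectors, so the ray moves at speed \<open>\<theta> $ i\<close> in factor
  \<open>i\<close>.\<close>

lemma asymptotic_directions_subset:
  assumes lines: "\<And>i. \<exists>b. geodesic_line (X i) b"
  shows "asymptotic_directions \<subseteq> limit_slopes X \<Gamma> x"
proof
  fix \<theta> assume A: "\<theta> \<in> asymptotic_directions"
  then have \<theta>: "\<theta> \<in> slope_sphere" by (simp add: asymptotic_directions_def)
  have "\<exists>\<gamma>\<in>\<Gamma>. real n < norm (disp \<gamma>) \<and> norm (sgn (disp \<gamma>) - \<theta>) < inverse (real (Suc n))" for n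
  proof -
    have "0 < inverse (real (Suc n))" by simp
    then show ?thesis using A unfolding asymptotic_directions_def by blast
  qed
  then obtain \<gamma> where \<gamma>: "\<And>n. \<gamma> n \<in> \<Gamma>" and far: "\<And>n. real n < norm (disp (\<gamma> n))"
    and dir: "\<And>n. norm (sgn (disp (\<gamma> n)) - \<theta>) < inverse (real (Suc n))" by metis
  define y where "y n = product_action (\<gamma> n) x" for n
  have yP: "y n \<in> mspace P" for n unfolding y_def by (rule act_P[OF \<gamma>])
  interpret P: CN_space P by (rule CN_P)
  have L: "mdist P x (y n) = norm (disp (\<gamma> n))" for n by (simp add: norm_disp y_def)
  have inf: "filterlim (\<lambda>n. mdist P x (y n)) at_top ufil"
  proof (rule filterlim_ufil, rule filterlim_at_top_mono[OF filterlim_real_sequentially])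
    show "eventually (\<lambda>n. real n \<le> mdist P x (y n)) sequentially" using far by (simp add: L less_imp_le)
  qed
  obtain s where s: "geodesic_ray P s" "s 0 = x"
    and lim: "\<And>t. 0 \<le> t \<Longrightarrow> P.uconv (\<lambda>n. P.pt x (y n) (t / mdist P x (y n))) (s t)"
    using P.ray_limit[OF xP yP inf] by blast
  have "((\<lambda>n. norm (sgn (disp (\<gamma> n)) - \<theta>)) \<longlongrightarrow> 0) ufil"
    by (rule tendsto_sandwich[OF _ _ tendsto_const tendsto_ufil[OF LIMSEQ_inverse_real_of_nat]])
      (use dir in \<open>auto intro!: always_eventually less_imp_le\<close>)
  then have "((\<lambda>n. sgn (disp (\<gamma> n))) \<longlongrightarrow> \<theta>) ufil"
    using tendsto_norm_zero_iff LIM_zero_cancel by blast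
  then have dirl: "((\<lambda>n. sgn (disp (\<gamma> n)) $ i) \<longlongrightarrow> \<theta> $ i) ufil" for i by (rule tendsto_vec_nth)
  have sS: "0 \<le> t \<Longrightarrow> s t i \<in> mspace (X i)" for t i using s(1) by (auto simp: geodesic_ray_def)
  have comp: "dd i (s u i) (s t i) = \<theta> $ i * (t - u)" if u: "0 \<le> u" "u \<le> t" for u t i
  proof -
    have t: "0 \<le> t" using u by simp
    define c where "c n v = P.pt x (y n) (v / mdist P x (y n))" for n v
    have ev: "eventually (\<lambda>n. dd i (c n u i) (c n t i) = (t - u) * (sgn (disp (\<gamma> n)) $ i)) ufil"
    proof -
      have "eventually (\<lambda>n. t + 1 \<le> mdist P x (y n)) ufil" using inf by (simp add: filterlim_at_top)
      then show ?thesis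
      proof (rule eventually_mono)
        fix n
        define L where "L = mdist P x (y n)"
        assume "t + 1 \<le> mdist P x (y n)"
        then have Lt: "t + 1 \<le> L" "0 < L" using t by (auto simp: L_def)
        have ul: "0 \<le> u / L" "u / L \<le> 1" "0 \<le> t / L" "t / L \<le> 1" using Lt u by auto
        have cP: "c n u \<in> mspace P" "c n t \<in> mspace P" unfolding c_def L_def[symmetric] using P.pt_in[OF xP yP] ul by auto
        have d: "mdist P x (c n t) = t" "mdist P x (c n u) = u" "mdist P (c n t) (y n) = L - t"
          using P.d_pt_simps[OF xP yP ul(1,2)] P.d_pt_simps[OF xP yP ul(3,4)] Lt
          by (simp_all add: c_def flip: L_def) (simp add: left_diff_distrib)
        have "mdist P (c n u) (c n t) = \<bar>u / L - t / L\<bar> * L"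
          unfolding c_def L_def[symmetric] using P.d_pt_pt[OF xP yP ul] by (simp add: L_def)
        also have "\<dots> = t - u" using Lt u by (simp add: abs_if field_simps)
        finally have d2: "mdist P (c n u) (c n t) = t - u" .
        have 1: "L *\<^sub>R dist_vec X x (c n t) = t *\<^sub>R dist_vec X x (y n)"
          using dist_vec_geodesic(1)[OF xP cP(2) yP] d by (simp add: L_def)
        have 2: "t *\<^sub>R dist_vec X (c n u) (c n t) = (t - u) *\<^sub>R dist_vec X x (c n t)"
          using dist_vec_geodesic(2)[OF xP cP] d d2 by simp
        have w: "sgn (disp (\<gamma> n)) $ i = dd i (x i) (y n i) / L"
          by (simp add: sgn_div_norm disp_dist_vec norm_dist_vec L_def y_def divide_inverse)
        have e1: "L * dd i (x i) (c n t i) = t * dd i (x i) (y n i)" using arg_cong[OF 1, of "\<lambda>v. v $ i"] by simp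
        have e2: "t * dd i (c n u i) (c n t i) = (t - u) * dd i (x i) (c n t i)" using arg_cong[OF 2, of "\<lambda>v. v $ i"] by simp
        show "dd i (c n u i) (c n t i) = (t - u) * (sgn (disp (\<gamma> n)) $ i)"
        proof (cases "t = 0")
          case True
          then have "u = 0" using u by simp
          then show ?thesis using True cP by simp
        next
          case False
          have "t * (L * dd i (c n u i) (c n t i)) = (t - u) * (L * dd i (x i) (c n t i))" using e2 by (simp add: mult.left_commute)
          also have "\<dots> = t * ((t - u) * dd i (x i) (y n i))" unfolding e1 by simp
          finally have "L * dd i (c n u i) (c n t i) = (t - u) * dd i (x i) (y n i)" using False by simp
          then show ?thesis unfolding w using Lt(2) by (simp add: field_simps)
        qed
      qed
    qed
    interpret Xi: CN_space "X i" by (rule CN_factor)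
    have conv: "Xi.uconv (\<lambda>n. c n v i) (s v i)" if v: "0 \<le> v" for v
    proof -
      have u: "P.uconv (\<lambda>n. c n v) (s v)" unfolding c_def by (rule lim[OF v])
      have "((\<lambda>n. mdist P (c n v) (s v)) \<longlongrightarrow> 0) ufil" using u by (simp add: P.uconv_def)
      then have "((\<lambda>n. dd i (c n v i) (s v i)) \<longlongrightarrow> 0) ufil"
        by (rule Lim_null_comparison[rotated]) (simp add: L2_metric_coord)
      moreover have "eventually (\<lambda>n. c n v \<in> mspace P) ufil" using u by (simp add: P.uconv_def)
      then have "eventually (\<lambda>n. c n v i \<in> mspace (X i)) ufil" by (rule eventually_mono) simp
      ultimately show ?thesis using sS[OF v] by (simp add: Xi.uconv_def)
    qed
    have "((\<lambda>n. (t - u) * (sgn (disp (\<gamma> n)) $ i)) \<longlongrightarrow> (t - u) * \<theta> $ i) ufil"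
      by (intro tendsto_mult tendsto_const dirl)
    then have "((\<lambda>n. dd i (c n u i) (c n t i)) \<longlongrightarrow> (t - u) * \<theta> $ i) ufil"
      by (rule tendsto_cong[THEN iffD1, rotated]) (use ev in eventually_elim, simp)
    then show ?thesis using Xi.uconv_eq[OF conv[OF u(1)] conv[OF t]] by (simp add: mult.commute)
  qed
  have \<theta>0: "0 \<le> \<theta> $ i" for i using \<theta> by (simp add: slope_sphere_def)
  have "\<exists>\<rho>. geodesic_ray (X i) \<rho> \<and> (\<forall>t\<ge>0. s t i = \<rho> (\<theta> $ i * t))" for i
  proof (cases "\<theta> $ i = 0")
    case True
    interpret Xi: CN_space "X i" by (rule CN_factor)
    \<comment> \<open>\<open>has_slope\<close> asks for a geodesic ray in every factor, also where
      \<open>s\<close> stands still; the line guarantees that a ray starting at \<open>x i\<close>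
      exists.\<close>
    obtain b where b: "geodesic_line (X i) b" using lines by blast
    have bS: "b t \<in> mspace (X i)" for t using b by (auto simp: geodesic_line_def)
    have "filterlim (\<lambda>n. dd i (x i) (b (real n))) at_top ufil"
    proof (rule filterlim_at_top_mono)
      show "filterlim (\<lambda>n. - dd i (x i) (b 0) + real n) at_top ufil"
        by (rule filterlim_tendsto_add_at_top[OF tendsto_const filterlim_ufil[OF filterlim_real_sequentially]])
      have "- dd i (x i) (b 0) + real n \<le> dd i (x i) (b (real n))" for n
        using mdist_triangle[OF bS xS bS, of 0 "real n"] b by (simp add: geodesic_line_def mdist_commute)
      then show "eventually (\<lambda>n. - dd i (x i) (b 0) + real n \<le> dd i (x i) (b (real n))) ufil" by simp
    qed
    then obtain \<rho> where \<rho>: "geodesic_ray (X i) \<rho>" "\<rho> 0 = x i" using Xi.ray_limit[OF xS bS] by blast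
    have "s t i = x i" if t: "0 \<le> t" for t
    proof -
      have "dd i (s 0 i) (s t i) = 0" using comp[of 0 t i] t True by simp
      then show ?thesis using sS[OF t, of i] sS[of 0 i] s(2) by simp
    qed
    then show ?thesis using \<rho> True by auto
  next
    case False
    then have pos: "0 < \<theta> $ i" using \<theta>0[of i] by simp
    define \<rho> where "\<rho> t = s (t / \<theta> $ i) i" for t
    have *: "dd i (\<rho> u) (\<rho> t) = t - u" if "0 \<le> u" "u \<le> t" for u t
    proof -
      have "dd i (\<rho> u) (\<rho> t) = \<theta> $ i * (t / \<theta> $ i - u / \<theta> $ i)"
        unfolding \<rho>_def using that pos by (intro comp) (auto simp: divide_right_mono)
      also have "\<dots> = t - u" using pos by (simp add: right_diff_distrib)
      finally show ?thesis .
    qed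
    have "geodesic_ray (X i) \<rho>"
      unfolding geodesic_ray_def
    proof (intro conjI allI impI)
      show "\<rho> ` {0..} \<subseteq> mspace (X i)" using sS pos by (auto simp: \<rho>_def)
      fix u t :: real assume ut: "0 \<le> u" "0 \<le> t"
      show "dd i (\<rho> u) (\<rho> t) = \<bar>u - t\<bar>"
      proof (cases "u \<le> t")
        case True then show ?thesis using *[of u t] ut by simp
      next
        case False then show ?thesis using *[of t u] ut by (simp add: mdist_commute)
      qed
    qed
    then show ?thesis using pos by (intro exI[of _ \<rho>]) (simp add: \<rho>_def)
  qed
  then obtain \<rho> where "\<And>i. geodesic_ray (X i) (\<rho> i)" "\<And>i t. 0 \<le> t \<Longrightarrow> s t i = \<rho> i (\<theta> $ i * t)" by metis
  then have slope: "has_slope X s \<theta>" using \<theta> s(1) by (auto simp: has_slope_def)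
  have "Inr (ray_endpoint P s) \<in> cone_topology P closure_of (Inl ` ((\<lambda>\<gamma>. product_action \<gamma> x) ` \<Gamma>))"
    by (rule P.limit_in_closure[OF xP yP inf s(1) lim]) (use \<gamma> in \<open>auto simp: y_def\<close>)
  moreover have "ray_endpoint P s \<in> geometric_boundary P"
    using s(1) by (auto simp: geometric_boundary_def ray_endpoint_def quotient_def)
  moreover have "s \<in> ray_endpoint P s"
    using equiv_class_self[OF equiv_asymptotic_rel] s(1) by (simp add: ray_endpoint_def)
  ultimately show "\<theta> \<in> limit_slopes X \<Gamma> x" using slope unfolding limit_slopes_def limit_set_def by blast
qed

text \<open>The \<open>k\<close>-th power moves the point \<open>a i 0\<close> of the axis by
  exactly \<open>k * l i\<close>; passing to the base point costs a constant independent of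
  \<open>k\<close>.\<close>

lemma power_displacement:
  assumes d: "\<delta> \<in> \<Gamma>" and reg: "regular_axial X \<delta>"
  shows "\<exists>C. \<forall>k::nat. \<exists>\<gamma>\<in>\<Gamma>. \<forall>i. \<bar>disp \<gamma> $ i - real k * translation_vector X \<delta> $ i\<bar> \<le> C"
proof -
  have "\<exists>a l. is_axis (X i) (\<delta> i) a l" for i
    using reg unfolding regular_axial_def rank_one_def by blast
  then obtain a l where a: "\<And>i. is_axis (X i) (\<delta> i) (a i) (l i)" by metis
  have l: "translation_vector X \<delta> $ i = l i" for i
    using translation_length_eq[OF comp_isom[OF d] a] by (simp add: translation_vector_def)
  have lpos: "0 < l i" for i using a by (auto simp: is_axis_def)
  have line: "geodesic_line (X i) (a i)" for i using a by (auto simp: is_axis_def)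
  have aS: "a i t \<in> mspace (X i)" for i t using line[of i] by (auto simp: geodesic_line_def)
  define C where "C = (\<Sum>i\<in>UNIV. 2 * dd i (x i) (a i 0))"
  have C: "2 * dd i (x i) (a i 0) \<le> C" for i unfolding C_def by (rule member_le_sum) auto
  show ?thesis
  proof (intro exI[of _ C] allI)
    fix k :: nat
    obtain \<gamma> where \<gamma>: "\<gamma> \<in> \<Gamma>" "\<And>i. \<gamma> i = \<delta> i [^]\<^bsub>G i\<^esub> int k" using pow_ex[OF d] by blast
    have "\<bar>disp \<gamma> $ i - real k * translation_vector X \<delta> $ i\<bar> \<le> C" for i
    proof -
      note ci = comp_isom[OF \<gamma>(1), of i]
      have "\<gamma> i (a i 0) = a i (0 + of_int (int k) * l i)"
        unfolding \<gamma>(2) by (rule CN_space.axis_pow[OF CN_factor comp_isom[OF d] a])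
      then have ga: "\<gamma> i (a i 0) = a i (real k * l i)" by simp
      have gx: "\<gamma> i (x i) \<in> mspace (X i)" by (rule CN_space.isom_in[OF CN_factor ci xS])
      have 1: "dd i (a i (real k * l i)) (\<gamma> i (x i)) = dd i (a i 0) (x i)"
        unfolding ga[symmetric] by (rule CN_space.isom_d[OF CN_factor ci aS xS])
      have 2: "dd i (a i 0) (a i (real k * l i)) = real k * l i" using line[of i] lpos[of i] by (simp add: geodesic_line_def)
      have "dd i (x i) (\<gamma> i (x i)) \<le> dd i (x i) (a i 0) + (dd i (a i 0) (a i (real k * l i)) + dd i (a i (real k * l i)) (\<gamma> i (x i)))"
        using mdist_triangle[OF xS aS gx, of 0] mdist_triangle[OF aS aS gx, of 0 "real k * l i"] by simp
      moreover have "dd i (a i 0) (a i (real k * l i)) \<le> dd i (a i 0) (x i) + (dd i (x i) (\<gamma> i (x i)) + dd i (\<gamma> i (x i)) (a i (real k * l i)))"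
        using mdist_triangle[OF aS xS aS, of i 0 "real k * l i"] mdist_triangle[OF xS gx aS, of "real k * l i"] by simp
      ultimately show ?thesis using 1 2 C[of i] unfolding l disp_nth by (simp add: mdist_commute abs_le_iff)
    qed
    then show "\<exists>\<gamma>\<in>\<Gamma>. \<forall>i. \<bar>disp \<gamma> $ i - real k * translation_vector X \<delta> $ i\<bar> \<le> C" using \<gamma>(1) by blast
  qed
qed

section \<open>Directions of translation vectors and the limit cone\<close>

definition half_lines :: "(real ^ 'n) set" where
  "half_lines = (\<Union>\<gamma>\<in>{\<gamma> \<in> \<Gamma>. regular_axial X \<gamma>}. {s *\<^sub>R translation_vector X \<gamma> |s. s \<ge> 0})"

lemma half_linesI: "\<gamma> \<in> \<Gamma> \<Longrightarrow> regular_axial X \<gamma> \<Longrightarrow> 0 \<le> s \<Longrightarrow> s *\<^sub>R translation_vector X \<gamma> \<in> half_lines"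
  by (auto simp: half_lines_def)

lemma half_linesE:
  assumes "v \<in> half_lines"
  obtains \<gamma> s where "\<gamma> \<in> \<Gamma>" "regular_axial X \<gamma>" "0 \<le> s" "v = s *\<^sub>R translation_vector X \<gamma>"
  using assms by (auto simp: half_lines_def)

lemma limit_cone_closure: "limit_cone X \<Gamma> = closure half_lines"
  by (simp add: limit_cone_def half_lines_def)

text \<open>In one direction a group element is replaced by a regular axial one with nearby
  translation vector, in the other a regular axial element by its high powers. Both errors are
  bounded and vanish after normalization.\<close>

lemma asymptotic_directions_eq:
  assumes g: "g \<in> \<Gamma>" and h: "h \<in> \<Gamma>" and ind: "independent_regular_axial X g h"
  shows "asymptotic_directions = limit_cone X \<Gamma> \<inter> slope_sphere"
proof (intro equalityI subsetI IntI)
  define r where "r = real CARD('n)"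
  fix \<theta> assume A: "\<theta> \<in> asymptotic_directions"
  then show "\<theta> \<in> slope_sphere" by (simp add: asymptotic_directions_def)
  obtain C where C: "\<And>\<gamma>. \<gamma> \<in> \<Gamma> \<Longrightarrow> \<exists>\<delta>\<in>\<Gamma>. regular_axial X \<delta> \<and> (\<forall>i. \<bar>translation_vector X \<delta> $ i - disp \<gamma> $ i\<bar> \<le> C)"
    using near_regular_axial[OF assms] by blast
  show "\<theta> \<in> limit_cone X \<Gamma>"
    unfolding limit_cone_closure closure_approachable
  proof (intro allI impI)
    fix e :: real assume e: "0 < e"
    define N where "N = \<bar>2 * (r * C) / e\<bar> + 1"
    obtain \<gamma> where \<gamma>: "\<gamma> \<in> \<Gamma>" "N < norm (disp \<gamma>)" "norm (sgn (disp \<gamma>) - \<theta>) < e / 2"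
      using A half_gt_zero[OF e] unfolding asymptotic_directions_def by blast
    obtain \<delta> where \<delta>: "\<delta> \<in> \<Gamma>" "regular_axial X \<delta>" "\<And>i. \<bar>translation_vector X \<delta> $ i - disp \<gamma> $ i\<bar> \<le> C"
      using C[OF \<gamma>(1)] by blast
    define n where "n = norm (disp \<gamma>)"
    have n: "0 < n" "2 * (r * C) / e < n"
      using \<gamma>(2) abs_ge_self[of "2 * (r * C) / e"] abs_ge_zero[of "2 * (r * C) / e"] unfolding N_def n_def by linarith+
    let ?v = "inverse n *\<^sub>R translation_vector X \<delta>"
    have "norm (translation_vector X \<delta> - disp \<gamma>) \<le> r * C" unfolding r_def by (rule norm_le_coord) (use \<delta>(3) in simp)
    moreover have "?v - sgn (disp \<gamma>) = inverse n *\<^sub>R (translation_vector X \<delta> - disp \<gamma>)"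
      by (simp add: sgn_div_norm n_def scaleR_diff_right)
    then have "norm (?v - sgn (disp \<gamma>)) = inverse n * norm (translation_vector X \<delta> - disp \<gamma>)" using n by simp
    ultimately have "norm (?v - sgn (disp \<gamma>)) \<le> inverse n * (r * C)" using n by (simp add: mult_left_mono)
    also have "\<dots> < e / 2"
    proof -
      have "2 * (r * C) < n * e" using n(2) e by (simp add: pos_divide_less_eq)
      then show ?thesis using n(1) by (simp add: divide_simps mult.commute)
    qed
    finally have "norm (?v - \<theta>) < e"
      using \<gamma>(3) norm_triangle_ineq[of "?v - sgn (disp \<gamma>)" "sgn (disp \<gamma>) - \<theta>"] by simp
    moreover have "?v \<in> half_lines" using n by (intro half_linesI \<delta>) auto
    ultimately show "\<exists>v\<in>half_lines. dist v \<theta> < e" by (auto simp: dist_norm)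
  qed
next
  define r where "r = real CARD('n)"
  fix \<theta> assume "\<theta> \<in> limit_cone X \<Gamma> \<inter> slope_sphere"
  then have cl: "\<theta> \<in> closure half_lines" and \<theta>: "\<theta> \<in> slope_sphere" by (auto simp: limit_cone_closure)
  have n1: "norm \<theta> = 1" using \<theta> by (simp add: slope_sphere_def)
  show "\<theta> \<in> asymptotic_directions"
    unfolding asymptotic_directions_def
  proof (intro CollectI conjI \<theta> allI impI)
    fix N e :: real assume e: "0 < e"
    \<comment> \<open>\<open>1/2\<close> keeps \<open>u\<close> away from \<open>0\<close>;
      \<open>e / 8\<close> absorbs the factor two of \<open>norm_sgn_diff_le\<close>.\<close>
    define \<eta> where "\<eta> = min (1/2) (e / 8)"
    have \<eta>: "0 < \<eta>" "\<eta> \<le> 1/2" "\<eta> \<le> e / 8" using e by (auto simp: \<eta>_def)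
    obtain u where u: "u \<in> half_lines" "norm (u - \<theta>) < \<eta>"
      using cl \<eta>(1) unfolding closure_approachable dist_norm by blast
    obtain \<delta> s where \<delta>: "\<delta> \<in> \<Gamma>" "regular_axial X \<delta>" "0 \<le> s" "u = s *\<^sub>R translation_vector X \<delta>"
      using u(1) by (rule half_linesE)
    let ?l = "translation_vector X \<delta>"
    have u0: "u \<noteq> 0" using u(2) n1 \<eta>(2) by auto
    then have s: "0 < s" and l0: "?l \<noteq> 0" using \<delta>(3,4) by (auto simp: less_le)
    have su: "sgn u = sgn ?l" using s by (simp add: \<delta>(4) sgn_scaleR)
    have "sgn \<theta> = \<theta>" "\<theta> \<noteq> 0" using n1 by (auto simp: sgn_div_norm)
    then have "norm (sgn ?l - \<theta>) \<le> 2 * norm (u - \<theta>)"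
      using norm_sgn_diff_le[OF u0, of \<theta>] n1 by (simp add: su)
    then have 1: "norm (sgn ?l - \<theta>) < e / 2" using u(2) \<eta>(3) e by linarith
    obtain C where C: "\<And>k::nat. \<exists>\<gamma>\<in>\<Gamma>. \<forall>i. \<bar>disp \<gamma> $ i - real k * ?l $ i\<bar> \<le> C"
      using power_displacement[OF \<delta>(1,2)] by blast
    define m where "m = norm ?l"
    have m: "0 < m" using l0 by (simp add: m_def)
    \<comment> \<open>The first two terms push the displacement beyond \<open>N\<close> despite the
      error \<open>r * C\<close>; the third makes the error of the direction smaller than
      \<open>e / 2\<close>.\<close>
    define c where "c = \<bar>N\<bar> + \<bar>r * C\<bar> + \<bar>4 * (r * C) / e\<bar> + 1"
    obtain k :: nat where k: "c < real k * m" using ex_less_of_nat_mult[OF m] by blast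
    obtain \<gamma> where \<gamma>: "\<gamma> \<in> \<Gamma>" "\<And>i. \<bar>disp \<gamma> $ i - real k * ?l $ i\<bar> \<le> C" using C by blast
    have km: "norm (real k *\<^sub>R ?l) = real k * m" by (simp add: m_def)
    have n: "norm (disp \<gamma> - real k *\<^sub>R ?l) \<le> r * C" unfolding r_def by (rule norm_le_coord) (use \<gamma>(2) in simp)
    have "real k * m \<le> norm (disp \<gamma>) + norm (disp \<gamma> - real k *\<^sub>R ?l)"
      unfolding km[symmetric] using norm_triangle_ineq4[of "disp \<gamma>" "disp \<gamma> - real k *\<^sub>R ?l"] by simp
    then have "\<bar>N\<bar> + 1 < norm (disp \<gamma>)"
      using n k abs_ge_self[of "r * C"] abs_ge_zero[of "4 * (r * C) / e"] unfolding c_def by linarith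
    then have big: "N < norm (disp \<gamma>)" and d0: "disp \<gamma> \<noteq> 0" by auto
    have "0 < real k * m"
      using k abs_ge_zero[of N] abs_ge_zero[of "r * C"] abs_ge_zero[of "4 * (r * C) / e"] unfolding c_def by linarith
    then have k0: "0 < real k" using m by (rule zero_less_mult_pos2)
    then have kl: "real k *\<^sub>R ?l \<noteq> 0" "0 < real k" using l0 by simp_all
    have "norm (sgn (disp \<gamma>) - sgn (real k *\<^sub>R ?l)) \<le> 2 * norm (disp \<gamma> - real k *\<^sub>R ?l) / (real k * m)"
      using norm_sgn_diff_le[OF d0 kl(1)] unfolding km .
    also have "sgn (real k *\<^sub>R ?l) = sgn ?l" using kl(2) by (simp add: sgn_scaleR)
    also have "2 * norm (disp \<gamma> - real k *\<^sub>R ?l) / (real k * m) \<le> 2 * (r * C) / (real k * m)"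
      using n kl m by (intro divide_right_mono) auto
    also have "\<dots> < e / 2"
    proof -
      have "4 * (r * C) / e < real k * m" using k unfolding c_def by linarith
      then have "4 * (r * C) < real k * m * e" using e by (simp add: pos_divide_less_eq)
      then show ?thesis using kl m by (simp add: pos_divide_less_eq mult.commute)
    qed
    finally have "norm (sgn (disp \<gamma>) - \<theta>) < e"
      using 1 norm_triangle_ineq[of "sgn (disp \<gamma>) - sgn ?l" "sgn ?l - \<theta>"] by simp
    then show "\<exists>\<gamma>\<in>\<Gamma>. N < norm (disp \<gamma>) \<and> norm (sgn (disp \<gamma>) - \<theta>) < e" using \<gamma>(1) big by blast
  qed
qed

text \<open>Real coefficients are approximated by the integer exponents
  \<open>\<lfloor>n s\<rfloor>\<close> and \<open>\<lfloor>n t\<rfloor>\<close>. The two powers are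
  combined by \<open>displacement_additive\<close> and replaced by a regular axial element. The
  total error does not depend on \<open>n\<close> and disappears after division by
  \<open>n\<close>.\<close>

lemma half_lines_add:
  assumes g: "g \<in> \<Gamma>" and h: "h \<in> \<Gamma>" and ind: "independent_regular_axial X g h"
    and p: "p \<in> half_lines" and q: "q \<in> half_lines"
  shows "p + q \<in> closure half_lines"
proof -
  obtain \<gamma>1 s where 1: "\<gamma>1 \<in> \<Gamma>" "regular_axial X \<gamma>1" "0 \<le> s" "p = s *\<^sub>R translation_vector X \<gamma>1" using p by (rule half_linesE)
  obtain \<gamma>2 t where 2: "\<gamma>2 \<in> \<Gamma>" "regular_axial X \<gamma>2" "0 \<le> t" "q = t *\<^sub>R translation_vector X \<gamma>2" using q by (rule half_linesE)
  let ?u = "translation_vector X \<gamma>1" and ?v = "translation_vector X \<gamma>2"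
  obtain C1 where C1: "\<And>k::nat. \<exists>\<gamma>\<in>\<Gamma>. \<forall>i. \<bar>disp \<gamma> $ i - real k * ?u $ i\<bar> \<le> C1" using power_displacement[OF 1(1,2)] by blast
  obtain C2 where C2: "\<And>k::nat. \<exists>\<gamma>\<in>\<Gamma>. \<forall>i. \<bar>disp \<gamma> $ i - real k * ?v $ i\<bar> \<le> C2" using power_displacement[OF 2(1,2)] by blast
  obtain C3 where C3: "\<And>\<gamma> \<gamma>'. \<gamma> \<in> \<Gamma> \<Longrightarrow> \<gamma>' \<in> \<Gamma> \<Longrightarrow> \<exists>\<delta>\<in>\<Gamma>. \<forall>i. \<bar>disp \<delta> $ i - (disp \<gamma> $ i + disp \<gamma>' $ i)\<bar> \<le> C3"
    using displacement_additive[OF g h ind] by blast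
  obtain C4 where C4: "\<And>\<gamma>. \<gamma> \<in> \<Gamma> \<Longrightarrow> \<exists>\<delta>\<in>\<Gamma>. regular_axial X \<delta> \<and> (\<forall>i. \<bar>translation_vector X \<delta> $ i - disp \<gamma> $ i\<bar> \<le> C4)"
    using near_regular_axial[OF g h ind] by blast
  define C where "C = C1 + C2 + C3 + C4 + norm ?u + norm ?v"
  define r where "r = real CARD('n)"
  show ?thesis
    unfolding closure_approachable
  proof (intro allI impI)
    fix e :: real assume e: "0 < e"
    obtain n :: nat where n: "\<bar>r * C\<bar> < real n * e" using ex_less_of_nat_mult[OF e] by blast
    then have n0: "0 < real n" using e by (auto simp: zero_less_mult_iff dest: order_le_less_trans[OF abs_ge_zero])
    define j where "j = nat \<lfloor>real n * s\<rfloor>"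
    define k where "k = nat \<lfloor>real n * t\<rfloor>"
    have j: "\<bar>real j - real n * s\<bar> \<le> 1"
    proof -
      have "0 \<le> real n * s" using 1(3) by simp
      then have "real j = of_int \<lfloor>real n * s\<rfloor>" by (simp add: j_def)
      then show ?thesis by linarith
    qed
    have k: "\<bar>real k - real n * t\<bar> \<le> 1"
    proof -
      have "0 \<le> real n * t" using 2(3) by simp
      then have "real k = of_int \<lfloor>real n * t\<rfloor>" by (simp add: k_def)
      then show ?thesis by linarith
    qed
    obtain \<alpha> where \<alpha>: "\<alpha> \<in> \<Gamma>" "\<And>i. \<bar>disp \<alpha> $ i - real j * ?u $ i\<bar> \<le> C1" using C1 by blast
    obtain \<beta> where \<beta>: "\<beta> \<in> \<Gamma>" "\<And>i. \<bar>disp \<beta> $ i - real k * ?v $ i\<bar> \<le> C2" using C2 by blast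
    obtain \<epsilon> where \<epsilon>: "\<epsilon> \<in> \<Gamma>" "\<And>i. \<bar>disp \<epsilon> $ i - (disp \<alpha> $ i + disp \<beta> $ i)\<bar> \<le> C3" using C3[OF \<alpha>(1) \<beta>(1)] by blast
    obtain \<delta> where \<delta>: "\<delta> \<in> \<Gamma>" "regular_axial X \<delta>" "\<And>i. \<bar>translation_vector X \<delta> $ i - disp \<epsilon> $ i\<bar> \<le> C4" using C4[OF \<epsilon>(1)] by blast
    let ?w = "translation_vector X \<delta>"
    have "\<bar>(?w - real n *\<^sub>R (p + q)) $ i\<bar> \<le> C" for i
    proof -
      have "\<bar>(real j - real n * s) * ?u $ i\<bar> \<le> 1 * norm ?u"
        unfolding abs_mult using j component_le_norm_cart[of ?u i] by (intro mult_mono) auto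
      moreover have "\<bar>(real k - real n * t) * ?v $ i\<bar> \<le> 1 * norm ?v"
        unfolding abs_mult using k component_le_norm_cart[of ?v i] by (intro mult_mono) auto
      moreover have "(?w - real n *\<^sub>R (p + q)) $ i = (?w $ i - disp \<epsilon> $ i) + (disp \<epsilon> $ i - (disp \<alpha> $ i + disp \<beta> $ i))
         + (disp \<alpha> $ i - real j * ?u $ i) + (disp \<beta> $ i - real k * ?v $ i)
         + (real j - real n * s) * ?u $ i + (real k - real n * t) * ?v $ i"
        by (simp add: 1(4) 2(4) algebra_simps)
      ultimately show ?thesis using \<alpha>(2)[of i] \<beta>(2)[of i] \<epsilon>(2)[of i] \<delta>(3)[of i] unfolding C_def by linarith
    qed
    then have "norm (?w - real n *\<^sub>R (p + q)) \<le> r * C" unfolding r_def by (rule norm_le_coord)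
    also have "\<dots> < real n * e" using n by linarith
    finally have lt: "norm (?w - real n *\<^sub>R (p + q)) < real n * e" .
    have "inverse (real n) *\<^sub>R ?w - (p + q) = inverse (real n) *\<^sub>R (?w - real n *\<^sub>R (p + q))"
      using n0 by (simp add: scaleR_diff_right)
    then have "norm (inverse (real n) *\<^sub>R ?w - (p + q)) = norm (?w - real n *\<^sub>R (p + q)) / real n"
      by (simp add: divide_inverse mult.commute)
    also have "\<dots> < e" using lt n0 by (simp add: pos_divide_less_eq mult.commute)
    finally have "dist (inverse (real n) *\<^sub>R ?w) (p + q) < e" by (simp add: dist_norm)
    moreover have "inverse (real n) *\<^sub>R ?w \<in> half_lines" by (intro half_linesI \<delta>) simp
    ultimately show "\<exists>y\<in>half_lines. dist y (p + q) < e" by blast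
  qed
qed

lemma half_lines_scale:
  assumes "p \<in> half_lines" "0 \<le> a" shows "a *\<^sub>R p \<in> half_lines"
proof -
  obtain \<gamma> s where 1: "\<gamma> \<in> \<Gamma>" "regular_axial X \<gamma>" "0 \<le> s" "p = s *\<^sub>R translation_vector X \<gamma>" using assms(1) by (rule half_linesE)
  then show ?thesis using half_linesI[OF 1(1,2), of "a * s"] assms(2) by simp
qed

text \<open>As \<open>half_lines_add\<close> lands only in the closure, approximation is needed
  twice: for the two summands and for the sum of their approximations.\<close>

lemma convex_limit_cone:
  assumes g: "g \<in> \<Gamma>" and h: "h \<in> \<Gamma>" and ind: "independent_regular_axial X g h"
  shows "convex (limit_cone X \<Gamma>)"
  unfolding limit_cone_closure convex_def
proof (intro ballI allI impI)
  fix u v :: "real ^ 'n" and a b :: real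
  assume u: "u \<in> closure half_lines" and v: "v \<in> closure half_lines" and a: "0 \<le> a" and b: "0 \<le> b" and ab: "a + b = 1"
  show "a *\<^sub>R u + b *\<^sub>R v \<in> closure half_lines"
    unfolding closure_approachable[of "a *\<^sub>R u + b *\<^sub>R v"]
  proof (intro allI impI)
    fix e :: real assume e: "0 < e"
    then have e2: "0 < e / 2" by simp
    obtain p where p: "p \<in> half_lines" "norm (p - u) < e / 2" using u e2 unfolding closure_approachable dist_norm by blast
    obtain q where q: "q \<in> half_lines" "norm (q - v) < e / 2" using v e2 unfolding closure_approachable dist_norm by blast
    have "a *\<^sub>R p + b *\<^sub>R q \<in> closure half_lines"
      by (rule half_lines_add[OF assms half_lines_scale[OF p(1) a] half_lines_scale[OF q(1) b]])
    then obtain w where w: "w \<in> half_lines" "norm (w - (a *\<^sub>R p + b *\<^sub>R q)) < e / 2"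
      using e2 unfolding closure_approachable dist_norm by blast
    have "norm (a *\<^sub>R (p - u) + b *\<^sub>R (q - v)) \<le> a * norm (p - u) + b * norm (q - v)"
      using norm_triangle_ineq[of "a *\<^sub>R (p - u)" "b *\<^sub>R (q - v)"] a b by simp
    also have "\<dots> \<le> a * (e / 2) + b * (e / 2)" using a b p q by (intro add_mono mult_left_mono) auto
    also have "\<dots> = e / 2" using ab by (simp flip: distrib_right)
    finally have "norm ((w - (a *\<^sub>R p + b *\<^sub>R q)) + (a *\<^sub>R (p - u) + b *\<^sub>R (q - v))) < e"
      using w(2) norm_triangle_ineq[of "w - (a *\<^sub>R p + b *\<^sub>R q)" "a *\<^sub>R (p - u) + b *\<^sub>R (q - v)"] by linarith
    then have "dist w (a *\<^sub>R u + b *\<^sub>R v) < e" by (simp add: dist_norm algebra_simps)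
    then show "\<exists>y\<in>half_lines. dist y (a *\<^sub>R u + b *\<^sub>R v) < e" using w(1) by blast
  qed
qed

end

theorem theoremD:
  fixes X :: "'n::finite \<Rightarrow> 'a metric" and \<Gamma> :: "('n \<Rightarrow> 'a \<Rightarrow> 'a) set"
  assumes "\<And>i. Hadamard_space (X i)"
    and "\<And>i. locally_compact_space (mtopology_of (X i))"
    and "subgroup \<Gamma> (product_isometry_group X)"
    and "properly_discontinuous X \<Gamma>"
    and "\<exists>g\<in>\<Gamma>. \<exists>h\<in>\<Gamma>. independent_regular_axial X g h"
  shows "(\<forall>x\<in>mspace (L2_metric X). limit_slopes X \<Gamma> x = limit_cone X \<Gamma> \<inter> slope_sphere)
    \<and> convex (limit_cone X \<Gamma>)"
proof -
  obtain g h where gh: "g \<in> \<Gamma>" "h \<in> \<Gamma>" "independent_regular_axial X g h" using assms(5) by blast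
  have CN: "CN_space (X i)" for i using Hadamard_CN_space assms(1,2) .
  have "\<exists>b. geodesic_line (X i) b" for i
    using gh(3) unfolding independent_regular_axial_def regular_axial_def rank_one_def is_axis_def by blast
  then obtain b where b: "\<And>i. geodesic_line (X i) (b i)" by metis
  have act: "product_space_action X \<Gamma> x" if "x \<in> mspace (L2_metric X)" for x
    using that CN assms(3) by (simp add: product_space_action_def)
  show ?thesis
  proof (intro conjI ballI)
    fix x assume x: "x \<in> mspace (L2_metric X)"
    have "limit_slopes X \<Gamma> x = product_space_action.asymptotic_directions X \<Gamma> x"
      using product_space_action.limit_slopes_subset[OF act[OF x]] product_space_action.asymptotic_directions_subset[OF act[OF x]] b by blast
    also have "\<dots> = limit_cone X \<Gamma> \<inter> slope_sphere" by (rule product_space_action.asymptotic_directions_eq[OF act[OF x] gh])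
    finally show "limit_slopes X \<Gamma> x = limit_cone X \<Gamma> \<inter> slope_sphere" .
  next
    \<comment> \<open>The limit cone does not involve a base point; the axes supply one.\<close>
    have "(\<lambda>i. b i 0) \<in> mspace (L2_metric X)" using b by (auto simp: geodesic_line_def)
    from product_space_action.convex_limit_cone[OF act[OF this] gh] show "convex (limit_cone X \<Gamma>)" .
  qed
qed

end
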